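(* With \[ \vartheta_4(a_0,a_1,a_2,a_3):=\frac{1}{4J_4}\Big[a_0\overline{J}_{4,8}\overline{J}_{6,16}+a_1q^2\overline{J}_{0,8}\overline{J}_{14,16}+a_2q\overline{J}_{4,8}\overline{J}_{14,16}+a_3q\overline{J}_{0,8}\overline{J}_{6,16}\Big] \] and \[ G_4(b_0,b_1):=b_0\big(-1+q^2g(-q^2;q^{16})\big)+b_1\,q^5g(-q^6;q^{16}), \] we have \begin{align*} D(0,4)&=\vartheta_4(-5,3,1,1)+2G_4(-1,0),\\ D(1,4)=D(3,4)&=\vartheta_4(3,-1,-3,1)+G_4(1,1),\\ D(2,4)&=\vartheta_4(-1,-1,5,-3)+2G_4(0,-1). \end{align*}
   Context: Throughout, $q$ is a complex number with $0<|q|<1$. Write $(x)_n=(x;q)_n=\prod_{i=0}^{n-1}(1-q^ix)$ and $(x)_\infty=(x;q)_\infty=\prod_{i\ge0}(1-q^ix)$. Let $j(x;q)=(x)_\infty(q/x)_\infty(q)_\infty=\sum_{n\in\mathbb Z}(-1)^nq^{\binom n2}x^n$. For integers $a$ and $m\ge1$: $J_{a,m}=j(q^a;q^m)$, $\overline{J}_{a,m}=j(-q^a;q^m)$, and $J_m=J_{m,3m}=\prod_{i\ge1}(1-q^{mi})$. The universal mock theta function is $g(x;q)=x^{-1}\big(-1+\sum_{n\ge0}\frac{q^{n^2}}{(x)_{n+1}(q/x)_n}\big)$. Ranks: define integers $N(m,n)$ ($m\in\mathbb Z$, $n\ge0$) by $\sum_{n\ge0}\sum_{m\in\mathbb Z}N(m,n)z^mq^n=\sum_{n\ge0}\frac{q^{n^2}}{(zq)_n(z^{-1}q)_n}$;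 for $n\ge1$, $N(m,n)$ is the number of partitions of $n$ with rank (largest part minus number of parts) equal to $m$, and $N(m,0)=\delta_{m,0}$. For $M\ge1$ and an integer $a$, $N(a,M;n)=\sum_{m\equiv a \pmod M}N(m,n)$. Let $p(n)$ be the number of partitions of $n$ ($p(0)=1$). The rank deviation is $D(a,M)=\sum_{n\ge0}\big(N(a,M;n)-p(n)/M\big)q^n$. *)

theory Defs
  imports "HOL-Analysis.Analysis" "HOL-Library.Multiset"
begin

definition qpoch :: "complex \<Rightarrow> complex \<Rightarrow> nat \<Rightarrow> complex" where
  "qpoch x q n = (\<Prod>i<n. 1 - q ^ i * x)"

definition qpoch_inf :: "complex \<Rightarrow> complex \<Rightarrow> complex" where
  "qpoch_inf x q = (\<Prod>i. 1 - q ^ i * x)"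

definition jfun :: "complex \<Rightarrow> complex \<Rightarrow> complex" where
  "jfun x q = qpoch_inf x q * qpoch_inf (q / x) q * qpoch_inf q q"

definition J2 :: "int \<Rightarrow> nat \<Rightarrow> complex \<Rightarrow> complex" where
  "J2 a m q = jfun (q powi a) (q ^ m)"

definition Jbar :: "int \<Rightarrow> nat \<Rightarrow> complex \<Rightarrow> complex" where
  "Jbar a m q = jfun (- (q powi a)) (q ^ m)"

definition J1 :: "nat \<Rightarrow> complex \<Rightarrow> complex" where
  "J1 m q = J2 (int m) (3 * m) q"

definition gfun :: "complex \<Rightarrow> complex \<Rightarrow> complex" where
  "gfun x q = (1 / x) * (-1 + (\<Sum>n. q ^ (n^2) / (qpoch x q (n+1) * qpoch (q / x) q n)))"

definition partitions_of :: "nat \<Rightarrow> nat multiset set" where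
  "partitions_of n = {P. (\<forall>x\<in>#P. 0 < x) \<and> sum_mset P = n}"

definition prank :: "nat multiset \<Rightarrow> int" where
  "prank P = (if P = {#} then 0 else int (Max (set_mset P)) - int (size P))"

definition pnum :: "nat \<Rightarrow> nat" where
  "pnum n = card (partitions_of n)"

definition Nrank :: "int \<Rightarrow> nat \<Rightarrow> nat" where
  "Nrank m n = card {P \<in> partitions_of n. prank P = m}"

definition NrankMod :: "int \<Rightarrow> nat \<Rightarrow> nat \<Rightarrow> nat" where
  "NrankMod a M n = card {P \<in> partitions_of n. prank P mod int M = a mod int M}"

definition Ddev :: "int \<Rightarrow> nat \<Rightarrow> complex \<Rightarrow> complex" where
  "Ddev a M q = (\<Sum>n. (of_nat (NrankMod a M n) - of_nat (pnum n) / of_nat M) * q ^ n)"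

definition theta4 :: "complex \<Rightarrow> complex \<Rightarrow> complex \<Rightarrow> complex \<Rightarrow> complex \<Rightarrow> complex" where
  "theta4 a0 a1 a2 a3 q = (1 / (4 * J1 4 q)) *
     (a0 * Jbar 4 8 q * Jbar 6 16 q + a1 * q^2 * Jbar 0 8 q * Jbar 14 16 q
      + a2 * q * Jbar 4 8 q * Jbar 14 16 q + a3 * q * Jbar 0 8 q * Jbar 6 16 q)"

definition G4 :: "complex \<Rightarrow> complex \<Rightarrow> complex \<Rightarrow> complex" where
  "G4 b0 b1 q = b0 * (-1 + q^2 * gfun (- (q^2)) (q^16)) + b1 * q^5 * gfun (- (q^6)) (q^16)"

end

theory Submission
  imports Defs "HOL-Complex_Analysis.Complex_Analysis"
begin

text \<open>
  Let \<open>T(z) = 1 + z g(z;q)\<close>. Sorting partitions by their largest part and applying the case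
  \<open>\<alpha> = 0\<close> of the Rogers--Fine identity gives \<open>(1 - z) T(z)\<close> as the rank generating function, so a
  fourth-roots-of-unity filter expresses the deviations by \<open>T(- 1)\<close> and \<open>T(\<i>)\<close>.
  Partial fractions turn \<open>T\<close> into an Appell sum, whence \<open>T(qz) = - q z\<^sup>3 T(z) + 1 - q z\<^sup>2\<close>.
  A combination of four copies of \<open>T\<close> to the base \<open>q\<^bsup>16\<^esup>\<close>, at the arguments
  \<open>- q\<^bsup>2+4j\<^esup> z\<^sup>4\<close>, satisfies the same equation. The difference, after subtracting a theta
  quotient that cancels all poles, is holomorphic on the punctured plane and multiplied by
  \<open>- q z\<^sup>3\<close> under \<open>z \<mapsto> q z\<close>; it tends to \<open>0\<close> to infinite order at the origin, so it vanishes.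
  Both required identities are the specialisations \<open>z = - 1\<close> and \<open>z = \<i>\<close> of this one.
\<close>

section \<open>q-Pochhammer products\<close>

text \<open>The argument - q^2 z^4 is dictated by the multiplier. Four steps z -> q z multiply the
  homogeneous part of the equation by q^22 z^12; for w = c z^4 the single step w -> q^16 w
  multiplies it by - q^16 c^3 z^12. Equality forces c^3 = - q^6, and c = - q^2 is the choice made.

  The multiplier - q z^3 is of the kind opposite to that of a theta function, which under z -> q z
  is divided by a power of z. Theta multipliers leave free coefficients; this one leaves none, so no
  constant has to be determined once the poles are gone. The price is that every pole must cancel.
  Modulo powers of q there are five, one at z = 1 and four at - q^2 z^4 = 1, against two free
  coefficients in the theta numerator. The residue conditions are therefore theta identities in
  their own right; they are settled by writing all theta constants involved as quotients of the
  nonzero products \<open>eta\<close>.\<close>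

lemma summable_norm_geometric_mult:
  fixes q x :: complex
  assumes "norm q < 1"
  shows "summable (\<lambda>i. norm (q ^ i * x))"
  using assms by (simp add: norm_mult norm_power summable_geometric summable_mult2)

lemma convergent_prod_qpoch:
  fixes q x :: complex
  assumes "norm q < 1"
  shows "convergent_prod (\<lambda>i. 1 - q ^ i * x)"
  using summable_norm_geometric_mult[OF assms, of x]
  by (intro abs_convergent_prod_imp_convergent_prod) (simp add: abs_convergent_prod_conv_summable)

lemma qpoch_tendsto:
  assumes "norm q < 1"
  shows "(\<lambda>n. qpoch x q n) \<longlonglongrightarrow> qpoch_inf x q"
  using convergent_prod_has_prod[OF convergent_prod_qpoch[OF assms]]
  unfolding qpoch_def qpoch_inf_def by (rule has_prod_imp_tendsto')

lemma qpoch_inf_eq_0_iff: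
  assumes "norm q < 1"
  shows "qpoch_inf x q = 0 \<longleftrightarrow> (\<exists>i. q ^ i * x = 1)"
  using has_prod_eq_0_iff[OF convergent_prod_has_prod[OF convergent_prod_qpoch[OF assms]], of x]
  unfolding qpoch_inf_def by auto

lemma qpoch_0 [simp]: "qpoch x q 0 = 1"
  by (simp add: qpoch_def)

lemma qpoch_Suc: "qpoch x q (Suc n) = qpoch x q n * (1 - q ^ n * x)"
  by (simp add: qpoch_def)

lemma qpoch_Suc_shift: "qpoch x q (Suc n) = (1 - x) * qpoch (q * x) q n"
  unfolding qpoch_def by (subst prod.lessThan_Suc_shift) (simp add: algebra_simps)

lemma qpoch_eq_0_iff: "qpoch x q n = 0 \<longleftrightarrow> (\<exists>i<n. q ^ i * x = 1)"
  by (auto simp: qpoch_def)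

lemma qpoch_inf_shift:
  assumes "norm q < 1"
  shows "qpoch_inf x q = (1 - x) * qpoch_inf (q * x) q"
proof (rule LIMSEQ_unique)
  show "(\<lambda>n. qpoch x q (Suc n)) \<longlonglongrightarrow> qpoch_inf x q"
    using qpoch_tendsto[OF assms] by (rule LIMSEQ_Suc)
  show "(\<lambda>n. qpoch x q (Suc n)) \<longlonglongrightarrow> (1 - x) * qpoch_inf (q * x) q"
    unfolding qpoch_Suc_shift by (intro tendsto_intros qpoch_tendsto assms)
qed


lemma prod_lessThan_add:
  fixes f :: "nat \<Rightarrow> 'a :: comm_monoid_mult"
  shows "prod f {..<m + n} = prod f {..<m} * (\<Prod>i<n. f (m + i))"
  by (induction n) (simp_all add: mult.assoc)

lemma qpoch_dissect: "qpoch x q (m * n) = (\<Prod>r<m. qpoch (q ^ r * x) (q ^ m) n)"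
proof (induction n)
  case (Suc n)
  have "qpoch x q (m * Suc n) = qpoch x q (m * n + m)"
    by (simp add: add.commute)
  also have "\<dots> = qpoch x q (m * n) * (\<Prod>r<m. 1 - q ^ (m * n + r) * x)"
    unfolding qpoch_def by (rule prod_lessThan_add)
  finally show ?case
    using Suc by (simp add: qpoch_Suc prod.distrib power_add power_mult mult_ac)
qed simp

lemma qpoch_inf_dissect:
  assumes "norm q < 1" "0 < m"
  shows "qpoch_inf x q = (\<Prod>r<m. qpoch_inf (q ^ r * x) (q ^ m))"
proof (rule LIMSEQ_unique)
  have "strict_mono (\<lambda>n. m * n)"
    using assms(2) by (auto intro: strict_monoI)
  then show "(\<lambda>n. qpoch x q (m * n)) \<longlonglongrightarrow> qpoch_inf x q"
    using LIMSEQ_subseq_LIMSEQ[OF qpoch_tendsto[OF assms(1)]] by (simp add: o_def)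
  have "norm (q ^ m) < 1"
    using assms by (simp add: norm_power power_less_one_iff)
  then show "(\<lambda>n. qpoch x q (m * n)) \<longlonglongrightarrow> (\<Prod>r<m. qpoch_inf (q ^ r * x) (q ^ m))"
    unfolding qpoch_dissect by (intro tendsto_prod qpoch_tendsto)
qed

lemma qpoch_inf_dissect2:
  assumes "norm q < 1"
  shows "qpoch_inf x q = qpoch_inf x (q\<^sup>2) * qpoch_inf (q * x) (q\<^sup>2)"
  using qpoch_inf_dissect[OF assms, of 2 x] by (simp add: numeral_2_eq_2)

lemma qpoch_inf_dissect3:
  assumes "norm q < 1"
  shows "qpoch_inf x q = qpoch_inf x (q ^ 3) * qpoch_inf (q * x) (q ^ 3) * qpoch_inf (q\<^sup>2 * x) (q ^ 3)"
  using qpoch_inf_dissect[OF assms, of 3 x] by (simp add: numeral_3_eq_3 numeral_2_eq_2 mult_ac)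

lemma qpoch_inf_mult_minus:
  assumes "norm q < 1"
  shows "qpoch_inf x q * qpoch_inf (- x) q = qpoch_inf (x\<^sup>2) (q\<^sup>2)"
proof (rule LIMSEQ_unique)
  show "(\<lambda>n. qpoch x q n * qpoch (- x) q n) \<longlonglongrightarrow> qpoch_inf x q * qpoch_inf (- x) q"
    by (intro tendsto_intros qpoch_tendsto assms)
  have "qpoch x q n * qpoch (- x) q n = qpoch (x\<^sup>2) (q\<^sup>2) n" for n
    unfolding qpoch_def prod.distrib[symmetric]
    by (intro prod.cong) (auto simp: algebra_simps power2_eq_square power_mult_distrib)
  moreover have "norm (q\<^sup>2) < 1"
    using assms by (simp add: norm_power power_less_one_iff)
  ultimately show "(\<lambda>n. qpoch x q n * qpoch (- x) q n) \<longlonglongrightarrow> qpoch_inf (x\<^sup>2) (q\<^sup>2)"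
    by (simp add: qpoch_tendsto)
qed

lemma holomorphic_qpoch_inf:
  assumes "norm q < 1"
  shows "(\<lambda>x. qpoch_inf x q) holomorphic_on A"
proof -
  have "(\<lambda>x. qpoch_inf x q) holomorphic_on ball 0 r" for r
  proof -
    have sm: "uniformly_convergent_on (cball 0 r) (\<lambda>N x. \<Sum>n<N. norm ((1 - q ^ n * x) - 1))"
    proof (rule Weierstrass_m_test')
      show "summable (\<lambda>n. norm (q ^ n * of_real r))"
        by (rule summable_norm_geometric_mult[OF assms])
    qed (auto simp: norm_mult intro!: mult_left_mono)
    have "uniformly_convergent_on (cball 0 r) (\<lambda>N x. \<Prod>n<N. 1 - q ^ n * x)"
      by (rule uniformly_convergent_on_prod'[OF _ _ sm]) (auto intro!: continuous_intros)
    then obtain l where l: "uniform_limit (cball 0 r) (\<lambda>N x. qpoch x q N) l sequentially"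
      unfolding uniformly_convergent_on_def qpoch_def by blast
    have "l x = qpoch_inf x q" if "x \<in> cball 0 r" for x
      using LIMSEQ_unique[OF tendsto_uniform_limitI[OF l that] qpoch_tendsto[OF assms]] .
    then have "uniform_limit (cball 0 r) (\<lambda>N x. qpoch x q N) l sequentially \<longleftrightarrow>
      uniform_limit (cball 0 r) (\<lambda>N x. qpoch x q N) (\<lambda>x. qpoch_inf x q) sequentially"
      by (intro uniform_limit_cong' refl)
    with l have "uniform_limit (cball 0 r) (\<lambda>N x. qpoch x q N) (\<lambda>x. qpoch_inf x q) sequentially"
      by simp
    then show ?thesis
      by (rule holomorphic_uniform_limit[rotated])
         (auto intro!: always_eventually continuous_intros holomorphic_intros simp: qpoch_def)
  qed
  then have "(\<lambda>x. qpoch_inf x q) holomorphic_on (\<Union>r. ball 0 r)"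
    by (subst holomorphic_on_UN_open) auto
  moreover have "A \<subseteq> (\<Union>r. ball 0 r)"
    by (auto simp: gt_ex)
  ultimately show ?thesis
    by (rule holomorphic_on_subset)
qed

lemmas holomorphic_on_qpoch_inf [holomorphic_intros] =
  holomorphic_on_compose[OF _ holomorphic_qpoch_inf, unfolded o_def]

lemma qpoch_inf_qq_nonzero:
  assumes "norm q < 1"
  shows "qpoch_inf q q \<noteq> 0"
proof
  assume "qpoch_inf q q = 0"
  then obtain i where "q ^ Suc i = 1"
    using qpoch_inf_eq_0_iff[OF assms] by (auto simp: mult.commute)
  then have "norm q ^ Suc i = 1"
    by (metis norm_one norm_power)
  then show False
    using assms by (metis less_irrefl norm_ge_zero power_Suc_less_one power_one_right power_less_one_iff zero_less_Suc)
qed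

lemma qpoch_qq_nonzero:
  assumes "norm q < 1"
  shows "qpoch q q n \<noteq> 0"
  using qpoch_inf_qq_nonzero[OF assms] by (auto simp: qpoch_eq_0_iff qpoch_inf_eq_0_iff[OF assms])

text \<open>A sequence with a nonzero limit eventually has bounded reciprocals. This constant is the
  majorant behind most exchanges of limits that follow.\<close>

lemma bounded_inverse_qpoch:
  assumes "norm q < 1"
  obtains K where "0 < K" "\<And>n. norm (inverse (qpoch q q n)) \<le> K"
proof -
  have "(\<lambda>n. inverse (qpoch q q n)) \<longlonglongrightarrow> inverse (qpoch_inf q q)"
    by (intro tendsto_intros qpoch_tendsto assms qpoch_inf_qq_nonzero)
  then have "Bseq (\<lambda>n. inverse (qpoch q q n))"
    by (intro convergent_imp_Bseq) (auto simp: convergent_def)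
  then show ?thesis
    using that by (auto simp: Bseq_def)
qed

section \<open>Theta products: reflection, shift and zeros\<close>

lemma jfun_commute:
  assumes "q \<noteq> 0" "x \<noteq> 0"
  shows "jfun (q / x) q = jfun x q"
  using assms by (simp add: jfun_def mult_ac)

lemma jfun_shift:
  assumes "norm q < 1" "q \<noteq> 0" "x \<noteq> 0"
  shows "jfun (q * x) q = - jfun x q / x"
proof -
  have "jfun (q * x) q = qpoch_inf (q * x) q * ((1 - 1 / x) * qpoch_inf (q / x) q) * qpoch_inf q q"
    using qpoch_inf_shift[OF assms(1), of "1 / x"] assms by (simp add: jfun_def)
  also have "\<dots> = - ((1 - x) * qpoch_inf (q * x) q * qpoch_inf (q / x) q * qpoch_inf q q) / x"
    using assms by (simp add: field_simps)
  finally show ?thesis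
    using qpoch_inf_shift[OF assms(1), of x] by (simp add: jfun_def)
qed

lemma jfun_eq_0_iff:
  assumes "norm q < 1" "q \<noteq> 0" "x \<noteq> 0"
  shows "jfun x q = 0 \<longleftrightarrow> (\<exists>n::int. x * q powi n = 1)"
proof
  assume "jfun x q = 0"
  then consider i where "q ^ i * x = 1" | i where "q ^ i * (q / x) = 1"
    using qpoch_inf_qq_nonzero[OF assms(1)] by (auto simp: jfun_def qpoch_inf_eq_0_iff[OF assms(1)])
  then show "\<exists>n::int. x * q powi n = 1"
  proof cases
    case 1
    then show ?thesis
      by (intro exI[of _ "int i"]) (simp add: mult.commute)
  next
    case 2
    then have "x = q ^ Suc i"
      using assms by (simp add: field_simps)
    then have "x * q powi (- int (Suc i)) = 1"
      using assms unfolding power_int_minus by (simp add: field_simps del: of_nat_Suc)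
    then show ?thesis by blast
  qed
next
  assume "\<exists>n::int. x * q powi n = 1"
  then obtain n :: int where n: "x * q powi n = 1" by blast
  show "jfun x q = 0"
  proof (cases "n \<ge> 0")
    case True
    then have "q ^ nat n * x = 1"
      using n by (simp add: power_int_def mult.commute)
    then show ?thesis
      by (auto simp: jfun_def qpoch_inf_eq_0_iff[OF assms(1)])
  next
    case False
    \<comment> \<open>The vanishing factor 1 - q^(i+1)/x belongs to
      \<open>qpoch_inf (q / x) q\<close>, whose exponents of q start at 1; hence the offset.\<close>
    define i where "i = nat (- n) - 1"
    have "n = - int (Suc i)"
      using False by (simp add: i_def)
    then have "q ^ i * (q / x) = 1"
      using n assms by (simp add: power_int_minus field_simps del: of_nat_Suc)
    then show ?thesis
      by (auto simp: jfun_def qpoch_inf_eq_0_iff[OF assms(1)])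
  qed
qed

lemma holomorphic_jfun:
  assumes "norm q < 1" "0 \<notin> A"
  shows "(\<lambda>x. jfun x q) holomorphic_on A"
  unfolding jfun_def using assms by (auto intro!: holomorphic_intros)

section \<open>The Jacobi triple product\<close>

definition tri :: "int \<Rightarrow> int" where
  "tri k = k * (k - 1) div 2"

lemma two_tri: "2 * tri k = k * (k - 1)"
  unfolding tri_def by (rule dvd_mult_div_cancel) simp

lemma tri_add: "tri (k + l) = tri k + tri l + k * l"
  using two_tri[of k] two_tri[of l] two_tri[of "k + l"] by (simp add: algebra_simps)

lemma tri_0 [simp]: "tri 0 = 0" and tri_1 [simp]: "tri 1 = 0" and tri_neg_1 [simp]: "tri (- 1) = 1"
  by (simp_all add: tri_def)

lemma tri_add_1: "tri (k + 1) = tri k + k"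
  by (simp add: tri_add)

lemma tri_diff_1: "tri (k - 1) = tri k - k + 1"
  using tri_add[of k "- 1"] by simp

lemma tri_uminus: "tri (- k) = tri k + k"
  using two_tri[of k] two_tri[of "- k"] by (simp add: algebra_simps)

text \<open>With the convention \<open>1/(q)\<^sub>m = 0\<close> for \<open>m < 0\<close>, finite sums over \<open>{-n..n}\<close> become sums over all integers.\<close>

definition inv_qfact :: "complex \<Rightarrow> int \<Rightarrow> complex" where
  "inv_qfact q m = (if m < 0 then 0 else inverse (qpoch q q (nat m)))"

lemma inv_qfact_neg [simp]: "m < 0 \<Longrightarrow> inv_qfact q m = 0"
  by (simp add: inv_qfact_def)

lemma inv_qfact_of_nat: "inv_qfact q (int m) = inverse (qpoch q q m)"
  by (simp add: inv_qfact_def)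

lemma inv_qfact_0 [simp]: "inv_qfact q 0 = 1"
  by (simp add: inv_qfact_def)

lemma inv_qfact_diff_1:
  assumes "norm q < 1"
  shows "inv_qfact q (m - 1) = (1 - q powi m) * inv_qfact q m"
proof (cases "m \<ge> 1")
  case True
  define i where "i = nat (m - 1)"
  have m: "m = int (Suc i)"
    using True by (simp add: i_def)
  have "qpoch q q (Suc i) \<noteq> 0" "qpoch q q i \<noteq> 0"
    using qpoch_qq_nonzero[OF assms] by auto
  then have "inverse (qpoch q q i) = (1 - q ^ Suc i) * inverse (qpoch q q (Suc i))"
    by (simp add: qpoch_Suc field_simps)
  moreover have "m - 1 = int i"
    using m by simp
  ultimately show ?thesis
    unfolding m using inv_qfact_of_nat[of q "Suc i"] inv_qfact_of_nat[of q i]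
    by (simp add: power_int_def nat_add_distrib)
next
  case False
  then show ?thesis
    by (cases "m = 0") auto
qed

text \<open>Read a = q^(n+1-k) and b = q^(n+1+k), so that a b = q^(2n+2). This is the recurrence for
  the coefficient of x^k after division by the common factor.\<close>

lemma finite_triple_product_aux:
  fixes a b q :: complex
  assumes "q \<noteq> 0"
  shows "(1 - a * b / q) * (1 - a * b) =
    (1 + a * b / q) * ((1 - a) * (1 - b)) + a * ((1 - b / q) * (1 - b)) + b * ((1 - a / q) * (1 - a))"
  using assms by (simp add: field_simps)

text \<open>Passing to n + 1 multiplies the product by (1 + q^n x)(1 + q^(n+1)/x), which couples the
  coefficient of x^k to its two neighbours. It is the q-binomial theorem in centred form, so that
  both sides have a limit as n grows.\<close>

lemma finite_triple_product:
  fixes q x :: complex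
  assumes q: "q \<noteq> 0" "norm q < 1" and x: "x \<noteq> 0"
  shows "((\<lambda>k. q powi tri k * x powi k * (inv_qfact q (int n - k) * inv_qfact q (int n + k)))
    has_sum (qpoch (- x) q n * qpoch (- (q / x)) q n * inverse (qpoch q q (2 * n)))) UNIV"
proof (induction n)
  case 0
  have "((\<lambda>k. q powi tri k * x powi k * (inv_qfact q (int 0 - k) * inv_qfact q (int 0 + k)))
      has_sum (\<Sum>k\<in>{0}. q powi tri k * x powi k * (inv_qfact q (int 0 - k) * inv_qfact q (int 0 + k)))) UNIV"
  proof (rule has_sum_finite_neutralI)
    fix k :: int
    assume "k \<in> UNIV - {0}"
    then have "k < 0 \<or> k > 0" by auto
    then show "q powi tri k * x powi k * (inv_qfact q (int 0 - k) * inv_qfact q (int 0 + k)) = 0"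
      by auto
  qed auto
  then show ?case by simp
next
  case (Suc n)
  define F where "F n k = q powi tri k * x powi k * (inv_qfact q (int n - k) * inv_qfact q (int n + k))" for n :: nat and k :: int
  define S where "S = qpoch (- x) q n * qpoch (- (q / x)) q n * inverse (qpoch q q (2 * n))"
  have IH: "(F n has_sum S) UNIV"
    using Suc unfolding F_def S_def .
  have "bij_betw (\<lambda>k::int. k - 1) UNIV UNIV" "bij_betw (\<lambda>k::int. k + 1) UNIV UNIV"
    by (rule bij_betwI[of _ _ _ "\<lambda>k. k + 1"]; simp)
       (rule bij_betwI[of _ _ _ "\<lambda>k. k - 1"]; simp)
  then have IH1: "((\<lambda>k. F n (k - 1)) has_sum S) UNIV" and IH2: "((\<lambda>k. F n (k + 1)) has_sum S) UNIV"
    using IH by (simp_all add: has_sum_reindex_bij_betw[where f = "F n"])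
  \<comment> \<open>The right side collects the four terms of (1 + q^n x)(1 + q^(n+1)/x); the factor
    on the left is (q)_(2n+2)/(q)_(2n).\<close>
  have *: "(1 - q ^ (2 * n + 1)) * (1 - q ^ (2 * n + 2)) * F (Suc n) k =
    (1 + q ^ (2 * n + 1)) * F n k + (q ^ n * x) * F n (k - 1) + (q ^ (n + 1) / x) * F n (k + 1)" for k
  proof -
    \<comment> \<open>Everything is expressed by the reciprocals at n + 1: lowering an index
      multiplies by some 1 - q^m, and this remains true at the boundary where the reciprocals become
      0.\<close>
    define a b where "a = q powi (int n + 1 - k)" and "b = q powi (int n + 1 + k)"
    define ra rb where "ra = inv_qfact q (int n + 1 - k)" and "rb = inv_qfact q (int n + 1 + k)"
    define Q where "Q = q powi tri k * x powi k"
    have aq: "q powi (int n - k) = a / q" and bq: "q powi (int n + k) = b / q"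
      using q by (simp_all add: a_def b_def power_int_add power_int_diff field_simps)
    have shifts: "int n + 1 - k - 1 = int n - k" "int n + 1 + k - 1 = int n + k"
      "int n - k - 1 = int n - 1 - k" "int n + k - 1 = int n - 1 + k"
      by simp_all
    have r1: "inv_qfact q (int n - k) = (1 - a) * ra" "inv_qfact q (int n + k) = (1 - b) * rb"
      using inv_qfact_diff_1[OF q(2), of "int n + 1 - k"] inv_qfact_diff_1[OF q(2), of "int n + 1 + k"]
      unfolding shifts a_def b_def ra_def rb_def .
    have r2: "inv_qfact q (int n - 1 - k) = (1 - a / q) * ((1 - a) * ra)"
      "inv_qfact q (int n - 1 + k) = (1 - b / q) * ((1 - b) * rb)"
      using inv_qfact_diff_1[OF q(2), of "int n - k"] inv_qfact_diff_1[OF q(2), of "int n + k"]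
      unfolding shifts r1 aq bq .
    note r = r1 r2
    have ab: "a * b = q powi (2 * int n + 2)"
      using q by (simp add: a_def b_def flip: power_int_add)
    have ab2: "a * b = q ^ (2 * n + 2)"
      unfolding ab by (simp add: power_int_def nat_add_distrib nat_mult_distrib)
    have ab1: "a * b / q = q ^ (2 * n + 1)"
      using q unfolding ab2 by (simp add: field_simps)
    have F0: "F n k = Q * (((1 - a) * (1 - b)) * (ra * rb))"
      unfolding F_def r Q_def by simp
    have FS: "F (Suc n) k = Q * (ra * rb)"
      unfolding F_def Q_def ra_def rb_def by (simp add: algebra_simps)
    have Q1: "(q ^ n * x) * (q powi tri (k - 1) * x powi (k - 1)) = a * Q"
      unfolding Q_def a_def tri_diff_1 using q x
      by (simp add: power_int_add power_int_diff field_simps)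
    have Q2: "(q ^ (n + 1) / x) * (q powi tri (k + 1) * x powi (k + 1)) = b * Q"
      unfolding Q_def b_def tri_add_1 using q x
      by (simp add: power_int_add power_int_diff field_simps)
    have "(q ^ n * x) * F n (k - 1) = ((q ^ n * x) * (q powi tri (k - 1) * x powi (k - 1))) *
        (inv_qfact q (int n + 1 - k) * inv_qfact q (int n - 1 + k))"
      unfolding F_def by (simp add: algebra_simps)
    then have F1: "(q ^ n * x) * F n (k - 1) = Q * ((a * ((1 - b / q) * (1 - b))) * (ra * rb))"
      unfolding Q1 r by (simp add: ra_def)
    have "(q ^ (n + 1) / x) * F n (k + 1) = ((q ^ (n + 1) / x) * (q powi tri (k + 1) * x powi (k + 1))) *
        (inv_qfact q (int n - 1 - k) * inv_qfact q (int n + 1 + k))"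
      unfolding F_def by (simp add: algebra_simps)
    then have F2: "(q ^ (n + 1) / x) * F n (k + 1) = Q * ((b * ((1 - a / q) * (1 - a))) * (ra * rb))"
      unfolding Q2 r by (simp add: rb_def)
    show ?thesis
      unfolding FS F0 F1 F2 ab1[symmetric] ab2[symmetric] finite_triple_product_aux[OF q(1), of a b]
      by (simp only: distrib_left distrib_right mult.assoc mult.left_commute)
  qed
  define P where "P = (1 - q ^ (2 * n + 1)) * (1 - q ^ (2 * n + 2))"
  have P: "P \<noteq> 0"
    using qpoch_qq_nonzero[OF q(2), of "2 * n + 2"] by (auto simp: P_def qpoch_Suc mult.commute)
  have "((\<lambda>k. P * F (Suc n) k) has_sum
    ((1 + q ^ (2 * n + 1)) * S + (q ^ n * x) * S + (q ^ (n + 1) / x) * S)) UNIV"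
    unfolding P_def * by (intro has_sum_add has_sum_cmult_right IH IH1 IH2)
  then have "((\<lambda>k. inverse P * (P * F (Suc n) k)) has_sum
      inverse P * ((1 + q ^ (2 * n + 1)) * S + (q ^ n * x) * S + (q ^ (n + 1) / x) * S)) UNIV"
    by (rule has_sum_cmult_right)
  moreover have "(\<lambda>k. inverse P * (P * F (Suc n) k)) = F (Suc n)"
    using P by (auto simp: field_simps)
  ultimately have "(F (Suc n) has_sum
      inverse P * ((1 + q ^ (2 * n + 1)) * S + (q ^ n * x) * S + (q ^ (n + 1) / x) * S)) UNIV"
    by simp
  moreover have "(1 + q ^ (2 * n + 1)) * S + (q ^ n * x) * S + (q ^ (n + 1) / x) * S =
    (1 + q ^ n * x) * (1 + q ^ n * (q / x)) * S"
    using x by (simp add: field_simps power_add mult_2_right)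
  ultimately have 1: "(F (Suc n) has_sum inverse P * ((1 + q ^ n * x) * (1 + q ^ n * (q / x)) * S)) UNIV"
    by simp
  have 2: "inverse (qpoch q q (2 * Suc n)) = inverse P * inverse (qpoch q q (2 * n))"
    by (simp add: P_def qpoch_Suc mult_ac)
  have "inverse P * ((1 + q ^ n * x) * (1 + q ^ n * (q / x)) * S) =
    qpoch (- x) q (Suc n) * qpoch (- (q / x)) q (Suc n) * inverse (qpoch q q (2 * Suc n))"
    unfolding 2 qpoch_Suc[of _ _ n] S_def by simp
  with 1 show ?case
    unfolding F_def by simp
qed

text \<open>Dominated convergence for unordered sums: the majorant makes the finite partial sums
  converge uniformly in n, which permits the exchange of the two limits.\<close>

lemma tannery_infsum:
  fixes f :: "'a \<Rightarrow> nat \<Rightarrow> complex"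
  assumes lim: "\<And>x. (\<lambda>n. f x n) \<longlonglongrightarrow> g x"
    and bound: "\<And>x n. norm (f x n) \<le> M x" and M: "M summable_on UNIV"
  shows "g summable_on UNIV" "(\<lambda>n. \<Sum>\<^sub>\<infinity>x. f x n) \<longlonglongrightarrow> (\<Sum>\<^sub>\<infinity>x. g x)"
proof -
  have "norm (g x) \<le> M x" for x
    using bound[of x] by (intro LIMSEQ_le_const2[OF tendsto_norm[OF lim[of x]]]) auto
  then have "(\<lambda>x. norm (g x)) summable_on UNIV"
    by (intro Infinite_Sum.abs_summable_on_comparison_test'[OF M])
  then show *: "g summable_on UNIV"
    by (rule abs_summable_summable)
  show "(\<lambda>n. \<Sum>\<^sub>\<infinity>x. f x n) \<longlonglongrightarrow> (\<Sum>\<^sub>\<infinity>x. g x)"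
  proof (rule swap_uniform_limit')
    show "uniform_limit UNIV (\<lambda>X n. \<Sum>x\<in>X. f x n) (\<lambda>n. \<Sum>\<^sub>\<infinity>x. f x n) (finite_subsets_at_top UNIV)"
      using bound M by (rule Weierstrass_m_test_general)
    show "(sum g \<longlongrightarrow> (\<Sum>\<^sub>\<infinity>x. g x)) (finite_subsets_at_top UNIV)"
      using * by (rule infsum_tendsto)
    show "\<forall>\<^sub>F X in finite_subsets_at_top UNIV. (\<lambda>n. \<Sum>x\<in>X. f x n) \<longlonglongrightarrow> sum g X"
      by (intro always_eventually allI tendsto_sum lim)
  qed auto
qed

lemma summable_on_int:
  fixes f :: "int \<Rightarrow> real"
  assumes "summable (\<lambda>n. norm (f (int n)))" "summable (\<lambda>n. norm (f (- int n)))"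
  shows "f summable_on UNIV"
proof -
  have "(\<lambda>n. f (int n)) summable_on UNIV" "(\<lambda>n. f (- int n)) summable_on UNIV"
    using assms by (auto intro: norm_summable_imp_summable_on)
  then have "f summable_on range int" "f summable_on range (\<lambda>n. - int n)"
    by (simp_all add: summable_on_reindex inj_def o_def)
  then have "f summable_on (range int \<union> range (\<lambda>n. - int n))"
    by (rule summable_on_union)
  moreover have "range int \<union> range (\<lambda>n. - int n) = UNIV"
    by (auto simp: image_iff) (metis int_cases2)
  ultimately show ?thesis by simp
qed

lemma summable_tri_nat:
  fixes r y :: real
  assumes r: "0 < r" "r < 1" and y: "0 < y"
  shows "summable (\<lambda>n. norm (r powi tri (int n) * y powi int n))"
proof -
  have "(\<lambda>n. r ^ n * y) \<longlonglongrightarrow> 0 * y"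
    using r by (intro tendsto_intros LIMSEQ_realpow_zero) auto
  then have "eventually (\<lambda>n. r ^ n * y < 1 / 2) sequentially"
    by (rule order_tendstoD) simp
  then obtain N where N: "\<And>n. n \<ge> N \<Longrightarrow> r ^ n * y < 1 / 2"
    by (auto simp: eventually_sequentially)
  show ?thesis
  proof (rule summable_ratio_test)
    fix n assume "n \<ge> N"
    have "norm (norm (r powi tri (int (Suc n)) * y powi int (Suc n))) =
      (r ^ n * y) * norm (norm (r powi tri (int n) * y powi int n))"
      using r y tri_add_1[of "int n"]
      by (simp add: power_int_add norm_mult abs_mult add.commute[of 1] mult_ac)
    also have "\<dots> \<le> 1 / 2 * norm (norm (r powi tri (int n) * y powi int n))"
      using N[OF \<open>n \<ge> N\<close>] by (intro mult_right_mono) auto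
    finally show "norm (norm (r powi tri (int (Suc n)) * y powi int (Suc n)))
      \<le> 1 / 2 * norm (norm (r powi tri (int n) * y powi int n))" .
  qed simp
qed

lemma summable_on_tri:
  fixes r y :: real
  assumes r: "0 < r" "r < 1" and y: "0 < y"
  shows "(\<lambda>k. r powi tri k * y powi k) summable_on UNIV"
proof (rule summable_on_int)
  show "summable (\<lambda>n. norm (r powi tri (int n) * y powi int n))"
    using assms by (rule summable_tri_nat)
  \<comment> \<open>Because tri (-k) = tri k + k, the negative half is the positive one with y
    replaced by r / y.\<close>
  have "summable (\<lambda>n. norm (r powi tri (int n) * (r / y) powi int n))"
    using assms by (intro summable_tri_nat) auto
  also have "(\<lambda>n. norm (r powi tri (int n) * (r / y) powi int n)) =
      (\<lambda>n. norm (r powi tri (- int n) * y powi (- int n)))"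
    using r y by (intro ext) (simp add: tri_uminus power_int_add power_int_minus field_simps)
  finally show "summable (\<lambda>n. norm (r powi tri (- int n) * y powi (- int n)))" .
qed

lemma summable_on_tri_complex:
  fixes q x :: complex
  assumes "q \<noteq> 0" "norm q < 1" "x \<noteq> 0"
  shows "(\<lambda>k. norm (q powi tri k * x powi k)) summable_on UNIV"
  using summable_on_tri[of "norm q" "norm x"] assms by (simp add: norm_mult norm_power_int)

lemma bounded_inv_qfact:
  assumes "norm q < 1"
  obtains K where "0 < K" "\<And>m. norm (inv_qfact q m) \<le> K"
proof -
  obtain K where "0 < K" "\<And>n. norm (inverse (qpoch q q n)) \<le> K"
    using bounded_inverse_qpoch[OF assms] by metis
  then show ?thesis
    using that[of K] by (auto simp: inv_qfact_def)
qed

lemma inv_qfact_tendsto: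
  assumes "norm q < 1"
  shows "(\<lambda>n. inv_qfact q (int n + k)) \<longlonglongrightarrow> inverse (qpoch_inf q q)"
proof (rule LIMSEQ_offset)
  \<comment> \<open>After the shift by \<open>nat (- k)\<close> the index is never negative, so the
    default value 0 of \<open>inv_qfact\<close> is not met.\<close>
  have "inv_qfact q (int (n + nat (- k)) + k) = inverse (qpoch q q (n + nat k))" for n
    using inv_qfact_of_nat[of q "n + nat k"] by (cases "0 \<le> k") auto
  then show "(\<lambda>n. inv_qfact q (int (n + nat (- k)) + k)) \<longlonglongrightarrow> inverse (qpoch_inf q q)"
    by (simp only:) (intro LIMSEQ_ignore_initial_segment tendsto_intros qpoch_tendsto
      assms qpoch_inf_qq_nonzero)
qed

text \<open>In the finite form each of the two reciprocals tends to 1/(q)_inf, while the product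
  side carries only one such factor; clearing them leaves the third factor of \<open>jfun\<close>.
  The majorant is the theta series in absolute values times a bound for the reciprocals.\<close>

theorem jacobi_triple_product:
  fixes q x :: complex
  assumes q: "q \<noteq> 0" "norm q < 1" and x: "x \<noteq> 0"
  shows "((\<lambda>k. q powi tri k * x powi k) has_sum jfun (- x) q) UNIV"
proof -
  define E where "E = qpoch_inf q q"
  have E: "E \<noteq> 0"
    using qpoch_inf_qq_nonzero q by (simp add: E_def)
  obtain K where K: "0 < K" "\<And>m. norm (inv_qfact q m) \<le> K"
    using bounded_inv_qfact[OF q(2)] by metis
  define f where "f k n = q powi tri k * x powi k * (inv_qfact q (int n - k) * inv_qfact q (int n + k))"
    for k and n :: nat
  define g where "g k = q powi tri k * x powi k * (inverse E * inverse E)" for k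
  have lim: "(\<lambda>n. f k n) \<longlonglongrightarrow> g k" for k
    unfolding f_def g_def E_def using inv_qfact_tendsto[OF q(2), of "- k"] inv_qfact_tendsto[OF q(2), of k]
    by (intro tendsto_intros) auto
  have bound: "norm (f k n) \<le> norm (q powi tri k * x powi k) * (K * K)" for k n
    unfolding f_def norm_mult[of "_ * _"] using K
    by (intro mult_mono mult_left_mono) (auto simp: norm_mult intro!: mult_mono)
  have sm: "(\<lambda>k. norm (q powi tri k * x powi k) * (K * K)) summable_on UNIV"
    by (intro summable_on_cmult_left summable_on_tri_complex assms)
  have "(\<lambda>n. \<Sum>\<^sub>\<infinity>k. f k n) = (\<lambda>n. qpoch (- x) q n * qpoch (- (q / x)) q n * inverse (qpoch q q (2 * n)))"
    unfolding f_def by (intro ext infsumI finite_triple_product assms)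
  moreover have "(\<lambda>n. qpoch q q (2 * n)) \<longlonglongrightarrow> E"
    unfolding E_def using LIMSEQ_subseq_LIMSEQ[OF qpoch_tendsto[OF q(2)], of "\<lambda>n. 2 * n"]
    by (simp add: o_def strict_mono_def)
  then have "(\<lambda>n. qpoch (- x) q n * qpoch (- (q / x)) q n * inverse (qpoch q q (2 * n))) \<longlonglongrightarrow>
      qpoch_inf (- x) q * qpoch_inf (- (q / x)) q * inverse E"
    using E by (intro tendsto_intros qpoch_tendsto q)
  ultimately have "infsum g UNIV = qpoch_inf (- x) q * qpoch_inf (- (q / x)) q * inverse E"
    using LIMSEQ_unique[OF tannery_infsum(2)[OF lim bound sm]] by simp
  then have "(g has_sum (qpoch_inf (- x) q * qpoch_inf (- (q / x)) q * inverse E)) UNIV"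
    using tannery_infsum(1)[OF lim bound sm] by (simp add: has_sum_iff)
  then have "((\<lambda>k. g k * (E * E)) has_sum (qpoch_inf (- x) q * qpoch_inf (- (q / x)) q * inverse E * (E * E))) UNIV"
    by (rule has_sum_cmult_left)
  then show ?thesis
    using E by (simp add: g_def jfun_def field_simps E_def[symmetric])
qed

section \<open>Partial fractions of the rank series\<close>

text \<open>The summand of \<open>finite_triple_product\<close> at x = -q. It turns out to be the
  numerator over 1 - z q^k in the partial fractions of 1/((z)_(n+1) (q/z)_n).\<close>

definition rank_coeff :: "complex \<Rightarrow> nat \<Rightarrow> int \<Rightarrow> complex" where
  "rank_coeff q n k = q powi tri k * (- q) powi k * (inv_qfact q (int n - k) * inv_qfact q (int n + k))"

lemma rank_coeff_eq_0: "int n < \<bar>k\<bar> \<Longrightarrow> rank_coeff q n k = 0"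
  by (cases "k \<ge> 0") (auto simp: rank_coeff_def)

lemma one_minus_power_neq_0:
  fixes q z :: complex
  assumes "q \<noteq> 0" "z \<noteq> 0" "\<And>k. z * q powi k \<noteq> 1"
  shows "1 - q ^ n * z \<noteq> 0" "1 - q ^ n / z \<noteq> 0"
proof -
  show "1 - q ^ n * z \<noteq> 0"
    using assms(3)[of "int n"] by (auto simp: mult.commute)
  show "1 - q ^ n / z \<noteq> 0"
    using assms(3)[of "- int n"] assms(1,2) by (auto simp: power_int_minus field_simps)
qed

text \<open>Used with a = q^k and Q = q^(n+1). The prefactor is a Laurent polynomial in z: its value
  at the pole z = 1/a stays as numerator, and the difference is divisible by 1 - z a, which leaves
  two pole-free terms.\<close>

lemma partial_fractions_aux:
  fixes a b c z Q :: complex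
  assumes "a \<noteq> 0" "z \<noteq> 0" "1 - z * a \<noteq> 0"
  shows "(1 - Q * z) * (1 - Q / z) * (c / (1 - z * a)) =
    (1 - Q / a) * (1 - Q * a) * c / (1 - z * a) + Q * (c * inverse a) + (- (Q / z)) * c"
proof -
  have "(1 - Q * z) * (1 - Q / z) = (1 - Q / a) * (1 - Q * a) + Q * (inverse a - 1 / z) * (1 - z * a)"
    using assms(1,2) by (simp add: field_simps)
  then have "(1 - Q * z) * (1 - Q / z) * (c / (1 - z * a)) =
      (1 - Q / a) * (1 - Q * a) * c / (1 - z * a) + Q * (inverse a - 1 / z) * (1 - z * a) * c / (1 - z * a)"
    by (simp add: distrib_right add_divide_distrib)
  also have "Q * (inverse a - 1 / z) * (1 - z * a) * c / (1 - z * a) = Q * (inverse a - 1 / z) * c"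
    using assms(3) by simp
  finally show ?thesis
    by (simp add: algebra_simps)
qed

text \<open>Induction on n, multiplying by the two factors that are new at n + 1. The pole-free
  remainders add up to multiples of the sums of c(k) and of c(k) q^(-k). Both sums vanish, so the
  pole terms are the whole function.\<close>

theorem rank_partial_fractions:
  fixes q z :: complex
  assumes q: "q \<noteq> 0" "norm q < 1" and z: "z \<noteq> 0" "\<And>k. z * q powi k \<noteq> 1"
  shows "((\<lambda>k. rank_coeff q n k / (1 - z * q powi k)) has_sum
    inverse (qpoch z q (n + 1) * qpoch (q / z) q n)) UNIV"
proof (induction n)
  case 0
  have "((\<lambda>k. rank_coeff q 0 k / (1 - z * q powi k)) has_sum
      (\<Sum>k\<in>{0}. rank_coeff q 0 k / (1 - z * q powi k))) UNIV"
  proof (rule has_sum_finite_neutralI)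
    fix k :: int
    assume "k \<in> UNIV - {0}"
    then show "rank_coeff q 0 k / (1 - z * q powi k) = 0"
      by (simp add: rank_coeff_eq_0)
  qed auto
  then show ?case
    by (simp add: rank_coeff_def qpoch_Suc inverse_eq_divide)
next
  case (Suc n)
  define Q where "Q = q ^ Suc n"
  define A where "A = inverse (qpoch z q (n + 1) * qpoch (q / z) q n)"
  have nz: "1 - Q * z \<noteq> 0" "1 - Q / z \<noteq> 0"
    unfolding Q_def by (intro one_minus_power_neq_0 q z)+
  have c: "rank_coeff q n k = (1 - Q / q powi k) * (1 - Q * q powi k) * rank_coeff q (Suc n) k" for k
  proof -
    have "Q / q powi k = q powi (int (Suc n) - k)" "Q * q powi k = q powi (int (Suc n) + k)"
      using q(1) by (simp_all add: Q_def power_int_add power_int_diff)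
    moreover have "int n - k = int (Suc n) - k - 1" "int n + k = int (Suc n) + k - 1"
      by simp_all
    ultimately show ?thesis
      unfolding rank_coeff_def using inv_qfact_diff_1[OF q(2)] by (simp only: mult_ac)
  qed
  define c where "c = rank_coeff q (Suc n)"
  \<comment> \<open>This sum and \<open>z2\<close> are the finite triple product at x = -q and at x
    = -1; its length \<open>Suc n\<close> is positive, so each product contains the factor 1 -
    1.\<close>
  have z1: "(c has_sum 0) UNIV"
    using finite_triple_product[OF q, of "- q" "Suc n"] q
    by (simp add: c_def rank_coeff_def[abs_def] qpoch_Suc_shift mult.assoc)
  have "((\<lambda>k. q powi tri k * (- 1) powi k * (inv_qfact q (int (Suc n) - k) * inv_qfact q (int (Suc n) + k)))
      has_sum 0) UNIV"
    using finite_triple_product[OF q, of "- 1" "Suc n"] by (simp add: qpoch_Suc_shift)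
  also have "(\<lambda>k. q powi tri k * (- 1) powi k * (inv_qfact q (int (Suc n) - k) * inv_qfact q (int (Suc n) + k))) =
      (\<lambda>k. c k * inverse (q powi k))"
    using q(1) power_int_mult_distrib[of "- 1" q]
    by (auto simp: c_def rank_coeff_def field_simps)
  finally have z2: "((\<lambda>k. c k * inverse (q powi k)) has_sum 0) UNIV" .
  have "(\<lambda>k. c k / (1 - z * q powi k)) summable_on UNIV"
  proof (rule finite_nonzero_values_imp_summable_on)
    have "c k = 0" if "k \<notin> {- int (Suc n)..int (Suc n)}" for k
      unfolding c_def by (rule rank_coeff_eq_0) (use that in auto)
    then have "{k \<in> UNIV. c k / (1 - z * q powi k) \<noteq> 0} \<subseteq> {- int (Suc n)..int (Suc n)}"
      by force
    then show "finite {k \<in> UNIV. c k / (1 - z * q powi k) \<noteq> 0}"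
      by (rule finite_subset) simp
  qed
  then have S: "((\<lambda>k. c k / (1 - z * q powi k)) has_sum infsum (\<lambda>k. c k / (1 - z * q powi k)) UNIV) UNIV"
    by (rule has_sum_infsum)
  then have L: "((\<lambda>k. (1 - Q * z) * (1 - Q / z) * (c k / (1 - z * q powi k))) has_sum
      (1 - Q * z) * (1 - Q / z) * infsum (\<lambda>k. c k / (1 - z * q powi k)) UNIV) UNIV"
    by (rule has_sum_cmult_right)
  have "((\<lambda>k. (1 - Q / q powi k) * (1 - Q * q powi k) * c k / (1 - z * q powi k)) has_sum A) UNIV"
    using Suc unfolding A_def c_def c .
  then have "((\<lambda>k. (1 - Q / q powi k) * (1 - Q * q powi k) * c k / (1 - z * q powi k)
      + Q * (c k * inverse (q powi k)) + (- (Q / z)) * c k) has_sum (A + Q * 0 + (- (Q / z)) * 0)) UNIV"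
    by (intro has_sum_add has_sum_cmult_right z1 z2)
  also have "(\<lambda>k. (1 - Q / q powi k) * (1 - Q * q powi k) * c k / (1 - z * q powi k)
      + Q * (c k * inverse (q powi k)) + (- (Q / z)) * c k) =
      (\<lambda>k. (1 - Q * z) * (1 - Q / z) * (c k / (1 - z * q powi k)))"
    using q(1) z by (intro ext partial_fractions_aux[symmetric]) auto
  finally have "(1 - Q * z) * (1 - Q / z) * infsum (\<lambda>k. c k / (1 - z * q powi k)) UNIV = A"
    using has_sum_unique[OF L] by simp
  moreover have "(1 - Q * z) * (1 - Q / z) \<noteq> 0"
    using nz by (rule no_zero_divisors)
  ultimately have "infsum (\<lambda>k. c k / (1 - z * q powi k)) UNIV = A / ((1 - Q * z) * (1 - Q / z))"
    by (metis (no_types, lifting) nonzero_eq_divide_eq mult.commute)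
  also have "\<dots> = inverse (qpoch z q (Suc n + 1) * qpoch (q / z) q (Suc n))"
    by (simp add: A_def qpoch_Suc[of _ _ n] qpoch_Suc[of _ _ "Suc n"] Q_def divide_inverse mult_ac)
  finally show ?case
    using S by (simp add: c_def)
qed

text \<open>Writing \<open>C\<^sub>l\<close> for the sum, the differences satisfy
  \<open>C\<^sub>l - C\<^sub>l\<^sub>+\<^sub>1 = - q\<^sup>l\<^sup>+\<^sup>1 (C\<^sub>l\<^sub>+\<^sub>1 - C\<^sub>l\<^sub>+\<^sub>2)\<close>, which forces them to vanish;
  the limit \<open>l \<rightarrow> \<infinity>\<close> only sees the term \<open>m = 0\<close>.\<close>

lemma durfee_rectangle_sum:
  fixes q :: complex
  assumes q: "norm q < 1"
  shows "((\<lambda>m. q ^ (m\<^sup>2 + l * m) * (inverse (qpoch q q m) * inverse (qpoch q q (m + l))))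
    has_sum inverse (qpoch_inf q q)) UNIV"
proof -
  define f where "f l m = q ^ (m\<^sup>2 + l * m) * (inverse (qpoch q q m) * inverse (qpoch q q (m + l)))" for l m
  obtain K where K: "0 < K" "\<And>n. norm (inverse (qpoch q q n)) \<le> K"
    using bounded_inverse_qpoch[OF q] by metis
  have nz: "qpoch q q n \<noteq> 0" for n
    by (rule qpoch_qq_nonzero[OF q])
  have KK: "norm (inverse (qpoch q q m) * inverse (qpoch q q n)) \<le> K * K" for m n
    using K by (auto simp: norm_mult intro!: mult_mono)
  have bound: "norm (f l m) \<le> norm q ^ m * (K * K)" for l m
  proof -
    have "m \<le> m\<^sup>2 + l * m"
      by (simp add: power2_eq_square trans_le_add1)
    then have "norm q ^ (m\<^sup>2 + l * m) \<le> norm q ^ m"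
      using q by (intro power_decreasing) auto
    then show ?thesis
      unfolding f_def norm_mult[of "q ^ _"] norm_power by (intro mult_mono KK) auto
  qed
  have sumq: "summable (\<lambda>m. norm q ^ m * (K * K))"
    using q by (intro summable_mult2 summable_geometric) simp
  have smn: "summable (\<lambda>m. norm (f l m))" for l
    by (rule summable_comparison_test[OF _ sumq]) (use bound in auto)
  then have sm: "summable (f l)" for l
    by (rule summable_norm_cancel)
  define C where "C l = suminf (f l)" for l
  have rec: "C l - C (Suc l) = - (q ^ Suc l) * (C (Suc l) - C (Suc (Suc l)))" for l
  proof -
    \<comment> \<open>Over a common denominator the difference has numerator 1 - q^(m+l+1) - q^m. It
      is split so that \<open>a\<close> vanishes at m = 0 and \<open>a (Suc m)\<close> can be
      compared termwise with \<open>b m\<close>.\<close>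
    define a where "a m = q ^ (m\<^sup>2 + l * m) * (1 - q ^ m) * (inverse (qpoch q q m) * inverse (qpoch q q (m + Suc l)))" for m
    define b where "b m = q ^ (m\<^sup>2 + l * m + m + Suc l) * (inverse (qpoch q q m) * inverse (qpoch q q (m + Suc l)))" for m
    have i1: "inverse (qpoch q q (m + n)) = (1 - q ^ Suc (m + n)) * inverse (qpoch q q (m + Suc n))" for m n
      using nz[of "Suc (m + n)"] by (simp add: qpoch_Suc mult.commute)
    have i2: "(1 - q ^ Suc m) * inverse (qpoch q q (Suc m)) = inverse (qpoch q q m)" for m
      using nz[of "Suc m"] by (simp add: qpoch_Suc mult.commute)
    have fab: "f l m - f (Suc l) m = a m - b m" for m
    proof -
      have p: "q ^ (m\<^sup>2 + Suc l * m) = q ^ (m\<^sup>2 + l * m) * q ^ m"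
        "q ^ (m\<^sup>2 + l * m + m + Suc l) = q ^ (m\<^sup>2 + l * m) * q ^ Suc (m + l)"
        by (simp_all add: power_add algebra_simps)
      show ?thesis
        unfolding f_def a_def b_def i1[of m l] p by (simp add: algebra_simps)
    qed
    have norm_le_2: "norm (1 - q ^ m) \<le> 2" for m
    proof -
      have "norm (1 - q ^ m) \<le> norm (1::complex) + norm (q ^ m)"
        by (rule norm_triangle_ineq4)
      also have "\<dots> \<le> 1 + 1"
        using q by (intro add_mono) (auto simp: norm_power intro: power_le_one)
      finally show ?thesis by simp
    qed
    have sa: "summable a"
    proof (rule summable_comparison_test[OF _ summable_mult[OF sumq, of 2]], intro exI allI impI)
      fix m
      have "m \<le> m\<^sup>2 + l * m"
        by (simp add: power2_eq_square trans_le_add1)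
      then have "norm q ^ (m\<^sup>2 + l * m) \<le> norm q ^ m"
        using q by (intro power_decreasing) auto
      then have "norm (a m) \<le> (norm q ^ m * 2) * (K * K)"
        unfolding a_def norm_mult[of "_ * _"] norm_mult[of "q ^ _"] norm_power
        by (intro mult_mono) (use KK norm_le_2 K in \<open>auto simp: norm_mult\<close>)
      then show "norm (a m) \<le> 2 * (norm q ^ m * (K * K))"
        by (simp add: mult_ac)
    qed
    have "summable (\<lambda>m. f l m - f (Suc l) m)"
      by (intro summable_diff sm)
    then have sb: "summable b"
      using summable_diff[OF sa, of "\<lambda>m. f l m - f (Suc l) m"] unfolding fab by simp
    have "C l - C (Suc l) = (\<Sum>m. a m - b m)"
      unfolding C_def by (subst suminf_diff) (auto simp: sm fab)
    also have "\<dots> = suminf a - suminf b"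
      by (rule suminf_diff[symmetric]) fact+
    also have "suminf a = (\<Sum>m. a (Suc m))"
      using suminf_split_head[OF sa] by (simp add: a_def)
    also have "(\<Sum>m. a (Suc m)) - suminf b = (\<Sum>m. a (Suc m) - b m)"
      using sa sb by (subst suminf_diff) (auto simp: summable_Suc_iff)
    also have "(\<lambda>m. a (Suc m) - b m) = (\<lambda>m. - (q ^ Suc l) * (f (Suc l) m - f (Suc (Suc l)) m))"
    proof
      fix m
      have p: "q ^ ((Suc m)\<^sup>2 + l * Suc m) = q ^ Suc l * q ^ (m\<^sup>2 + Suc l * m) * q ^ m"
        "q ^ (m\<^sup>2 + l * m + m + Suc l) = q ^ Suc l * q ^ (m\<^sup>2 + Suc l * m)"
        "q ^ (m\<^sup>2 + Suc (Suc l) * m) = q ^ (m\<^sup>2 + Suc l * m) * q ^ m"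
        by (simp_all add: power_add power2_eq_square algebra_simps)
      have "a (Suc m) = q ^ ((Suc m)\<^sup>2 + l * Suc m) * (inverse (qpoch q q m) * inverse (qpoch q q (m + Suc (Suc l))))"
        unfolding a_def i2[of m, symmetric] by (simp add: mult_ac)
      then show "a (Suc m) - b m = - (q ^ Suc l) * (f (Suc l) m - f (Suc (Suc l)) m)"
        unfolding f_def b_def i1[of m "Suc l"] p by (simp add: algebra_simps)
    qed
    also have "(\<Sum>m. - (q ^ Suc l) * (f (Suc l) m - f (Suc (Suc l)) m)) =
        - (q ^ Suc l) * (C (Suc l) - C (Suc (Suc l)))"
      unfolding C_def by (subst suminf_mult) (auto simp: suminf_diff sm intro!: summable_diff)
    finally show ?thesis .
  qed
  have lim: "C \<longlonglongrightarrow> inverse (qpoch_inf q q)"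
  proof -
    have C_eq: "C l = inverse (qpoch q q l) + (\<Sum>m. f l (Suc m))" for l
      using suminf_split_head[OF sm[of l]] by (simp add: C_def f_def)
    have "(\<lambda>l. \<Sum>m. f l (Suc m)) \<longlonglongrightarrow> 0"
    proof (rule Lim_null_comparison)
      show "(\<lambda>l. norm q ^ l * (\<Sum>m. norm q ^ m * (K * K))) \<longlonglongrightarrow> 0"
        using q by (intro tendsto_mult_left_zero LIMSEQ_realpow_zero) auto
      have "norm (f l (Suc m)) \<le> norm q ^ l * (norm q ^ m * (K * K))" for l m
      proof -
        have "norm q ^ ((Suc m)\<^sup>2 + l * Suc m) \<le> norm q ^ (l + m)"
          using q by (intro power_decreasing) (auto simp: power2_eq_square)
        then have "norm (f l (Suc m)) \<le> norm q ^ (l + m) * (K * K)"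
          unfolding f_def norm_mult[of "q ^ _"] norm_power by (intro mult_mono KK) auto
        then show ?thesis
          by (simp add: power_add mult_ac)
      qed
      then have "norm (\<Sum>m. f l (Suc m)) \<le> (\<Sum>m. norm q ^ l * (norm q ^ m * (K * K)))" for l
        by (rule norm_suminf_le) (intro summable_mult sumq)
      then show "eventually (\<lambda>l. norm (\<Sum>m. f l (Suc m)) \<le> norm q ^ l * (\<Sum>m. norm q ^ m * (K * K))) sequentially"
        by (subst suminf_mult[symmetric, OF sumq]) simp
    qed
    then have "(\<lambda>l. inverse (qpoch q q l) + (\<Sum>m. f l (Suc m))) \<longlonglongrightarrow> inverse (qpoch_inf q q) + 0"
      by (intro tendsto_intros qpoch_tendsto q qpoch_inf_qq_nonzero)
    then show ?thesis
      by (simp add: C_eq[abs_def])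
  qed
  \<comment> \<open>Since norm q < 1, the recurrence makes \<open>d\<close> nondecreasing, while
    convergence of \<open>C\<close> makes it tend to 0; hence it is 0 throughout.\<close>
  define d where "d l = norm (C l - C (Suc l))" for l
  have "d l \<le> d (Suc l)" for l
  proof -
    have "norm q ^ Suc l \<le> 1"
      using q by (intro power_le_one) auto
    then have "norm q ^ Suc l * d (Suc l) \<le> 1 * d (Suc l)"
      by (intro mult_right_mono) (auto simp: d_def)
    then show ?thesis
      unfolding d_def rec[of l] norm_mult norm_minus_cancel norm_power by simp
  qed
  then have "incseq d"
    by (rule incseq_SucI)
  moreover have "d \<longlonglongrightarrow> norm (inverse (qpoch_inf q q) - inverse (qpoch_inf q q))"
    unfolding d_def by (intro tendsto_intros lim LIMSEQ_Suc)
  ultimately have "d l \<le> 0" for l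
    using incseq_le[of d] by simp
  then have "C (Suc l) = C l" for l
    by (simp add: d_def)
  then have "C l = C 0" for l
    by (induction l) auto
  then have "C = (\<lambda>_. C 0)"
    by auto
  then have "C l = inverse (qpoch_inf q q)"
    using lim LIMSEQ_unique[OF _ tendsto_const[of "C 0"]] by metis
  then show ?thesis
    using norm_summable_imp_has_sum[OF smn[of l], of "C l"] summable_sums[OF sm[of l]]
    by (simp add: C_def f_def[abs_def])
qed

section \<open>Appell sums\<close>

text \<open>\<open>rank_series z q\<close> is \<open>1 + z g(z;q)\<close>, i.e. the rank generating function divided by \<open>1 - z\<close>.\<close>

definition rank_series :: "complex \<Rightarrow> complex \<Rightarrow> complex" where
  "rank_series z q = (\<Sum>n. q ^ (n\<^sup>2) / (qpoch z q (n + 1) * qpoch (q / z) q n))"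

text \<open>Equal to (-1)^k q^(k(3k+1)/2), with the pentagonal exponents; written to base q^3 so
  that the triple product sums it directly.\<close>

definition appell_coeff :: "complex \<Rightarrow> int \<Rightarrow> complex" where
  "appell_coeff q k = (q ^ 3) powi tri k * (- (q\<^sup>2)) powi k"

text \<open>The index set is a parameter so that the singular term k = 0 can be split off near z =
  1.\<close>

definition appell :: "int set \<Rightarrow> complex \<Rightarrow> complex \<Rightarrow> complex" where
  "appell I z q = (\<Sum>\<^sub>\<infinity>k\<in>I. appell_coeff q k / (1 - z * q powi k))"

lemma appell_coeff_0 [simp]: "appell_coeff q 0 = 1"
  by (simp add: appell_coeff_def)

lemma norm_power_lt_1:
  fixes q :: complex
  assumes "norm q < 1" "0 < n"
  shows "norm (q ^ n) < 1"
  using assms by (simp add: norm_power power_less_one_iff)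

section \<open>Locally uniform convergence of Appell sums\<close>

lemma appell_coeff_summable:
  fixes q :: complex
  assumes "q \<noteq> 0" "norm q < 1"
  shows "(\<lambda>k. norm (appell_coeff q k)) summable_on UNIV"
  unfolding appell_coeff_def using assms by (intro summable_on_tri_complex norm_power_lt_1) auto

lemma appell_coeff_conv:
  assumes "q \<noteq> 0"
  shows "appell_coeff q k = q powi (k\<^sup>2) * (q powi tri k * (- q) powi k)"
proof -
  have "k\<^sup>2 + tri k + k = 3 * tri k + 2 * k"
    using two_tri[of k] by (simp add: power2_eq_square algebra_simps)
  then have "q powi (k\<^sup>2 + tri k + k) = q powi (3 * tri k + 2 * k)"
    by (simp only:)
  then have "q powi (k\<^sup>2) * q powi tri k * q powi k = q powi (3 * tri k) * q powi (2 * k)"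
    using assms by (simp add: power_int_add)
  moreover have "(- q) powi k = (- 1) powi k * q powi k" "(- (q\<^sup>2)) powi k = (- 1) powi k * (q\<^sup>2) powi k"
    using power_int_mult_distrib[of "- 1" q k] power_int_mult_distrib[of "- 1" "q\<^sup>2" k] by simp_all
  moreover have "(q ^ 3) powi tri k = q powi (3 * tri k)" "(q\<^sup>2) powi k = q powi (2 * k)"
    by (simp_all add: power_int_mult)
  ultimately show ?thesis
    by (simp add: appell_coeff_def mult_ac)
qed

text \<open>As q^k tends to 0 in one direction and to infinity in the other, all denominators
  outside a finite window of k stay away from 0 uniformly near \<open>z0\<close>; inside the window
  continuity suffices. Convergence and analyticity of the Appell sum both rest on this
  bound.\<close>

lemma appell_denominator_bound:
  fixes q z0 :: complex
  assumes q: "q \<noteq> 0" "norm q < 1" and z0: "z0 \<noteq> 0" "\<And>k. k \<in> I \<Longrightarrow> z0 * q powi k \<noteq> 1"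
  shows "\<exists>r>0. \<exists>d>0. \<forall>z\<in>cball z0 r. \<forall>k\<in>I. d \<le> norm (1 - z * q powi k)"
proof -
  have "(\<lambda>n. norm q ^ n) \<longlonglongrightarrow> 0"
    using q by (intro LIMSEQ_realpow_zero) auto
  \<comment> \<open>On the ball chosen below, norm z lies between norm z0 / 2 and 2 norm z0. These
    thresholds then give norm (z q^k) at most 1/2 for k > N and at least 2 for k < -N.\<close>
  then have "eventually (\<lambda>n. norm q ^ n < min (1 / (4 * norm z0)) (norm z0 / 4)) sequentially"
    using z0 by (intro order_tendstoD) auto
  then obtain N where N: "norm q ^ N < min (1 / (4 * norm z0)) (norm z0 / 4)"
    by (auto simp: eventually_sequentially)
  define K where "K = I \<inter> {- int N..int N}"
  have finK: "finite K"
    by (simp add: K_def)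
  define d where "d = Min (insert (1 / 2) ((\<lambda>k. norm (1 - z0 * q powi k) / 2) ` K))"
  have d: "d > 0" "d \<le> 1 / 2" "\<And>k. k \<in> K \<Longrightarrow> d \<le> norm (1 - z0 * q powi k) / 2"
  proof -
    show "d > 0"
      using z0(2) finK by (auto simp: d_def K_def)
    show "d \<le> 1 / 2" "\<And>k. k \<in> K \<Longrightarrow> d \<le> norm (1 - z0 * q powi k) / 2"
      unfolding d_def by (rule Min_le; use finK in simp)+
  qed
  have "eventually (\<lambda>z. \<forall>k\<in>K. d < norm (1 - z * q powi k)) (nhds z0)"
  proof (intro eventually_ball_finite ballI finK)
    fix k assume k: "k \<in> K"
    have "((\<lambda>z. norm (1 - z * q powi k)) \<longlongrightarrow> norm (1 - z0 * q powi k)) (nhds z0)"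
      by (intro tendsto_intros filterlim_ident)
    moreover have "d < norm (1 - z0 * q powi k)"
      using d(1) d(3)[OF k] by linarith
    ultimately show "eventually (\<lambda>z. d < norm (1 - z * q powi k)) (nhds z0)"
      by (rule order_tendstoD)
  qed
  then obtain e where e: "e > 0" "\<And>z. dist z z0 < e \<Longrightarrow> \<forall>k\<in>K. d < norm (1 - z * q powi k)"
    unfolding eventually_nhds_metric by blast
  define r where "r = min (e / 2) (norm z0 / 2)"
  have r: "r > 0"
    using e z0 by (simp add: r_def)
  have "\<forall>z\<in>cball z0 r. \<forall>k\<in>I. d \<le> norm (1 - z * q powi k)"
  proof (intro ballI)
    fix z k assume z: "z \<in> cball z0 r" and k: "k \<in> I"
    have zb: "norm z0 / 2 \<le> norm z" "norm z \<le> 2 * norm z0"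
    proof -
      have "norm (z0 - z) \<le> norm z0 / 2"
        using z by (simp add: r_def dist_norm)
      then show "norm z0 / 2 \<le> norm z" "norm z \<le> 2 * norm z0"
        using norm_triangle_ineq2[of z0 z] norm_triangle_ineq3[of z z0]
        by (auto simp: norm_minus_commute)
    qed
    have "k \<in> K \<or> k > int N \<or> k < - int N"
      using k by (auto simp: K_def)
    then consider "k \<in> K" | "k > int N" | "k < - int N"
      by blast
    then show "d \<le> norm (1 - z * q powi k)"
    proof cases
      case 1
      have "dist z z0 < e"
        using z e(1) by (simp add: r_def dist_commute)
      then show ?thesis
        using e(2)[of z] 1 by (auto intro: less_imp_le)
    next
      case 2
      have "norm (q powi k) = norm q ^ nat k"
        using 2 by (simp add: power_int_def norm_power)
      also have "\<dots> \<le> norm q ^ N"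
        using 2 q by (intro power_decreasing) auto
      finally have "norm (z * q powi k) \<le> (2 * norm z0) * (1 / (4 * norm z0))"
        unfolding norm_mult using N zb by (intro mult_mono) auto
      then have "norm (z * q powi k) \<le> 1 / 2"
        using z0 by simp
      then show ?thesis
        using norm_triangle_ineq2[of 1 "z * q powi k"] d(2) by simp
    next
      case 3
      have "norm (q powi k) = inverse (norm q ^ nat (- k))"
        using 3 by (simp add: power_int_def norm_power norm_inverse power_inverse)
      moreover have "norm q ^ nat (- k) \<le> norm q ^ N"
        using 3 q by (intro power_decreasing) auto
      then have "norm q ^ nat (- k) \<le> norm z0 / 4"
        using N by simp
      then have "inverse (norm z0 / 4) \<le> inverse (norm q ^ nat (- k))"
        using q by (intro le_imp_inverse_le) auto
      ultimately have "(norm z0 / 2) * inverse (norm z0 / 4) \<le> norm (z * q powi k)"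
        unfolding norm_mult using zb by (intro mult_mono) auto
      then have "2 \<le> norm (z * q powi k)"
        using z0 by simp
      then show ?thesis
        using norm_triangle_ineq2[of "z * q powi k" 1] d(2) by (simp add: norm_minus_commute)
    qed
  qed
  then show ?thesis
    using r d(1) by blast
qed

lemma appell_term_bound:
  fixes q :: complex
  assumes "0 < d" "d \<le> norm (1 - z * q powi k)"
  shows "norm (c / (1 - z * q powi k)) \<le> norm c / d"
  unfolding norm_divide using assms by (simp add: divide_simps mult_left_mono)

lemma appell_has_sum:
  fixes q z :: complex
  assumes q: "q \<noteq> 0" "norm q < 1" and z: "z \<noteq> 0" "\<And>k. k \<in> I \<Longrightarrow> z * q powi k \<noteq> 1"
  shows "((\<lambda>k. appell_coeff q k / (1 - z * q powi k)) has_sum appell I z q) I"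
proof -
  obtain r d where rd: "0 < r" "0 < d" "\<And>w k. w \<in> cball z r \<Longrightarrow> k \<in> I \<Longrightarrow> d \<le> norm (1 - w * q powi k)"
    using appell_denominator_bound[of q z I] q z by blast
  have "(\<lambda>k. norm (appell_coeff q k) * (1 / d)) summable_on I"
    by (intro summable_on_cmult_left summable_on_subset[OF appell_coeff_summable[OF q]]) auto
  then have "(\<lambda>k. norm (appell_coeff q k / (1 - z * q powi k))) summable_on I"
    by (rule Infinite_Sum.abs_summable_on_comparison_test') (use rd in \<open>auto intro!: appell_term_bound\<close>)
  then show ?thesis
    unfolding appell_def by (rule has_sum_infsum[OF abs_summable_summable])
qed

lemma appell_analytic_at:
  fixes q z :: complex
  assumes q: "q \<noteq> 0" "norm q < 1" and z: "z \<noteq> 0" "\<And>k. k \<in> I \<Longrightarrow> z * q powi k \<noteq> 1"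
  shows "(\<lambda>w. appell I w q) analytic_on {z}"
proof -
  obtain r d where rd: "0 < r" "0 < d" "\<And>w k. w \<in> cball z r \<Longrightarrow> k \<in> I \<Longrightarrow> d \<le> norm (1 - w * q powi k)"
    using appell_denominator_bound[of q z I] q z by blast
  have "(\<lambda>k. norm (appell_coeff q k) * (1 / d)) summable_on I"
    by (intro summable_on_cmult_left summable_on_subset[OF appell_coeff_summable[OF q]]) auto
  then have ulim: "uniform_limit (cball z r) (\<lambda>X w. \<Sum>k\<in>X. appell_coeff q k / (1 - w * q powi k))
      (\<lambda>w. appell I w q) (finite_subsets_at_top I)"
    unfolding appell_def
    by (rule Weierstrass_m_test_general[rotated]) (use rd in \<open>auto intro!: appell_term_bound\<close>)
  have "eventually (\<lambda>X. continuous_on (cball z r) (\<lambda>w. \<Sum>k\<in>X. appell_coeff q k / (1 - w * q powi k)) \<and>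
      (\<lambda>w. \<Sum>k\<in>X. appell_coeff q k / (1 - w * q powi k)) holomorphic_on ball z r) (finite_subsets_at_top I)"
  proof (rule eventually_finite_subsets_at_top_weakI)
    fix X assume X: "finite X" "X \<subseteq> I"
    have "1 - w * q powi k \<noteq> 0" if "w \<in> cball z r" "k \<in> X" for w k
    proof -
      have "d \<le> norm (1 - w * q powi k)"
        using that X by (intro rd(3)) auto
      then show ?thesis
        using rd(2) by auto
    qed
    then have hol: "(\<lambda>w. \<Sum>k\<in>X. appell_coeff q k / (1 - w * q powi k)) holomorphic_on cball z r"
      by (intro holomorphic_intros)
    then show "continuous_on (cball z r) (\<lambda>w. \<Sum>k\<in>X. appell_coeff q k / (1 - w * q powi k)) \<and>
      (\<lambda>w. \<Sum>k\<in>X. appell_coeff q k / (1 - w * q powi k)) holomorphic_on ball z r"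
      using holomorphic_on_imp_continuous_on holomorphic_on_subset[OF hol ball_subset_cball] by blast
  qed
  from this ulim have "(\<lambda>w. appell I w q) holomorphic_on ball z r"
    by (rule holomorphic_uniform_limit) simp_all
  then show ?thesis
    using rd(1) by (auto simp: analytic_at intro!: exI[of _ "ball z r"])
qed

text \<open>Only n >= |k| contributes, and the two reciprocals are symmetric in k. With n = m + |k|
  the column becomes a Durfee rectangle sum with excess 2|k|, whose value does not depend on the
  excess.\<close>

lemma rank_coeff_column_sum:
  fixes q :: complex
  assumes q: "q \<noteq> 0" "norm q < 1"
  shows "((\<lambda>n. q ^ (n\<^sup>2) * rank_coeff q n k) has_sum (appell_coeff q k * inverse (qpoch_inf q q))) UNIV"
proof -
  define l where "l = nat \<bar>k\<bar>"
  define g where "g n = q ^ (n\<^sup>2) * (inv_qfact q (int n - int l) * inv_qfact q (int n + int l))" for n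
  have k: "int n - k = int n - int l \<and> int n + k = int n + int l \<or>
      int n - k = int n + int l \<and> int n + k = int n - int l" for n
    by (auto simp: l_def)
  have g: "q ^ (n\<^sup>2) * rank_coeff q n k = (q powi tri k * (- q) powi k) * g n" for n
    using k[of n] by (auto simp: g_def rank_coeff_def)
  have "((\<lambda>m. q ^ (l\<^sup>2) * (q ^ (m\<^sup>2 + (2 * l) * m) * (inverse (qpoch q q m) * inverse (qpoch q q (m + 2 * l))))) has_sum
      q ^ (l\<^sup>2) * inverse (qpoch_inf q q)) UNIV"
    by (intro has_sum_cmult_right durfee_rectangle_sum q)
  also have "(\<lambda>m. q ^ (l\<^sup>2) * (q ^ (m\<^sup>2 + (2 * l) * m) * (inverse (qpoch q q m) * inverse (qpoch q q (m + 2 * l))))) =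
      (\<lambda>m. g (m + l))"
  proof
    fix m
    have "int (m + l) - int l = int m" "int (m + l) + int l = int (m + 2 * l)"
      by simp_all
    moreover have "(m + l)\<^sup>2 = l\<^sup>2 + (m\<^sup>2 + (2 * l) * m)"
      by (simp add: power2_eq_square algebra_simps)
    then have "q ^ ((m + l)\<^sup>2) = q ^ (l\<^sup>2) * q ^ (m\<^sup>2 + (2 * l) * m)"
      by (simp only: power_add)
    ultimately show "q ^ (l\<^sup>2) * (q ^ (m\<^sup>2 + (2 * l) * m) * (inverse (qpoch q q m) * inverse (qpoch q q (m + 2 * l)))) = g (m + l)"
      unfolding g_def by (simp only: inv_qfact_of_nat mult.assoc)
  qed
  also have "((\<lambda>m. g (m + l)) has_sum (q ^ (l\<^sup>2) * inverse (qpoch_inf q q))) UNIV \<longleftrightarrow>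
      (g has_sum (q ^ (l\<^sup>2) * inverse (qpoch_inf q q))) {l..}"
    by (rule has_sum_reindex_bij_witness[of _ "\<lambda>n. n - l" "\<lambda>m. m + l"]) auto
  also have "\<dots> \<longleftrightarrow> (g has_sum (q ^ (l\<^sup>2) * inverse (qpoch_inf q q))) UNIV"
    by (rule has_sum_cong_neutral) (auto simp: g_def)
  finally have "((\<lambda>n. (q powi tri k * (- q) powi k) * g n) has_sum
      (q powi tri k * (- q) powi k) * (q ^ (l\<^sup>2) * inverse (qpoch_inf q q))) UNIV"
    by (rule has_sum_cmult_right)
  moreover have "q ^ (l\<^sup>2) = q powi (k\<^sup>2)"
  proof -
    have "k\<^sup>2 = int (l\<^sup>2)"
      by (simp add: l_def)
    then show ?thesis by (simp del: of_nat_power)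
  qed
  ultimately show ?thesis
    unfolding g by (simp add: appell_coeff_conv[OF q(1)] mult_ac)
qed

text \<open>The double sum over n and k converges absolutely. Its rows are summed by
  \<open>rank_partial_fractions\<close>, its columns by
  \<open>rank_coeff_column_sum\<close>.\<close>

theorem rank_series_eq_appell:
  fixes q z :: complex
  assumes q: "q \<noteq> 0" "norm q < 1" and z: "z \<noteq> 0" "\<And>k. z * q powi k \<noteq> 1"
  shows "(\<lambda>n. q ^ (n\<^sup>2) / (qpoch z q (n + 1) * qpoch (q / z) q n)) sums (appell UNIV z q / qpoch_inf q q)"
    and "rank_series z q = appell UNIV z q / qpoch_inf q q"
proof -
  obtain r d where rd: "0 < r" "0 < d" "\<And>w k. w \<in> cball z r \<Longrightarrow> k \<in> UNIV \<Longrightarrow> d \<le> norm (1 - w * q powi k)"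
    using appell_denominator_bound[of q z UNIV] q z by blast
  then have d: "d \<le> norm (1 - z * q powi k)" for k
    by simp
  obtain K where K: "0 < K" "\<And>m. norm (inv_qfact q m) \<le> K"
    using bounded_inv_qfact[OF q(2)] by metis
  define F where "F = (\<lambda>(n, k). q ^ (n\<^sup>2) * (rank_coeff q n k / (1 - z * q powi k)))"
  \<comment> \<open>Geometric decay in n comes from n <= n^2, decay in k from the theta
    coefficients; reciprocals and denominators are only bounded.\<close>
  have Fb: "norm (F (n, k)) \<le> norm q ^ n * (norm (q powi tri k * (- q) powi k) * (K * K * (1 / d)))" for n k
  proof -
    have "norm (rank_coeff q n k) \<le> norm (q powi tri k * (- q) powi k) * (K * K)"
      unfolding rank_coeff_def norm_mult[of "_ powi _ * _"] norm_mult[of "inv_qfact _ _"] using K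
      by (intro mult_mono mult_nonneg_nonneg) (auto intro: less_imp_le)
    then have 1: "norm (rank_coeff q n k) / d \<le> norm (q powi tri k * (- q) powi k) * (K * K) / d"
      using rd(2) by (intro divide_right_mono) auto
    have "n \<le> n\<^sup>2"
      by (simp add: power2_eq_square)
    then have 2: "norm (q ^ (n\<^sup>2)) \<le> norm q ^ n"
      unfolding norm_power using q by (intro power_decreasing) auto
    have "norm (F (n, k)) = norm (q ^ (n\<^sup>2)) * norm (rank_coeff q n k / (1 - z * q powi k))"
      unfolding F_def prod.case by (rule norm_mult)
    also have "\<dots> \<le> norm q ^ n * (norm (q powi tri k * (- q) powi k) * (K * K) / d)"
      using 2 order.trans[OF appell_term_bound[OF rd(2) d] 1] by (intro mult_mono) auto
    finally show ?thesis by (simp add: mult.assoc)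
  qed
  have "(\<lambda>(n, k). norm q ^ n * (norm (q powi tri k * (- q) powi k) * (K * K * (1 / d)))) summable_on UNIV \<times> UNIV"
  proof (rule summable_on_SigmaI)
    show "((\<lambda>k. case (n, k) of (n, k) \<Rightarrow> norm q ^ n * (norm (q powi tri k * (- q) powi k) * (K * K * (1 / d)))) has_sum
      norm q ^ n * infsum (\<lambda>k. norm (q powi tri k * (- q) powi k) * (K * K * (1 / d))) UNIV) UNIV" for n
      unfolding prod.case using q
      by (intro has_sum_cmult_right has_sum_infsum summable_on_cmult_left summable_on_tri_complex) auto
    have "summable (\<lambda>n. norm (norm q ^ n))"
      using q by (simp add: summable_geometric)
    then show "(\<lambda>n. norm q ^ n * infsum (\<lambda>k. norm (q powi tri k * (- q) powi k) * (K * K * (1 / d))) UNIV) summable_on UNIV"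
      by (intro summable_on_cmult_left norm_summable_imp_summable_on)
  qed (use K rd(2) in auto)
  then have "(\<lambda>p. norm (F p)) summable_on UNIV \<times> UNIV"
    by (rule Infinite_Sum.abs_summable_on_comparison_test') (use Fb in auto)
  then have "F summable_on UNIV \<times> UNIV"
    by (rule abs_summable_summable)
  then have S: "(F has_sum infsum F (UNIV \<times> UNIV)) (UNIV \<times> UNIV)"
    by (rule has_sum_infsum)
  have rows: "((\<lambda>n. q ^ (n\<^sup>2) / (qpoch z q (n + 1) * qpoch (q / z) q n)) has_sum infsum F (UNIV \<times> UNIV)) UNIV"
  proof (rule has_sum_SigmaD[OF S])
    show "((\<lambda>k. F (n, k)) has_sum q ^ (n\<^sup>2) / (qpoch z q (n + 1) * qpoch (q / z) q n)) UNIV" for n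
      unfolding F_def prod.case divide_inverse[of "q ^ (n\<^sup>2)"]
      by (intro has_sum_cmult_right rank_partial_fractions q z)
  qed
  have S': "((\<lambda>(k, n). F (n, k)) has_sum infsum F (UNIV \<times> UNIV)) (UNIV \<times> UNIV)"
    using S by (subst (asm) has_sum_swap) simp
  have "((\<lambda>k. appell_coeff q k / (1 - z * q powi k) * inverse (qpoch_inf q q)) has_sum infsum F (UNIV \<times> UNIV)) UNIV"
  proof (rule has_sum_SigmaD[OF S'])
    fix k
    have "((\<lambda>n. q ^ (n\<^sup>2) * rank_coeff q n k * inverse (1 - z * q powi k)) has_sum
        appell_coeff q k * inverse (qpoch_inf q q) * inverse (1 - z * q powi k)) UNIV"
      by (intro has_sum_cmult_left rank_coeff_column_sum q)
    then show "((\<lambda>n. case (k, n) of (k, n) \<Rightarrow> F (n, k)) has_sum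
        appell_coeff q k / (1 - z * q powi k) * inverse (qpoch_inf q q)) UNIV"
      by (simp add: F_def divide_inverse mult_ac)
  qed
  moreover have "((\<lambda>k. appell_coeff q k / (1 - z * q powi k) * inverse (qpoch_inf q q)) has_sum
      appell UNIV z q * inverse (qpoch_inf q q)) UNIV"
    by (intro has_sum_cmult_left appell_has_sum q z)
  ultimately have "infsum F (UNIV \<times> UNIV) = appell UNIV z q / qpoch_inf q q"
    unfolding divide_inverse by (rule has_sum_unique)
  then show "(\<lambda>n. q ^ (n\<^sup>2) / (qpoch z q (n + 1) * qpoch (q / z) q n)) sums (appell UNIV z q / qpoch_inf q q)"
    using has_sum_imp_sums[OF rows] by simp
  then show "rank_series z q = appell UNIV z q / qpoch_inf q q"
    unfolding rank_series_def by (rule sums_unique[symmetric])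
qed

lemma appell_theta_sum:
  fixes q :: complex
  assumes q: "q \<noteq> 0" "norm q < 1"
  shows "((\<lambda>k. appell_coeff q k * (q powi j) powi k) has_sum jfun (q\<^sup>2 * q powi j) (q ^ 3)) UNIV"
  using jacobi_triple_product[of "q ^ 3" "- (q\<^sup>2 * q powi j)"] q norm_power_lt_1[OF q(2), of 3]
    power_int_mult_distrib[of "- (q\<^sup>2)" "q powi j"]
  by (simp add: appell_coeff_def mult_ac)

lemma jfun_q_cubed:
  fixes q :: complex
  assumes q: "q \<noteq> 0" "norm q < 1"
  shows "jfun q (q ^ 3) = qpoch_inf q q" "jfun (q\<^sup>2) (q ^ 3) = qpoch_inf q q"
proof -
  have *: "q ^ 3 / q = q\<^sup>2" "q ^ 3 / q\<^sup>2 = q"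
    using q by (simp_all add: power2_eq_square power3_eq_cube)
  show "jfun q (q ^ 3) = qpoch_inf q q" "jfun (q\<^sup>2) (q ^ 3) = qpoch_inf q q"
    unfolding jfun_def * qpoch_inf_dissect3[OF q(2), of q]
    by (simp_all add: power2_eq_square power3_eq_cube mult_ac)
qed

text \<open>With u = q^k, the difference u^(-3) - z^3 = u^(-3) (1 - (z u)^3) is divisible by 1 - z
  u, and the quotient is a geometric sum of three terms.\<close>

lemma appell_shift_aux:
  fixes u z :: complex
  assumes "u \<noteq> 0" "1 - z * u \<noteq> 0"
  shows "inverse (u ^ 3) * (c / (1 - z * u)) =
    z ^ 3 * (c / (1 - z * u)) + (c * inverse (u ^ 3) + z * (c * inverse (u\<^sup>2)) + z\<^sup>2 * (c * inverse u))"
  using assms by (simp add: field_simps power2_eq_square power3_eq_cube)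

text \<open>Replacing k by k - 1 restores the denominators and multiplies the coefficients by - q
  u^(-3). Trading u^(-3) for z^3 leaves the theta sums j(q^(-1); q^3), j(1; q^3), j(q; q^3), which
  equal -E/q, 0 and E; they account for the term 1, the absent linear term and - q z^2.\<close>

theorem rank_series_shift:
  fixes q z :: complex
  assumes q: "q \<noteq> 0" "norm q < 1" and z: "z \<noteq> 0" "\<And>k. z * q powi k \<noteq> 1"
  shows "rank_series (q * z) q = - (q * z ^ 3 * rank_series z q) + 1 - q * z\<^sup>2"
proof -
  define E where "E = qpoch_inf q q"
  have E: "E \<noteq> 0"
    using qpoch_inf_qq_nonzero q by (simp add: E_def)
  have q3: "q ^ 3 \<noteq> 0" "norm (q ^ 3) < 1"
    using q norm_power_lt_1 by auto
  have qz: "q * z \<noteq> 0" "\<And>k. q * z * q powi k \<noteq> 1"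
    using q z(1) z(2)[of "_ + 1"] by (auto simp: power_int_add mult_ac)
  have L: "((\<lambda>k. appell_coeff q k / (1 - q * z * q powi k)) has_sum appell UNIV (q * z) q) UNIV"
    by (intro appell_has_sum q qz)
  have bij: "bij_betw (\<lambda>k::int. k - 1) UNIV UNIV"
    by (rule bij_betwI[of _ _ _ "\<lambda>k. k + 1"]) auto
  have L': "((\<lambda>k. appell_coeff q (k - 1) / (1 - q * z * q powi (k - 1))) has_sum appell UNIV (q * z) q) UNIV"
    using L has_sum_reindex_bij_betw[OF bij, of "\<lambda>k. appell_coeff q k / (1 - q * z * q powi k)"] by simp
  have "appell_coeff q (k - 1) / (1 - q * z * q powi (k - 1)) =
      - q * (z ^ 3 * (appell_coeff q k / (1 - z * q powi k)) +
       (appell_coeff q k * (q powi (- 3)) powi k + z * (appell_coeff q k * (q powi (- 2)) powi k) +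
        z\<^sup>2 * (appell_coeff q k * (q powi (- 1)) powi k)))" for k
  proof -
    define u where "u = q powi k"
    have u: "u \<noteq> 0" "1 - z * u \<noteq> 0"
      using q z(2)[of k] by (auto simp: u_def)
    have p: "(q powi (- 3)) powi k = inverse (u ^ 3)" "(q powi (- 2)) powi k = inverse (u\<^sup>2)"
      "(q powi (- 1)) powi k = inverse u"
      by (simp_all add: u_def power_int_minus power_int_inverse power_int_power power_int_power' mult.commute)
    have "(q ^ 3) powi (- k) = inverse (u ^ 3)"
      by (simp add: u_def power_int_minus power_int_power power_int_power' mult.commute)
    then have e1: "appell_coeff q (k - 1) = - q * (inverse (u ^ 3) * appell_coeff q k)"
      unfolding appell_coeff_def tri_diff_1 using q
      by (simp add: power_int_add power_int_diff power_int_minus field_simps power2_eq_square power3_eq_cube)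
    have e2: "q * z * q powi (k - 1) = z * u"
      using q by (simp add: u_def power_int_diff)
    have "- q * (inverse (u ^ 3) * appell_coeff q k) / (1 - z * u) =
        - q * (inverse (u ^ 3) * (appell_coeff q k / (1 - z * u)))"
      by simp
    then show ?thesis
      unfolding e1 e2 p u_def[symmetric] appell_shift_aux[OF u] .
  qed
  then have L'': "((\<lambda>k. - q * (z ^ 3 * (appell_coeff q k / (1 - z * q powi k)) +
       (appell_coeff q k * (q powi (- 3)) powi k + z * (appell_coeff q k * (q powi (- 2)) powi k) +
        z\<^sup>2 * (appell_coeff q k * (q powi (- 1)) powi k)))) has_sum appell UNIV (q * z) q) UNIV"
    using L' by simp
  have "((\<lambda>k. - q * (z ^ 3 * (appell_coeff q k / (1 - z * q powi k)) +
       (appell_coeff q k * (q powi (- 3)) powi k + z * (appell_coeff q k * (q powi (- 2)) powi k) +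
        z\<^sup>2 * (appell_coeff q k * (q powi (- 1)) powi k)))) has_sum
      (- q * (z ^ 3 * appell UNIV z q + (jfun (q\<^sup>2 * q powi (- 3)) (q ^ 3) + z * jfun (q\<^sup>2 * q powi (- 2)) (q ^ 3) +
        z\<^sup>2 * jfun (q\<^sup>2 * q powi (- 1)) (q ^ 3))))) UNIV"
    by (intro has_sum_add has_sum_cmult_right appell_has_sum appell_theta_sum q z)
  with L'' have *: "appell UNIV (q * z) q =
      - q * (z ^ 3 * appell UNIV z q + (jfun (q\<^sup>2 * q powi (- 3)) (q ^ 3) + z * jfun (q\<^sup>2 * q powi (- 2)) (q ^ 3) +
        z\<^sup>2 * jfun (q\<^sup>2 * q powi (- 1)) (q ^ 3)))"
    by (rule has_sum_unique)
  have p: "q\<^sup>2 * q powi (- 3) = inverse q" "q\<^sup>2 * q powi (- 2) = 1" "q\<^sup>2 * q powi (- 1) = q"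
    using q by (simp_all add: power_int_minus power2_eq_square power3_eq_cube field_simps)
  have j1: "jfun (inverse q) (q ^ 3) = - E / q"
  proof -
    have "q ^ 3 * inverse q = q\<^sup>2"
      using q by (simp add: power2_eq_square power3_eq_cube)
    then have "E = - (q * jfun (inverse q) (q ^ 3))"
      using jfun_shift[OF q3(2) q3(1), of "inverse q"] q jfun_q_cubed[OF q]
      by (simp add: E_def divide_inverse mult.commute)
    then have "q * jfun (inverse q) (q ^ 3) = - E"
      by simp
    then show ?thesis
      using q by (simp add: field_simps)
  qed
  have j2: "jfun 1 (q ^ 3) = 0"
    by (subst jfun_eq_0_iff[OF q3(2) q3(1)]) (auto intro!: exI[of _ 0])
  have "appell UNIV (q * z) q = - (q * z ^ 3 * appell UNIV z q) + E - q * z\<^sup>2 * E"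
    unfolding * p j1 j2 using jfun_q_cubed[OF q] q by (simp add: E_def[symmetric] field_simps)
  then show ?thesis
    unfolding rank_series_eq_appell(2)[OF q z] rank_series_eq_appell(2)[OF q qz]
    using E by (simp add: E_def[symmetric] field_simps)
qed

text \<open>The substitution k -> -k in the Appell sum. It says that (1 - z) T(z) is invariant under
  z -> 1/z, the symmetry of ranks under conjugation of partitions.\<close>

theorem rank_series_inverse:
  fixes q z :: complex
  assumes q: "q \<noteq> 0" "norm q < 1" and z: "z \<noteq> 0" "\<And>k. z * q powi k \<noteq> 1"
  shows "rank_series (inverse z) q = - (z * rank_series z q)"
proof -
  have iz: "inverse z \<noteq> 0" "\<And>k. inverse z * q powi k \<noteq> 1"
    using z(1) z(2)[of "- _"] q by (auto simp: power_int_minus field_simps)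
  have L: "((\<lambda>k. appell_coeff q k / (1 - inverse z * q powi k)) has_sum appell UNIV (inverse z) q) UNIV"
    by (intro appell_has_sum q iz)
  have bij: "bij_betw (\<lambda>k::int. - k) UNIV UNIV"
    by (rule bij_betwI[of _ _ _ "\<lambda>k. - k"]) auto
  have L': "((\<lambda>k. appell_coeff q (- k) / (1 - inverse z * q powi (- k))) has_sum appell UNIV (inverse z) q) UNIV"
    using L has_sum_reindex_bij_betw[OF bij, of "\<lambda>k. appell_coeff q k / (1 - inverse z * q powi k)"] by simp
  have "appell_coeff q (- k) / (1 - inverse z * q powi (- k)) = - z * (appell_coeff q k / (1 - z * q powi k))" for k
  proof -
    define u where "u = q powi k"
    have u: "u \<noteq> 0" "z * u \<noteq> 1"
      using q z(2)[of k] by (auto simp: u_def)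
    have p: "(q ^ 3) powi k = u ^ 3" "(- (q\<^sup>2)) powi k = (- 1) powi k * u\<^sup>2"
      using power_int_mult_distrib[of "- 1" "q\<^sup>2" k]
      by (simp_all add: u_def power_int_power power_int_power' mult.commute)
    have "inverse ((- 1) powi k :: complex) = (- 1) powi k"
      by (simp add: power_int_minus_left)
    moreover have "(q ^ 3) powi (tri k + k) = (q ^ 3) powi tri k * u ^ 3"
      using q by (simp add: power_int_add p)
    ultimately have "appell_coeff q (- k) = (q ^ 3) powi tri k * (- 1) powi k * (u ^ 3 * inverse (u\<^sup>2))"
      unfolding appell_coeff_def tri_uminus power_int_minus p inverse_mult_distrib
      by (simp only: mult_ac)
    also have "u ^ 3 * inverse (u\<^sup>2) = inverse u * u\<^sup>2"
      using u by (simp add: field_simps power2_eq_square power3_eq_cube)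
    finally have ac: "appell_coeff q (- k) = inverse u * appell_coeff q k"
      unfolding appell_coeff_def p by (simp only: mult_ac)
    show ?thesis
      unfolding ac power_int_minus u_def[symmetric] using u z(1) by (simp add: field_simps)
  qed
  then have "((\<lambda>k. - z * (appell_coeff q k / (1 - z * q powi k))) has_sum appell UNIV (inverse z) q) UNIV"
    using L' by simp
  moreover have "((\<lambda>k. - z * (appell_coeff q k / (1 - z * q powi k))) has_sum (- z * appell UNIV z q)) UNIV"
    by (intro has_sum_cmult_right appell_has_sum q z)
  ultimately have "appell UNIV (inverse z) q = - z * appell UNIV z q"
    by (rule has_sum_unique)
  then show ?thesis
    unfolding rank_series_eq_appell(2)[OF q z] rank_series_eq_appell(2)[OF q iz] by simp
qed

section \<open>Theta functions and eta quotients\<close>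

lemma even_odd_has_sum:
  fixes f :: "int \<Rightarrow> complex"
  assumes "((\<lambda>k. f (2 * k)) has_sum a) UNIV" "((\<lambda>k. f (2 * k + 1)) has_sum b) UNIV"
  shows "(f has_sum (a + b)) UNIV"
proof -
  have e: "(f has_sum a) {k. even k}"
    using assms(1) by (subst (asm) has_sum_reindex_bij_witness[of _ "\<lambda>k. k div 2" "\<lambda>k. 2 * k" "{k. even k}" f]) auto
  have o: "(f has_sum b) {k. odd k}"
    using assms(2) by (subst (asm) has_sum_reindex_bij_witness[of _ "\<lambda>k. k div 2" "\<lambda>k. 2 * k + 1" "{k. odd k}" f]) auto
  have "(f has_sum (a + b)) ({k. even k} \<union> {k. odd k})"
    by (rule has_sum_Un_disjoint[OF e o]) auto
  moreover have "{k::int. even k} \<union> {k. odd k} = UNIV"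
    by auto
  ultimately show ?thesis by simp
qed

text \<open>Even and odd indices of the triple product series are summed separately. This evaluates
  \<open>jfun\<close> at the poles and later turns theta constants into the \<open>Jbar\<close> of
  the final formula.\<close>

theorem jfun_parity:
  fixes q z :: complex
  assumes q: "q \<noteq> 0" "norm q < 1" and z: "z \<noteq> 0"
  shows "jfun z q = jfun (- (q * z\<^sup>2)) (q ^ 4) - z * jfun (- (q ^ 3 * z\<^sup>2)) (q ^ 4)"
proof -
  define f where "f k = q powi tri k * (- z) powi k" for k
  have f: "(f has_sum jfun z q) UNIV"
    using jacobi_triple_product[OF q, of "- z"] z by (simp add: f_def[abs_def])
  have q4: "q ^ 4 \<noteq> 0" "norm (q ^ 4) < 1"
    using q norm_power_lt_1 by auto
  have "((\<lambda>k. (q ^ 4) powi tri k * (q * z\<^sup>2) powi k) has_sum jfun (- (q * z\<^sup>2)) (q ^ 4)) UNIV"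
    using q z by (intro jacobi_triple_product q4) auto
  also have "(\<lambda>k. (q ^ 4) powi tri k * (q * z\<^sup>2) powi k) = (\<lambda>k. f (2 * k))"
  proof
    fix k
    have "tri (2 * k) = 4 * tri k + k"
      using two_tri[of k] two_tri[of "2 * k"] by (simp add: algebra_simps)
    moreover have "(- z) powi (2 * k) = (z\<^sup>2) powi k" "(q ^ 4) powi tri k = q powi (4 * tri k)"
      by (simp_all add: power_int_mult)
    ultimately show "(q ^ 4) powi tri k * (q * z\<^sup>2) powi k = f (2 * k)"
      using q by (simp add: f_def power_int_add power_int_mult_distrib)
  qed
  finally have e: "((\<lambda>k. f (2 * k)) has_sum jfun (- (q * z\<^sup>2)) (q ^ 4)) UNIV" .
  have "((\<lambda>k. - z * ((q ^ 4) powi tri k * (q ^ 3 * z\<^sup>2) powi k)) has_sum - z * jfun (- (q ^ 3 * z\<^sup>2)) (q ^ 4)) UNIV"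
    using q z by (intro has_sum_cmult_right jacobi_triple_product q4) auto
  also have "(\<lambda>k. - z * ((q ^ 4) powi tri k * (q ^ 3 * z\<^sup>2) powi k)) = (\<lambda>k. f (2 * k + 1))"
  proof
    fix k
    have "tri (2 * k + 1) = 4 * tri k + 3 * k"
      using two_tri[of k] two_tri[of "2 * k + 1"] by (simp add: algebra_simps)
    moreover have "(- z) powi (2 * k + 1) = - z * (z\<^sup>2) powi k"
      using z by (simp add: power_int_add power_int_mult)
    moreover have "(q ^ 4) powi tri k = q powi (4 * tri k)" "(q ^ 3) powi k = q powi (3 * k)"
      by (simp_all add: power_int_mult)
    ultimately show "- z * ((q ^ 4) powi tri k * (q ^ 3 * z\<^sup>2) powi k) = f (2 * k + 1)"
      using q by (simp add: f_def power_int_add power_int_mult_distrib)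
  qed
  finally have o: "((\<lambda>k. f (2 * k + 1)) has_sum - z * jfun (- (q ^ 3 * z\<^sup>2)) (q ^ 4)) UNIV" .
  show ?thesis
    using has_sum_unique[OF f even_odd_has_sum[OF e o]] by simp
qed

text \<open>Dedekind's eta function at multiples of its argument, without the fractional power of q.
  Expressed by these nonzero numbers, identities between theta constants become field
  arithmetic.\<close>

definition eta :: "nat \<Rightarrow> complex \<Rightarrow> complex" where
  "eta k q = qpoch_inf (q ^ k) (q ^ k)"

lemma eta_power: "eta k (q ^ l) = eta (l * k) q"
  by (simp add: eta_def power_mult)

lemma eta_nonzero:
  assumes "norm q < 1" "0 < k"
  shows "eta k q \<noteq> 0"
  unfolding eta_def by (intro qpoch_inf_qq_nonzero norm_power_lt_1 assms)

section \<open>Theta constants as eta quotients\<close>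

lemma qpoch_inf_minus_self:
  assumes "norm q < 1"
  shows "qpoch_inf (- q) q = eta 2 q / eta 1 q"
  using qpoch_inf_mult_minus[OF assms, of q] eta_nonzero[OF assms, of 1]
  by (simp add: eta_def field_simps)

lemma qpoch_inf_square_base:
  assumes "norm q < 1"
  shows "qpoch_inf q (q\<^sup>2) = eta 1 q / eta 2 q"
    "qpoch_inf (- q) (q\<^sup>2) = (eta 2 q)\<^sup>2 / (eta 1 q * eta 4 q)"
    "qpoch_inf (- (q\<^sup>2)) (q\<^sup>2) = eta 4 q / eta 2 q"
proof -
  note nz = eta_nonzero[OF assms]
  have e2: "eta k (q\<^sup>2) = eta (2 * k) q" for k
    by (simp add: eta_power)
  have q2: "norm (q\<^sup>2) < 1"
    by (rule norm_power_lt_1[OF assms]) simp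
  show "qpoch_inf q (q\<^sup>2) = eta 1 q / eta 2 q"
    using qpoch_inf_dissect2[OF assms, of q] nz[of 2] by (simp add: eta_def power2_eq_square field_simps)
  show *: "qpoch_inf (- (q\<^sup>2)) (q\<^sup>2) = eta 4 q / eta 2 q"
    using qpoch_inf_minus_self[OF q2] unfolding e2 by simp
  show "qpoch_inf (- q) (q\<^sup>2) = (eta 2 q)\<^sup>2 / (eta 1 q * eta 4 q)"
    using qpoch_inf_dissect2[OF assms, of "- q"] nz[of 1] nz[of 2] nz[of 4]
    unfolding qpoch_inf_minus_self[OF assms] mult_minus_right power2_eq_square[symmetric] *
    by (simp add: field_simps power2_eq_square)
qed

text \<open>In Ramanujan's notation these are phi(-q), phi(q), twice 2 psi(q), then psi(-q) and
  psi(q).\<close>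

lemma jfun_eta:
  assumes q: "q \<noteq> 0" "norm q < 1"
  shows "jfun q (q\<^sup>2) = (eta 1 q)\<^sup>2 / eta 2 q"
    and "jfun (- q) (q\<^sup>2) = eta 2 q ^ 5 / ((eta 1 q)\<^sup>2 * (eta 4 q)\<^sup>2)"
    and "jfun (- 1) q = 2 * (eta 2 q)\<^sup>2 / eta 1 q"
    and "jfun (- q) q = 2 * (eta 2 q)\<^sup>2 / eta 1 q"
    and "jfun q (q ^ 4) = eta 1 q * eta 4 q / eta 2 q"
    and "jfun (- q) (q ^ 4) = (eta 2 q)\<^sup>2 / eta 1 q"
proof -
  note nz = eta_nonzero[OF q(2)]
  have e2: "qpoch_inf (q\<^sup>2) (q\<^sup>2) = eta 2 q" "qpoch_inf (q ^ 4) (q ^ 4) = eta 4 q" "qpoch_inf q q = eta 1 q"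
    by (simp_all add: eta_def)
  have d: "q\<^sup>2 / q = q" "q\<^sup>2 / (- q) = - q" "q / (- q) = - 1" "q / (- 1) = - q"
    "q ^ 4 / q = q\<^sup>2 * q" "q ^ 4 / (- q) = q\<^sup>2 * (- q)"
    using q by (simp_all add: power2_eq_square power4_eq_xxxx)
  have q4: "q ^ 4 = (q\<^sup>2)\<^sup>2"
    by simp
  have q2: "norm (q\<^sup>2) < 1"
    by (rule norm_power_lt_1[OF q(2)]) simp
  have m1: "qpoch_inf (- 1) q = 2 * (eta 2 q / eta 1 q)"
    using qpoch_inf_shift[OF q(2), of "- 1"] by (simp add: qpoch_inf_minus_self[OF q(2)])
  show "jfun q (q\<^sup>2) = (eta 1 q)\<^sup>2 / eta 2 q"
    unfolding jfun_def d e2 qpoch_inf_square_base[OF q(2)] using nz[of 2]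
    by (simp add: field_simps power2_eq_square)
  show "jfun (- q) (q\<^sup>2) = eta 2 q ^ 5 / ((eta 1 q)\<^sup>2 * (eta 4 q)\<^sup>2)"
    unfolding jfun_def d e2 qpoch_inf_square_base[OF q(2)] using nz[of 1] nz[of 4]
    by (simp add: field_simps power2_eq_square eval_nat_numeral)
  show "jfun (- 1) q = 2 * (eta 2 q)\<^sup>2 / eta 1 q" "jfun (- q) q = 2 * (eta 2 q)\<^sup>2 / eta 1 q"
    unfolding jfun_def d e2 m1 qpoch_inf_minus_self[OF q(2)] using nz[of 1]
    by (simp_all add: field_simps power2_eq_square)
  show "jfun q (q ^ 4) = eta 1 q * eta 4 q / eta 2 q"
  proof -
    have "jfun q (q ^ 4) = qpoch_inf q (q\<^sup>2) * eta 4 q"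
      unfolding jfun_def d e2 using qpoch_inf_dissect2[OF q2, of q] by simp
    then show ?thesis
      unfolding qpoch_inf_square_base[OF q(2)] by simp
  qed
  show "jfun (- q) (q ^ 4) = (eta 2 q)\<^sup>2 / eta 1 q"
  proof -
    have "jfun (- q) (q ^ 4) = qpoch_inf (- q) (q\<^sup>2) * eta 4 q"
      unfolding jfun_def d e2 using qpoch_inf_dissect2[OF q2, of "- q"] by simp
    then show ?thesis
      unfolding qpoch_inf_square_base[OF q(2)] using nz[of 4] by simp
  qed
qed

lemma jfun_imaginary_eta:
  assumes q: "q \<noteq> 0" "norm q < 1" and s: "s\<^sup>2 = - 1"
  shows "jfun s q = (1 - s) * (eta 1 q * eta 4 q / eta 2 q)"
    and "jfun (s * q) (q\<^sup>2) = (eta 4 q)\<^sup>2 / eta 8 q"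
proof -
  note nz = eta_nonzero[OF q(2)]
  have s0: "s \<noteq> 0"
    using s by auto
  have inv_s: "1 / s = - s"
    using s s0 by (simp add: field_simps power2_eq_square)
  have q2: "norm (q\<^sup>2) < 1"
    by (rule norm_power_lt_1[OF q(2)]) simp
  have d: "q / s = - (q * s)" "q\<^sup>2 / (s * q) = - (s * q)"
  proof -
    have "q / s = q * (1 / s)" "q\<^sup>2 / (s * q) = q * (1 / s)"
      using q s0 by (simp_all add: power2_eq_square)
    then show "q / s = - (q * s)" "q\<^sup>2 / (s * q) = - (s * q)"
      unfolding inv_s by simp_all
  qed
  have "jfun s q = (1 - s) * (qpoch_inf (q * s) q * qpoch_inf (- (q * s)) q) * qpoch_inf q q"
    unfolding jfun_def d using qpoch_inf_shift[OF q(2), of s] by simp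
  also have "qpoch_inf (q * s) q * qpoch_inf (- (q * s)) q = qpoch_inf (- (q\<^sup>2)) (q\<^sup>2)"
    using qpoch_inf_mult_minus[OF q(2), of "q * s"] s by (simp add: power_mult_distrib)
  finally show "jfun s q = (1 - s) * (eta 1 q * eta 4 q / eta 2 q)"
    unfolding qpoch_inf_square_base[OF q(2)] by (simp add: eta_def)
  have "jfun (s * q) (q\<^sup>2) = (qpoch_inf (s * q) (q\<^sup>2) * qpoch_inf (- (s * q)) (q\<^sup>2)) * eta 2 q"
    unfolding jfun_def d by (simp add: eta_def)
  also have "qpoch_inf (s * q) (q\<^sup>2) * qpoch_inf (- (s * q)) (q\<^sup>2) = qpoch_inf (- (q\<^sup>2)) ((q\<^sup>2)\<^sup>2)"
    using qpoch_inf_mult_minus[OF q2, of "s * q"] s by (simp add: power_mult_distrib)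
  also have "\<dots> = (eta 4 q)\<^sup>2 / (eta 2 q * eta 8 q)"
    unfolding qpoch_inf_square_base[OF q2] by (simp add: eta_power)
  finally show "jfun (s * q) (q\<^sup>2) = (eta 4 q)\<^sup>2 / eta 8 q"
    using nz[of 2] by simp
qed

section \<open>Quasi-periodic holomorphic functions\<close>

text \<open>The multiplier has modulus at most 1 on the unit disc, so a bound on one annulus extends
  to the whole punctured disc and the singularity at 0 is removable. A zero of finite order there
  would contradict the functional equation, since z^3 raises the order of the right side by
  three.\<close>

lemma holomorphic_quasi_periodic_eq_0:
  fixes f :: "complex \<Rightarrow> complex"
  assumes q: "q \<noteq> 0" "norm q < 1" and hol: "f holomorphic_on - {0}"
    and per: "\<And>z. z \<noteq> 0 \<Longrightarrow> f (q * z) = - (q * z ^ 3 * f z)"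
    and z: "z \<noteq> 0"
  shows "f z = 0"
proof -
  define A where "A = {z::complex. norm q \<le> norm z \<and> norm z \<le> 1}"
  have "A = cball 0 1 - ball 0 (norm q)"
    by (auto simp: A_def)
  then have "compact A"
    by (simp add: compact_diff)
  moreover have "continuous_on A f"
    using q by (intro holomorphic_on_imp_continuous_on holomorphic_on_subset[OF hol]) (auto simp: A_def)
  ultimately have "bounded (f ` A)"
    by (intro compact_imp_bounded compact_continuous_image)
  then obtain M where M: "M > 0" "\<And>z. z \<in> A \<Longrightarrow> norm (f z) \<le> M"
    by (auto simp: bounded_pos)
  \<comment> \<open>The bound on the annulus moves inward one factor q at a time.\<close>
  have bound: "norm (f z) \<le> M" if "norm q ^ Suc n \<le> norm z" "norm z \<le> 1" for n z
    using that
  proof (induction n arbitrary: z)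
    case 0
    then show ?case by (intro M) (auto simp: A_def)
  next
    case (Suc n)
    show ?case
    proof (cases "norm q \<le> norm z")
      case True
      then show ?thesis
        using Suc.prems by (intro M) (auto simp: A_def)
    next
      case False
      define y where "y = z / q"
      have zy: "z = q * y"
        using q by (simp add: y_def)
      have y: "norm q ^ Suc n \<le> norm y" "norm y \<le> 1"
        using Suc.prems False q by (auto simp: y_def norm_divide field_simps)
      have "0 < norm q ^ Suc n"
        using q by (intro zero_less_power) simp
      then have "y \<noteq> 0"
        using y(1) by auto
      have IH: "norm (f y) \<le> M"
        by (rule Suc.IH[OF y])
      have "norm (f z) = norm q * norm y ^ 3 * norm (f y)"
        unfolding zy per[OF \<open>y \<noteq> 0\<close>] by (simp add: norm_mult norm_power)
      also have "\<dots> \<le> 1 * 1 * M"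
        using q y IH by (intro mult_mono power_le_one) auto
      finally show ?thesis by simp
    qed
  qed
  have "eventually (\<lambda>z. norm (f z) \<le> M) (at 0)"
    unfolding eventually_at
  proof (intro exI[of _ 1] conjI ballI impI)
    fix z :: complex
    assume z: "z \<noteq> 0 \<and> dist z 0 < 1"
    have "(\<lambda>n. norm q ^ n) \<longlonglongrightarrow> 0"
      using q by (intro LIMSEQ_realpow_zero) auto
    then have "eventually (\<lambda>n. norm q ^ n < norm z) sequentially"
      using z by (intro order_tendstoD) auto
    then obtain N where N: "norm q ^ N < norm z"
      by (auto simp: eventually_sequentially)
    have "norm q ^ Suc N \<le> norm q ^ N"
      using q by (intro power_decreasing) auto
    then show "norm (f z) \<le> M"
      using N z by (intro bound[of N]) auto
  qed simp
  moreover have "f holomorphic_on UNIV - {0}"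
    using hol by (simp add: Compl_eq_Diff_UNIV)
  ultimately obtain h where h: "h holomorphic_on UNIV" "\<And>z. z \<noteq> 0 \<Longrightarrow> h z = f z"
    using holomorphic_on_extend_bounded[of f UNIV 0] by auto
  have hper: "h (q * z) = - (q * z ^ 3 * h z)" if "z \<noteq> 0" for z
    using that q per[OF that] by (simp add: h(2))
  have cont: "isCont h z" for z
    using holomorphic_on_imp_continuous_on[OF h(1)] by (simp add: continuous_on_eq_continuous_at)
  have "(\<lambda>z. h (q * z)) \<midarrow>0\<rightarrow> h (q * 0)"
    by (rule isCont_tendsto_compose[OF cont]) (intro tendsto_intros)
  moreover have "(\<lambda>z. - (q * z ^ 3 * h z)) \<midarrow>0\<rightarrow> - (q * 0 ^ 3 * h 0)"
    using cont[of 0] by (intro tendsto_intros) (simp add: isCont_def)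
  then have "(\<lambda>z. h (q * z)) \<midarrow>0\<rightarrow> - (q * 0 ^ 3 * h 0)"
    by (rule Lim_transform_eventually) (auto simp: eventually_at hper intro!: exI[of _ 1])
  ultimately have h0: "h 0 = 0"
    using LIM_unique by fastforce
  \<comment> \<open>Otherwise h = w^n g near 0 with g(0) nonzero; dividing the functional equation
    by w^n and letting w -> 0 gives q^n g(0) = 0.\<close>
  have "h constant_on UNIV"
  proof (rule ccontr)
    assume "\<not> h constant_on UNIV"
    then obtain g r n where g: "0 < n" "0 < r" "g holomorphic_on ball 0 r"
      "\<And>w. w \<in> ball 0 r \<Longrightarrow> h w = (w - 0) ^ n * g w" "\<And>w. w \<in> ball 0 r \<Longrightarrow> g w \<noteq> 0"
      using holomorphic_factor_zero_nonconstant[OF h(1) open_UNIV connected_UNIV UNIV_I h0] by metis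
    have contg: "isCont g 0"
      using g(2,3) by (meson centre_in_ball continuous_on_eq_continuous_at holomorphic_on_imp_continuous_on open_ball)
    have eq: "q ^ n * g (q * w) = - (q * w ^ 3 * g w)" if "w \<in> ball 0 r" "w \<noteq> 0" for w
    proof -
      have "norm (q * w) \<le> 1 * norm w"
        unfolding norm_mult using q by (intro mult_right_mono) auto
      then have "q * w \<in> ball 0 r"
        using that by simp
      then have "(q * w) ^ n * g (q * w) = - (q * w ^ 3 * (w ^ n * g w))"
        using hper[OF that(2)] g(4)[of w] g(4)[of "q * w"] that by simp
      then have "w ^ n * (q ^ n * g (q * w)) = w ^ n * (- (q * w ^ 3 * g w))"
        by (simp add: power_mult_distrib mult_ac)
      moreover have "w ^ n \<noteq> 0"
        using that by simp
      ultimately show ?thesis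
        using mult_left_cancel by blast
    qed
    have "(\<lambda>w. g (q * w)) \<midarrow>0\<rightarrow> g 0"
      by (rule isCont_tendsto_compose[OF contg]) (auto intro!: tendsto_eq_intros)
    then have "(\<lambda>w. q ^ n * g (q * w)) \<midarrow>0\<rightarrow> q ^ n * g 0"
      by (intro tendsto_intros)
    moreover have "(\<lambda>w. - (q * w ^ 3 * g w)) \<midarrow>0\<rightarrow> - (q * 0 ^ 3 * g 0)"
      using contg by (intro tendsto_intros) (simp add: isCont_def)
    then have "(\<lambda>w. q ^ n * g (q * w)) \<midarrow>0\<rightarrow> - (q * 0 ^ 3 * g 0)"
      by (rule Lim_transform_eventually) (use g(2) eq in \<open>auto simp: eventually_at intro!: exI[of _ r]\<close>)
    ultimately have "q ^ n * g 0 = - (q * 0 ^ 3 * g 0)"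
      using LIM_unique by blast
    then have "g 0 = 0"
      using q by simp
    then show False
      using g(2,5) by auto
  qed
  then have "h z = h 0"
    by (auto simp: constant_on_def)
  then show ?thesis
    using h(2)[OF z] h0 by simp
qed

lemma filterlim_times_at:
  fixes c :: complex
  assumes "c \<noteq> 0"
  shows "filterlim (\<lambda>z. c * z) (at (c * p)) (at p)"
proof (rule filterlim_atI)
  show "(\<lambda>z. c * z) \<midarrow>p\<rightarrow> c * p"
    by (intro tendsto_intros)
  show "eventually (\<lambda>z. c * z \<noteq> c * p) (at p)"
    using assms by (auto simp: eventually_at_filter)
qed

text \<open>The removability criterion is required at one point of each q-orbit only, since the
  functional equation carries it along the orbit in both directions. Values of f outside U may be
  artefacts of division by zero, so f is replaced by \<open>remove_sings f\<close> before the entire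
  punctured plane is considered.\<close>

lemma punctured_quasi_periodic_eq_0:
  fixes f :: "complex \<Rightarrow> complex"
  assumes q: "q \<noteq> 0" "norm q < 1"
    and U: "open U" "0 \<notin> U"
    and isolated: "\<And>p. p \<noteq> 0 \<Longrightarrow> eventually (\<lambda>z. z \<in> U) (at p)"
    and hol: "f holomorphic_on U"
    and per: "\<And>z. z \<in> U \<Longrightarrow> f (q * z) = - (q * z ^ 3 * f z)"
    and rem: "\<And>p. p \<noteq> 0 \<Longrightarrow> p \<notin> U \<Longrightarrow>
      \<exists>n::int. ((\<lambda>z. (z - p * q powi n) * f z) \<longlongrightarrow> 0) (at (p * q powi n))"
    and z: "z \<in> U"
  shows "f z = 0"
proof -
  define L where "L p \<longleftrightarrow> ((\<lambda>z. (z - p) * f z) \<longlongrightarrow> 0) (at p)" for p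
  have up: "L (q * p)" if "L p" "p \<noteq> 0" for p
  proof -
    have "(\<lambda>y. q * (- (q * y ^ 3)) * ((y - p) * f y)) \<midarrow>p\<rightarrow> q * (- (q * p ^ 3)) * 0"
      using that(1) unfolding L_def by (intro tendsto_intros)
    then have "(\<lambda>y. q * (- (q * y ^ 3)) * ((y - p) * f y)) \<midarrow>p\<rightarrow> 0"
      by simp
    then have "(\<lambda>y. (q * y - q * p) * f (q * y)) \<midarrow>p\<rightarrow> 0"
    proof (rule Lim_transform_eventually)
      show "eventually (\<lambda>y. q * (- (q * y ^ 3)) * ((y - p) * f y) = (q * y - q * p) * f (q * y)) (at p)"
        using isolated[OF that(2)] by eventually_elim (simp only: per, simp add: algebra_simps)
    qed
    moreover have "filterlim (\<lambda>z. inverse q * z) (at p) (at (q * p))"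
      using filterlim_times_at[of "inverse q" "q * p"] q by (simp add: mult.assoc[symmetric])
    ultimately have "(\<lambda>z. (q * (inverse q * z) - q * p) * f (q * (inverse q * z))) \<midarrow>q * p\<rightarrow> 0"
      by (rule filterlim_compose)
    then show ?thesis
      using q by (simp add: L_def mult.assoc[symmetric])
  qed
  have down: "L p" if "L (q * p)" "p \<noteq> 0" for p
  proof -
    have "(\<lambda>y. (q * y - q * p) * f (q * y)) \<midarrow>p\<rightarrow> 0"
      using filterlim_compose[OF that(1)[unfolded L_def] filterlim_times_at[OF q(1)]] .
    then have "(\<lambda>y. inverse (- (q * q * y ^ 3)) * ((q * y - q * p) * f (q * y))) \<midarrow>p\<rightarrow> inverse (- (q * q * p ^ 3)) * 0"
      using that(2) q by (intro tendsto_intros) auto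
    then have "(\<lambda>y. (y - p) * f y) \<midarrow>p\<rightarrow> inverse (- (q * q * p ^ 3)) * 0"
    proof (rule Lim_transform_eventually)
      show "eventually (\<lambda>y. inverse (- (q * q * y ^ 3)) * ((q * y - q * p) * f (q * y)) = (y - p) * f y) (at p)"
        using isolated[OF that(2)]
      proof eventually_elim
        case (elim y)
        then have "y \<noteq> 0"
          using U by auto
        have "(q * y - q * p) * f (q * y) = - (q * q * y ^ 3) * ((y - p) * f y)"
          unfolding per[OF elim] by (simp add: algebra_simps)
        then show ?case
          using q \<open>y \<noteq> 0\<close> by (simp add: field_simps)
      qed
    qed
    then show ?thesis by (simp add: L_def)
  qed
  have Lstep: "L (q * p) \<longleftrightarrow> L p" if "p \<noteq> 0" for p
    using up down that by blast
  have Lpow: "L (p * q powi n) \<longleftrightarrow> L p" if "p \<noteq> 0" for p and n :: int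
  proof (induction n rule: int_induct[of _ 0])
    case (step1 i)
    then show ?case
      using Lstep[of "p * q powi i"] that q by (simp add: power_int_add mult_ac)
  next
    case (step2 i)
    have *: "q * (p * q powi (i - 1)) = p * q powi i"
      using q by (simp add: power_int_diff)
    have "p * q powi (i - 1) \<noteq> 0"
      using that q by simp
    then show ?case
      using step2 Lstep[of "p * q powi (i - 1)"] unfolding * by simp
  qed simp
  define g where "g = remove_sings f"
  have gU: "g y = f y" "f analytic_on {y}" if "y \<in> U" for y
  proof -
    show "f analytic_on {y}"
      using hol U(1) that by (auto simp: analytic_at)
    then show "g y = f y"
      unfolding g_def by simp
  qed
  have ana: "g analytic_on {p}" if p: "p \<noteq> 0" for p
  proof (cases "p \<in> U")
    case True
    then show ?thesis
      unfolding g_def by (intro remove_sings_analytic_on gU)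
  next
    case False
    obtain n :: int where "L (p * q powi n)"
      using rem[OF p False] unfolding L_def by blast
    then have Lp: "L p"
      using Lpow[OF p] by blast
    obtain r where r: "r > 0" "\<And>y. y \<noteq> p \<Longrightarrow> dist y p < r \<Longrightarrow> y \<in> U"
      using isolated[OF p] by (auto simp: eventually_at)
    have holb: "f holomorphic_on ball p r - {p}"
      by (intro holomorphic_on_subset[OF hol] subsetI) (rule r(2); simp add: dist_commute)
    then obtain h where h: "h holomorphic_on ball p r" "\<And>y. y \<in> ball p r - {p} \<Longrightarrow> h y = f y"
      using holomorphic_on_extend_lim[of f "ball p r" p] Lp r(1) by (auto simp: L_def)
    have "isCont h p"
      using h(1) r(1) by (meson centre_in_ball continuous_on_eq_continuous_at holomorphic_on_imp_continuous_on open_ball)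
    then have "h \<midarrow>p\<rightarrow> h p"
      by (simp add: isCont_def)
    then have "f \<midarrow>p\<rightarrow> h p"
      by (rule Lim_transform_eventually) (use h r(1) in \<open>auto simp: eventually_at dist_commute intro!: exI[of _ r]\<close>)
    then show ?thesis
      unfolding g_def using isolated_singularity_at_holomorphic[OF holb] r(1)
      by (intro remove_sings_analytic_at) auto
  qed
  have "g analytic_on - {0}"
    using ana by (subst analytic_on_analytic_at) auto
  then have holg: "g holomorphic_on - {0}"
    by (rule analytic_imp_holomorphic)
  \<comment> \<open>When y or q y lies outside U, the equation for f says nothing about g there; it
    is recovered by continuity from nearby points where both are regular.\<close>
  have gper: "g (q * y) = - (q * y ^ 3 * g y)" if y: "y \<noteq> 0" for y
  proof -
    have c: "isCont g y" "isCont g (q * y)"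
      using ana y q by (auto intro!: analytic_at_imp_isCont)
    have 1: "(\<lambda>x. g (q * x)) \<midarrow>y\<rightarrow> g (q * y)"
      by (rule isCont_tendsto_compose[OF c(2)]) (intro tendsto_intros)
    have "(\<lambda>x. - (q * x ^ 3 * g x)) \<midarrow>y\<rightarrow> - (q * y ^ 3 * g y)"
      using c(1) by (intro tendsto_intros) (simp add: isCont_def)
    moreover have "eventually (\<lambda>x. q * x \<in> U) (at y)"
      using isolated[of "q * y"] filterlim_times_at[OF q(1), of y] y q by (auto simp: filterlim_iff)
    then have "eventually (\<lambda>x. - (q * x ^ 3 * g x) = g (q * x)) (at y)"
      using isolated[OF y] by eventually_elim (simp add: gU per)
    ultimately have "(\<lambda>x. g (q * x)) \<midarrow>y\<rightarrow> - (q * y ^ 3 * g y)"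
      by (rule Lim_transform_eventually)
    with 1 show ?thesis
      by (rule LIM_unique)
  qed
  have "g z = 0"
  proof (rule holomorphic_quasi_periodic_eq_0[OF q holg])
    show "g (q * y) = - (q * y ^ 3 * g y)" if "y \<noteq> 0" for y
      using that by (rule gper)
    show "z \<noteq> 0"
      using z U(2) by auto
  qed
  then show ?thesis
    using gU(1)[OF z] by simp
qed

section \<open>The dissection of the rank series\<close>

text \<open>Inversion followed by one shift; subtracting 1 absorbs the inhomogeneous terms.\<close>

lemma rank_series_reflect:
  assumes q: "q \<noteq> 0" "norm q < 1" and x: "x \<noteq> 0" "\<And>k. x * q powi k \<noteq> 1"
  shows "rank_series (q / x) q - 1 = q / x\<^sup>2 * (rank_series x q - 1)"
proof -
  have "inverse x * q powi k \<noteq> 1" for k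
    using x(1) x(2)[of "- k"] q by (auto simp: power_int_minus field_simps)
  then have "rank_series (q * inverse x) q =
      - (q * inverse x ^ 3 * rank_series (inverse x) q) + 1 - q * (inverse x)\<^sup>2"
    using x by (intro rank_series_shift q) auto
  moreover have "q * inverse x ^ 3 * (x * a) = q / x\<^sup>2 * a" for a
    using x(1) by (simp add: field_simps power2_eq_square power3_eq_cube)
  ultimately have "rank_series (q / x) q = q / x\<^sup>2 * rank_series x q + 1 - q / x\<^sup>2"
    unfolding rank_series_inverse[OF q x] by (simp add: divide_inverse power_inverse)
  then show ?thesis
    by (simp add: right_diff_distrib)
qed

lemma norm_power_int_eq_1_iff:
  fixes q :: complex
  assumes "q \<noteq> 0" "norm q < 1"
  shows "norm (q powi k) = 1 \<longleftrightarrow> k = 0"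
proof
  assume *: "norm (q powi k) = 1"
  show "k = 0"
  proof (rule ccontr)
    assume "k \<noteq> 0"
    then have "norm q ^ nat \<bar>k\<bar> < 1"
      using assms by (simp add: power_less_one_iff)
    moreover have "norm q ^ nat \<bar>k\<bar> = 1"
      using * by (auto simp: power_int_def norm_power norm_inverse power_inverse abs_if split: if_splits)
    ultimately show False by simp
  qed
qed simp

lemma rank_series_analytic_at:
  fixes q z :: complex
  assumes q: "q \<noteq> 0" "norm q < 1" and z: "z \<noteq> 0" "\<And>k. z * q powi k \<noteq> 1"
  shows "(\<lambda>w. rank_series w q) analytic_on {z}"
proof -
  obtain r d where rd: "0 < r" "0 < d" "\<And>w k. w \<in> cball z r \<Longrightarrow> k \<in> UNIV \<Longrightarrow> d \<le> norm (1 - w * q powi k)"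
    using appell_denominator_bound[of q z UNIV] q z by blast
  have "eventually (\<lambda>w. w \<in> ball z r - {0}) (nhds z)"
    using rd(1) z by (intro eventually_nhds_in_open) auto
  then have ev: "eventually (\<lambda>w. rank_series w q = appell UNIV w q / qpoch_inf q q) (nhds z)"
  proof eventually_elim
    case (elim w)
    have "w * q powi k \<noteq> 1" for k
    proof -
      have "d \<le> norm (1 - w * q powi k)"
        using elim by (intro rd(3)) auto
      then show ?thesis
        using rd(2) by auto
    qed
    then show ?case
      using elim by (intro rank_series_eq_appell q) auto
  qed
  have "(\<lambda>w. appell UNIV w q / qpoch_inf q q) analytic_on {z}"
    using qpoch_inf_qq_nonzero[OF q(2)] by (intro analytic_intros appell_analytic_at q z) auto
  then show ?thesis
    using analytic_at_cong[OF ev refl] by simp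
qed

text \<open>Near 1 only the term k = 0 of the Appell sum, which is 1/(1 - z), is singular; the sum
  over the other k is analytic there.\<close>

lemma rank_series_pole:
  fixes q :: complex
  assumes q: "q \<noteq> 0" "norm q < 1"
  shows "((\<lambda>z. (1 - z) * rank_series z q) \<longlongrightarrow> inverse (eta 1 q)) (at 1)"
proof -
  have E: "eta 1 q \<noteq> 0" "qpoch_inf q q = eta 1 q"
    using eta_nonzero[OF q(2), of 1] by (simp_all add: eta_def)
  have nz: "1 * q powi k \<noteq> 1" if "k \<in> - {0}" for k
    using norm_power_int_eq_1_iff[OF q, of k] that by auto
  obtain r d where rd: "0 < r" "0 < d" "\<And>w k. w \<in> cball 1 r \<Longrightarrow> k \<in> - {0} \<Longrightarrow> d \<le> norm (1 - w * q powi k)"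
    using appell_denominator_bound[of q 1 "- {0}"] q nz by (metis zero_neq_one)
  have "eventually (\<lambda>w. w \<in> ball 1 r - {0} - {1}) (at (1 :: complex))"
    using rd(1) by (intro eventually_at_in_open) auto
  then have ev: "eventually (\<lambda>w. (1 + (1 - w) * appell (- {0}) w q) * inverse (eta 1 q) = (1 - w) * rank_series w q) (at 1)"
  proof eventually_elim
    case (elim w)
    have wk: "w * q powi k \<noteq> 1" if "k \<in> - {0}" for k
    proof -
      have "d \<le> norm (1 - w * q powi k)"
        using elim that by (intro rd(3)) auto
      then show ?thesis
        using rd(2) by auto
    qed
    then have w: "w * q powi k \<noteq> 1" for k
      using elim by (cases "k = 0") auto
    have "((\<lambda>k. appell_coeff q k / (1 - w * q powi k)) has_sum
        (appell_coeff q 0 / (1 - w * q powi 0) + appell (- {0}) w q)) (insert 0 (- {0}))"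
      using wk elim by (intro has_sum_insert appell_has_sum q) auto
    moreover have "insert 0 (- {0}) = (UNIV :: int set)"
      by auto
    moreover have "((\<lambda>k. appell_coeff q k / (1 - w * q powi k)) has_sum appell UNIV w q) UNIV"
      using w elim by (intro appell_has_sum q) auto
    ultimately have "appell UNIV w q = 1 / (1 - w) + appell (- {0}) w q"
      using has_sum_unique by fastforce
    moreover have "rank_series w q = appell UNIV w q / eta 1 q"
      using w elim E(2) rank_series_eq_appell(2)[OF q, of w] by auto
    moreover have "1 - w \<noteq> 0"
      using elim by auto
    ultimately show ?case
      by (simp add: distrib_left divide_inverse)
  qed
  have "isCont (\<lambda>w. appell (- {0}) w q) 1"
    using nz by (intro analytic_at_imp_isCont appell_analytic_at q) auto
  then have "((\<lambda>w. (1 + (1 - w) * appell (- {0}) w q) * inverse (eta 1 q)) \<longlongrightarrow>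
      (1 + (1 - 1) * appell (- {0}) 1 q) * inverse (eta 1 q)) (at 1)"
    unfolding isCont_def by (intro tendsto_intros)
  then have "((\<lambda>z. (1 - z) * rank_series z q) \<longlongrightarrow> (1 + (1 - 1) * appell (- {0}) 1 q) * inverse (eta 1 q)) (at 1)"
    using ev by (rule Lim_transform_eventually)
  then show ?thesis by simp
qed

lemma jfun_analytic_at:
  assumes "norm q < 1" "x \<noteq> 0"
  shows "(\<lambda>x. jfun x q) analytic_on {x}"
  using holomorphic_jfun[OF assms(1), of "- {0}"] assms(2)
  by (auto simp: analytic_at intro!: exI[of _ "- {0}"])

text \<open>Once 1 - x is split off (x)_inf, three products remain that all equal (q)_inf at x = 1.
  The reciprocal is treated because the theta functions concerned stand in a denominator.\<close>

lemma jfun_pole: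
  fixes q :: complex
  assumes q: "q \<noteq> 0" "norm q < 1"
  shows "((\<lambda>x. (1 - x) / jfun x q) \<longlongrightarrow> inverse (eta 1 q ^ 3)) (at 1)"
proof -
  define j where "j x = qpoch_inf (q * x) q * qpoch_inf (q / x) q * qpoch_inf q q" for x
  have j1: "j 1 = eta 1 q ^ 3"
    by (simp add: j_def eta_def power3_eq_cube)
  have "j holomorphic_on - {0}"
    unfolding j_def[abs_def] using q by (auto intro!: holomorphic_intros)
  then have "j analytic_on {1}"
    by (auto simp: analytic_at intro!: exI[of _ "- {0}"])
  then have "(j \<longlongrightarrow> j 1) (at 1)"
    using analytic_at_imp_isCont isCont_def by blast
  then have "((\<lambda>x. inverse (j x)) \<longlongrightarrow> inverse (eta 1 q ^ 3)) (at 1)"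
    using eta_nonzero[OF q(2), of 1] unfolding j1 by (intro tendsto_intros) auto
  moreover have "eventually (\<lambda>x. inverse (j x) = (1 - x) / jfun x q) (at 1)"
  proof -
    have "jfun x q = (1 - x) * j x" for x
      using qpoch_inf_shift[OF q(2), of x] by (simp add: jfun_def j_def)
    then show ?thesis
      by (auto simp: eventually_at_filter divide_inverse)
  qed
  ultimately show ?thesis
    by (rule Lim_transform_eventually)
qed

lemma analytic_at_compose:
  assumes "f analytic_on {z}" "g analytic_on {f z}"
  shows "(\<lambda>x. g (f x)) analytic_on {z}"
  using analytic_on_compose[OF assms(1), of g] assms(2) by (simp add: o_def)

lemma analytic_at_jfun_compose:
  assumes "f analytic_on {z}" "norm q < 1" "f z \<noteq> 0"
  shows "(\<lambda>z. jfun (f z) q) analytic_on {z}"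
  using analytic_at_compose[OF assms(1) jfun_analytic_at[OF assms(2,3)]] .

text \<open>The four rank series below are permuted by \<open>z \<mapsto> q z\<close>; the monomials and the corrections by \<open>1\<close>
  are chosen so that \<open>rank_dissection\<close> obeys the same inhomogeneous equation as \<open>rank_series\<close>.
  The remaining difference is a theta quotient with simple poles where \<open>z = 1\<close> or
  \<open>- q\<^sup>2 z\<^sup>4 = 1\<close> (up to powers of \<open>q\<close>), determined by its residues.\<close>

definition rank_dissection :: "complex \<Rightarrow> complex \<Rightarrow> complex" where
  "rank_dissection q z = rank_series (- (q\<^sup>2 * z ^ 4)) (q ^ 16) - 1 / z
    - (rank_series (- (q\<^sup>2 * z ^ 4) * q ^ 4) (q ^ 16) - 1) / (q * z ^ 3)
    + (rank_series (- (q\<^sup>2 * z ^ 4) * q ^ 8) (q ^ 16) - 1) / (q ^ 5 * z ^ 6)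
    - (rank_series (- (q\<^sup>2 * z ^ 4) * q ^ 12) (q ^ 16) - 1) / (q ^ 12 * z ^ 9)"

text \<open>The two theta functions, one even and one odd in z, span the holomorphic solutions of
  f(q z) = f(z)/(q z^2). This is the multiplier for which the quotient by \<open>theta_den\<close>
  acquires - q z^3. The two coefficients are fixed by the residues.\<close>

definition theta_num :: "complex \<Rightarrow> complex \<Rightarrow> complex" where
  "theta_num q z = - (eta 2 q * jfun (- (q\<^sup>2)) (q ^ 4)) * jfun (- (q * z\<^sup>2)) (q\<^sup>2)
    + eta 4 q * eta 8 q ^ 3 / (eta 16 q)\<^sup>2 * (z * jfun (- (q\<^sup>2 * z\<^sup>2)) (q\<^sup>2))"

definition theta_den :: "complex \<Rightarrow> complex \<Rightarrow> complex" where
  "theta_den q z = jfun z q * jfun (- (q\<^sup>2 * z ^ 4)) (q ^ 4)"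

definition rank_defect :: "complex \<Rightarrow> complex \<Rightarrow> complex" where
  "rank_defect q z = rank_series z q - rank_dissection q z - theta_num q z / theta_den q z"

section \<open>Poles and functional equations of the defect\<close>

lemma base_power_conds:
  fixes q :: complex
  assumes "q \<noteq> 0" "norm q < 1"
  shows "q\<^sup>2 \<noteq> 0" "norm (q\<^sup>2) < 1" "q ^ 4 \<noteq> 0" "norm (q ^ 4) < 1" "q ^ 16 \<noteq> 0" "norm (q ^ 16) < 1"
  using assms norm_power_lt_1[OF assms(2)] by auto

lemma theta_den_eq_0_iff:
  assumes q: "q \<noteq> 0" "norm q < 1" and z: "z \<noteq> 0"
  shows "theta_den q z = 0 \<longleftrightarrow> (\<exists>k. z * q powi k = 1) \<or> (\<exists>k. - (q\<^sup>2 * z ^ 4) * (q ^ 4) powi k = 1)"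
  unfolding theta_den_def mult_eq_0_iff
  using jfun_eq_0_iff[OF q(2,1) z] jfun_eq_0_iff[OF base_power_conds(4,3)[OF q], of "- (q\<^sup>2 * z ^ 4)"] q z by auto

text \<open>The poles of the four series, where w q^(4j) is a power of q^16, together form the
  single orbit where w is a power of q^4. Hence the base q^4 in the second factor of
  \<open>theta_den\<close>.\<close>

lemma rank_dissection_nonpole_aux:
  fixes q :: complex and k :: int
  assumes q: "q \<noteq> 0" and "\<And>k. w * (q ^ 4) powi k \<noteq> 1"
  shows "w * q ^ (4 * j) * (q ^ 16) powi k \<noteq> 1"
proof -
  have "q ^ (4 * j) * (q ^ 16) powi k = (q ^ 4) powi (int j + 4 * k)"
  proof -
    have "q ^ (4 * j) = (q ^ 4) powi int j"
      by (simp add: power_mult)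
    moreover have "(q ^ 16) powi k = ((q ^ 4) ^ 4) powi k"
      by (simp flip: power_mult)
    then have "(q ^ 16) powi k = (q ^ 4) powi (4 * k)"
      by (simp add: power_int_mult)
    ultimately show ?thesis
      using q by (simp add: power_int_add)
  qed
  then show ?thesis
    using assms(2)[of "int j + 4 * k"] by (simp add: mult.assoc)
qed

lemma rank_dissection_nonpole:
  fixes q :: complex
  assumes q: "q \<noteq> 0" and w: "\<And>k. w * (q ^ 4) powi k \<noteq> 1"
  shows "w * (q ^ 16) powi k \<noteq> 1" "w * q ^ 4 * (q ^ 16) powi k \<noteq> 1"
    "w * q ^ 8 * (q ^ 16) powi k \<noteq> 1" "w * q ^ 12 * (q ^ 16) powi k \<noteq> 1"
  using rank_dissection_nonpole_aux[OF assms, of 0 k] rank_dissection_nonpole_aux[OF assms, of 1 k]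
    rank_dissection_nonpole_aux[OF assms, of 2 k] rank_dissection_nonpole_aux[OF assms, of 3 k] by simp_all

text \<open>Here \<open>a0\<close> to \<open>a3\<close> are the four series at z. At q z each moves
  one place forward, and the last place is filled by \<open>a0\<close> through the shift to base
  q^16.\<close>

lemma rank_dissection_shift_aux:
  fixes q z :: complex
  assumes "q \<noteq> 0" "z \<noteq> 0"
  shows "a1 - 1 / (q * z) - (a2 - 1) / (q * (q * z) ^ 3) + (a3 - 1) / (q ^ 5 * (q * z) ^ 6)
      - (- (q ^ 16 * (- (q\<^sup>2 * z ^ 4)) ^ 3 * a0) + 1 - q ^ 16 * (- (q\<^sup>2 * z ^ 4))\<^sup>2 - 1) / (q ^ 12 * (q * z) ^ 9) =
    - (q * z ^ 3 * (a0 - 1 / z - (a1 - 1) / (q * z ^ 3) + (a2 - 1) / (q ^ 5 * z ^ 6) - (a3 - 1) / (q ^ 12 * z ^ 9)))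
      + 1 - q * z\<^sup>2"
proof -
  \<comment> \<open>The wrap-around leaves the stray term 1 / (q z); the summand - 1 / z in
    \<open>rank_dissection\<close> is there to cancel it.\<close>
  have e: "(- (q ^ 16 * (- (q\<^sup>2 * z ^ 4)) ^ 3 * a0) + 1 - q ^ 16 * (- (q\<^sup>2 * z ^ 4))\<^sup>2 - 1) / (q ^ 12 * (q * z) ^ 9)
      = q * z ^ 3 * a0 - 1 / (q * z)"
    using assms by (simp add: divide_simps) (simp add: algebra_simps eval_nat_numeral)
  have "(a2 - 1) / (q * (q * z) ^ 3) = q * z ^ 3 * ((a2 - 1) / (q ^ 5 * z ^ 6))"
    "(a3 - 1) / (q ^ 5 * (q * z) ^ 6) = q * z ^ 3 * ((a3 - 1) / (q ^ 12 * z ^ 9))"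
    "q * z ^ 3 * ((a1 - 1) / (q * z ^ 3)) = a1 - 1" "q * z ^ 3 * (1 / z) = q * z\<^sup>2"
    using assms by (simp_all add: divide_simps) (simp_all add: algebra_simps eval_nat_numeral)
  then show ?thesis
    unfolding e by (simp only: right_diff_distrib distrib_left) simp
qed

lemma rank_dissection_shift:
  fixes q z :: complex
  assumes q: "q \<noteq> 0" "norm q < 1" and z: "z \<noteq> 0" "\<And>k. - (q\<^sup>2 * z ^ 4) * (q ^ 4) powi k \<noteq> 1"
  shows "rank_dissection q (q * z) = - (q * z ^ 3 * rank_dissection q z) + 1 - q * z\<^sup>2"
proof -
  define w where "w = - (q\<^sup>2 * z ^ 4)"
  have w: "w \<noteq> 0"
    using q z by (simp add: w_def)
  have "rank_series (q ^ 16 * w) (q ^ 16) = - (q ^ 16 * w ^ 3 * rank_series w (q ^ 16)) + 1 - q ^ 16 * w\<^sup>2"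
    using rank_dissection_nonpole(1)[OF q(1) z(2)] base_power_conds[OF q] w
    by (intro rank_series_shift) (auto simp: w_def)
  moreover have "- (q\<^sup>2 * (q * z) ^ 4) = w * q ^ 4" "w * q ^ 4 * q ^ 4 = w * q ^ 8"
    "w * q ^ 4 * q ^ 8 = w * q ^ 12" "w * q ^ 4 * q ^ 12 = q ^ 16 * w"
    by (simp_all add: w_def power_mult_distrib mult_ac flip: power_add)
  ultimately show ?thesis
    unfolding rank_dissection_def w_def[symmetric]
    using rank_dissection_shift_aux[OF q(1) z(1)] by (simp only: w_def)
qed

lemma theta_num_shift:
  assumes q: "q \<noteq> 0" "norm q < 1" and z: "z \<noteq> 0"
  shows "theta_num q (q * z) = theta_num q z / (q * z\<^sup>2)"
proof -
  note qq = base_power_conds[OF q]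
  have e: "- (q * (q * z)\<^sup>2) = q\<^sup>2 * (- (q * z\<^sup>2))" "- (q\<^sup>2 * (q * z)\<^sup>2) = q\<^sup>2 * (- (q\<^sup>2 * z\<^sup>2))"
    by (simp_all add: power_mult_distrib)
  have "- (q * z\<^sup>2) \<noteq> 0" "- (q\<^sup>2 * z\<^sup>2) \<noteq> 0"
    using q z by auto
  note sh = this[THEN jfun_shift[OF qq(2,1)]]
  have "- a / - (q * z\<^sup>2) = a / (q * z\<^sup>2)" "q * z * (- a / - (q\<^sup>2 * z\<^sup>2)) = z * a / (q * z\<^sup>2)" for a
    using q z by (simp_all add: power2_eq_square)
  then have "jfun (- (q * (q * z)\<^sup>2)) (q\<^sup>2) = jfun (- (q * z\<^sup>2)) (q\<^sup>2) / (q * z\<^sup>2)"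
    "q * z * jfun (- (q\<^sup>2 * (q * z)\<^sup>2)) (q\<^sup>2) = z * jfun (- (q\<^sup>2 * z\<^sup>2)) (q\<^sup>2) / (q * z\<^sup>2)"
    unfolding e sh by blast+
  then show ?thesis
    unfolding theta_num_def by (simp only: add_divide_distrib times_divide_eq_right)
qed

lemma theta_den_shift:
  assumes q: "q \<noteq> 0" "norm q < 1" and z: "z \<noteq> 0"
  shows "theta_den q (q * z) = - theta_den q z / (q\<^sup>2 * z ^ 5)"
proof -
  note qq = base_power_conds[OF q]
  have "- (q\<^sup>2 * (q * z) ^ 4) = q ^ 4 * (- (q\<^sup>2 * z ^ 4))"
    by (simp add: power_mult_distrib)
  then have jw: "jfun (- (q\<^sup>2 * (q * z) ^ 4)) (q ^ 4) = jfun (- (q\<^sup>2 * z ^ 4)) (q ^ 4) / (q\<^sup>2 * z ^ 4)"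
    using jfun_shift[OF qq(4,3), of "- (q\<^sup>2 * z ^ 4)"] q z by simp
  have "- a / z * (b / (q\<^sup>2 * z ^ 4)) = - (a * b) / (q\<^sup>2 * z ^ 5)" for a b
    using q z by (simp add: field_simps eval_nat_numeral)
  then show ?thesis
    unfolding theta_den_def jw jfun_shift[OF q(2,1) z] .
qed

lemma rank_defect_shift:
  assumes q: "q \<noteq> 0" "norm q < 1" and z: "z \<noteq> 0" "theta_den q z \<noteq> 0"
  shows "rank_defect q (q * z) = - (q * z ^ 3 * rank_defect q z)"
proof -
  have zk: "z * q powi k \<noteq> 1" "- (q\<^sup>2 * z ^ 4) * (q ^ 4) powi k \<noteq> 1" for k
    using theta_den_eq_0_iff[OF q z(1)] z(2) by auto
  have "theta_num q (q * z) / theta_den q (q * z) = - (q * z ^ 3 * (theta_num q z / theta_den q z))"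
    unfolding theta_num_shift[OF q z(1)] theta_den_shift[OF q z(1)]
    using q z by (simp add: field_simps eval_nat_numeral)
  then show ?thesis
    unfolding rank_defect_def rank_series_shift[OF q z(1) zk(1)] rank_dissection_shift[OF q z(1) zk(2)]
    by (simp add: algebra_simps)
qed

lemma theta_num_analytic_at:
  assumes q: "q \<noteq> 0" "norm q < 1" and z: "z \<noteq> 0"
  shows "theta_num q analytic_on {z}"
  unfolding theta_num_def[abs_def] using base_power_conds[OF q] q z
  by (intro analytic_intros analytic_at_jfun_compose) auto

lemma theta_den_analytic_at:
  assumes q: "q \<noteq> 0" "norm q < 1" and z: "z \<noteq> 0"
  shows "theta_den q analytic_on {z}" "(\<lambda>z. jfun (- (q\<^sup>2 * z ^ 4)) (q ^ 4)) analytic_on {z}"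
  unfolding theta_den_def[abs_def] using base_power_conds[OF q] q z
  by (intro analytic_intros analytic_at_jfun_compose; simp)+

lemma rank_dissection_analytic_at:
  assumes q: "q \<noteq> 0" "norm q < 1" and z: "z \<noteq> 0"
    and w: "\<And>k. - (q\<^sup>2 * z ^ 4) * (q ^ 16) powi k \<noteq> 1" "\<And>k. - (q\<^sup>2 * z ^ 4) * q ^ 4 * (q ^ 16) powi k \<noteq> 1"
    "\<And>k. - (q\<^sup>2 * z ^ 4) * q ^ 8 * (q ^ 16) powi k \<noteq> 1" "\<And>k. - (q\<^sup>2 * z ^ 4) * q ^ 12 * (q ^ 16) powi k \<noteq> 1"
  shows "rank_dissection q analytic_on {z}"
proof -
  have R: "(\<lambda>z. rank_series (f z) (q ^ 16)) analytic_on {z}"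
    if "f analytic_on {z}" "f z \<noteq> 0" "\<And>k. f z * (q ^ 16) powi k \<noteq> 1" for f
    using that base_power_conds[OF q]
    by (intro analytic_at_compose[of f z "\<lambda>x. rank_series x (q ^ 16)"] rank_series_analytic_at) auto
  show ?thesis
    unfolding rank_dissection_def[abs_def] using q z
    by (intro analytic_intros R w) auto
qed

lemma rank_defect_analytic_at:
  assumes q: "q \<noteq> 0" "norm q < 1" and z: "z \<noteq> 0" "theta_den q z \<noteq> 0"
  shows "rank_defect q analytic_on {z}"
proof -
  have zk: "z * q powi k \<noteq> 1" "- (q\<^sup>2 * z ^ 4) * (q ^ 4) powi k \<noteq> 1" for k
    using theta_den_eq_0_iff[OF q z(1)] z(2) by auto
  show ?thesis
    unfolding rank_defect_def[abs_def]
    by (intro analytic_intros rank_series_analytic_at rank_dissection_analytic_at theta_num_analytic_at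
      theta_den_analytic_at q z zk rank_dissection_nonpole[OF q(1) zk(2)]) (use z in auto)
qed

text \<open>In Ramanujan's notation phi(-q) + phi(q) = 2 phi(q^4): the odd halves of the two
  dissections cancel.\<close>

lemma jfun_parity_sum:
  assumes q: "q \<noteq> 0" "norm q < 1"
  shows "jfun q (q\<^sup>2) + jfun (- q) (q\<^sup>2) = 2 * jfun (- (q ^ 4)) (q ^ 8)"
  using jfun_parity[OF base_power_conds(1,2)[OF q], of q] jfun_parity[OF base_power_conds(1,2)[OF q], of "- q"] q
  by (simp add: power_mult[symmetric] power_add[symmetric])

text \<open>The value prescribed by the pole at z = 1, where the rank series contributes 1/(q)_inf
  and the theta quotient 1/(q)_inf^3. Beyond the eta evaluations the one additive relation is
  \<open>jfun_parity_sum\<close>.\<close>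

lemma theta_num_at_1:
  assumes q: "q \<noteq> 0" "norm q < 1"
  shows "theta_num q 1 = (eta 1 q)\<^sup>2 * jfun (- (q\<^sup>2)) (q ^ 4)"
proof -
  note nz = eta_nonzero[OF q(2)]
  note qq = base_power_conds[OF q]
  have j2: "jfun (- (q\<^sup>2)) (q\<^sup>2) = 2 * (eta 4 q)\<^sup>2 / eta 2 q"
    using jfun_eta(4)[OF qq(1,2)] by (simp add: eta_power)
  have p2: "jfun (- (q\<^sup>2)) (q ^ 4) = eta 4 q ^ 5 / ((eta 2 q)\<^sup>2 * (eta 8 q)\<^sup>2)"
    using jfun_eta(2)[OF qq(1,2)] by (simp add: eta_power flip: power_mult)
  have p4: "jfun (- (q ^ 4)) (q ^ 8) = eta 8 q ^ 5 / ((eta 4 q)\<^sup>2 * (eta 16 q)\<^sup>2)"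
    using jfun_eta(2)[OF qq(3,4)] by (simp add: eta_power flip: power_mult)
  have "jfun (- q) (q\<^sup>2) = 2 * jfun (- (q ^ 4)) (q ^ 8) - jfun q (q\<^sup>2)"
    using jfun_parity_sum[OF q] by (simp add: algebra_simps)
  then have p1: "jfun (- q) (q\<^sup>2) = 2 * (eta 8 q ^ 5 / ((eta 4 q)\<^sup>2 * (eta 16 q)\<^sup>2)) - (eta 1 q)\<^sup>2 / eta 2 q"
    unfolding p4 jfun_eta(1)[OF q] .
  show ?thesis
    unfolding theta_num_def using nz[of 1] nz[of 2] nz[of 4] nz[of 8] nz[of 16]
    by (simp add: p1 p2 j2 divide_simps) (simp add: algebra_simps eval_nat_numeral)
qed

text \<open>The value that cancels the pole of the first series in \<open>rank_dissection\<close>.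
  With s = - q z^2 one has s^2 = -1, so the theta functions depending on z become instances of
  \<open>jfun_imaginary_eta\<close>, \<open>jfun z q\<close> after a parity split.\<close>

lemma theta_num_at_pole:
  assumes q: "q \<noteq> 0" "norm q < 1" and z: "- (q\<^sup>2 * z ^ 4) = 1"
  shows "theta_num q z = - (jfun z q * eta 4 q ^ 3 / eta 16 q)"
proof -
  note nz = eta_nonzero[OF q(2)]
  note qq = base_power_conds[OF q]
  define s where "s = - (q * z\<^sup>2)"
  have z0: "z \<noteq> 0"
    using z by auto
  have s: "s\<^sup>2 = - 1"
    using z by (simp add: s_def power_mult_distrib minus_equation_iff[of _ 1] flip: power_mult)
  have sq: "- (q\<^sup>2 * z\<^sup>2) = s * q" "- (q ^ 3 * z\<^sup>2) = s * q\<^sup>2" "- (q * z\<^sup>2) = s"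
    by (simp_all add: s_def power2_eq_square power3_eq_cube)
  have p2: "jfun (- (q\<^sup>2)) (q ^ 4) = eta 4 q ^ 5 / ((eta 2 q)\<^sup>2 * (eta 8 q)\<^sup>2)"
    using jfun_eta(2)[OF qq(1,2)] by (simp add: eta_power flip: power_mult)
  have j1: "jfun s (q\<^sup>2) = (1 - s) * (eta 2 q * eta 8 q / eta 4 q)"
    using jfun_imaginary_eta(1)[OF qq(1,2) s] by (simp add: eta_power)
  have j2: "jfun (s * q) (q\<^sup>2) = (eta 4 q)\<^sup>2 / eta 8 q"
    by (rule jfun_imaginary_eta(2)[OF q s])
  have j3: "jfun s (q ^ 4) = (1 - s) * (eta 4 q * eta 16 q / eta 8 q)"
    using jfun_imaginary_eta(1)[OF qq(3,4) s] by (simp add: eta_power)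
  have j4: "jfun (s * q\<^sup>2) (q ^ 4) = (eta 8 q)\<^sup>2 / eta 16 q"
    using jfun_imaginary_eta(2)[OF qq(1,2) s] by (simp add: eta_power flip: power_mult)
  have jz: "jfun z q = (1 - s) * (eta 4 q * eta 16 q / eta 8 q) - z * ((eta 8 q)\<^sup>2 / eta 16 q)"
    using jfun_parity[OF q z0] unfolding sq j3 j4 .
  show ?thesis
    unfolding theta_num_def sq j1 j2 p2 jz using nz[of 2] nz[of 4] nz[of 8] nz[of 16]
    by (simp add: divide_simps) (simp add: algebra_simps eval_nat_numeral)
qed

section \<open>Removability of the poles of the defect\<close>

lemma power_int_of_power:
  fixes q :: complex
  shows "(q ^ n) powi k = q powi (int n * k)"
  by (simp add: power_int_mult)

lemma rank_defect_removable_1: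
  assumes q: "q \<noteq> 0" "norm q < 1"
  shows "((\<lambda>z. (z - 1) * rank_defect q z) \<longlongrightarrow> 0) (at 1)"
proof -
  note nz = eta_nonzero[OF q(2)]
  define W where "W z = jfun (- (q\<^sup>2 * z ^ 4)) (q ^ 4)" for z
  \<comment> \<open>Taking norms would force the exponent 2 + 4k to be 0, impossible modulo 4. So z
    = 1 is a pole of the rank series but not of the dissection.\<close>
  have w: "- (q\<^sup>2 * 1 ^ 4) * (q ^ 4) powi k \<noteq> 1" for k
  proof
    assume "- (q\<^sup>2 * 1 ^ 4) * (q ^ 4) powi k = 1"
    then have "norm (- (q\<^sup>2 * 1 ^ 4) * (q ^ 4) powi k) = 1"
      by simp
    moreover have "- (q\<^sup>2 * 1 ^ 4) * (q ^ 4) powi k = - (q powi (2 + 4 * k))"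
      using q by (simp add: power_int_add power_int_of_power)
    ultimately have "2 + 4 * k = 0"
      using norm_power_int_eq_1_iff[OF q, of "2 + 4 * k"] by simp
    then show False by presburger
  qed
  have W1: "W 1 \<noteq> 0"
    using w jfun_eq_0_iff[OF base_power_conds(4,3)[OF q], of "- (q\<^sup>2 * 1 ^ 4)"] q by (auto simp: W_def)
  have H: "isCont (rank_dissection q) 1"
    by (intro analytic_at_imp_isCont rank_dissection_analytic_at rank_dissection_nonpole q w) auto
  have N: "isCont (theta_num q) 1" "isCont W 1"
    unfolding W_def[abs_def] by (intro analytic_at_imp_isCont theta_num_analytic_at theta_den_analytic_at q; simp)+
  have "((\<lambda>z. - ((1 - z) * rank_series z q) - (z - 1) * rank_dissection q z + theta_num q z / W z * ((1 - z) / jfun z q))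
      \<longlongrightarrow> - inverse (eta 1 q) - (1 - 1) * rank_dissection q 1 + theta_num q 1 / W 1 * inverse (eta 1 q ^ 3)) (at 1)"
    using H N W1 unfolding isCont_def
    by (intro tendsto_intros rank_series_pole jfun_pole q) auto
  also have "- inverse (eta 1 q) - (1 - 1) * rank_dissection q 1 + theta_num q 1 / W 1 * inverse (eta 1 q ^ 3) = 0"
    using W1 nz[of 1] unfolding theta_num_at_1[OF q] W_def
    by (simp add: field_simps power2_eq_square power3_eq_cube)
  also have "(\<lambda>z. - ((1 - z) * rank_series z q) - (z - 1) * rank_dissection q z + theta_num q z / W z * ((1 - z) / jfun z q))
      = (\<lambda>z. (z - 1) * rank_defect q z)"
  proof
    fix z :: complex
    define X where "X = theta_num q z / W z * ((1 - z) / jfun z q)"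
    have "(z - 1) * (N / (J * W)) = - (N / W * ((1 - z) / J))" for N J W
      by (simp add: divide_inverse algebra_simps)
    then have "(z - 1) * (theta_num q z / (jfun z q * W z)) = - X"
      unfolding X_def .
    then have "(z - 1) * rank_defect q z = (z - 1) * rank_series z q - (z - 1) * rank_dissection q z + X"
      unfolding rank_defect_def theta_den_def W_def[symmetric] right_diff_distrib by simp
    then show "- ((1 - z) * rank_series z q) - (z - 1) * rank_dissection q z + theta_num q z / W z * ((1 - z) / jfun z q)
      = (z - 1) * rank_defect q z"
      unfolding X_def[symmetric] by (simp add: algebra_simps)
  qed
  finally show ?thesis .
qed

lemma rank_defect_removable_pole:
  assumes q: "q \<noteq> 0" "norm q < 1" and p: "- (q\<^sup>2 * p ^ 4) = 1"
  shows "((\<lambda>z. (z - p) * rank_defect q z) \<longlongrightarrow> 0) (at p)"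
proof -
  note nz = eta_nonzero[OF q(2)]
  note qq = base_power_conds[OF q]
  define w where "w z = - (q\<^sup>2 * z ^ 4)" for z
  \<comment> \<open>At p only the first of the four series is singular. The remainder H is regular
    because w p = 1 keeps w q^4, w q^8 and w q^12 off the powers of q^16.\<close>
  define H where "H z = rank_dissection q z - rank_series (w z) (q ^ 16)" for z
  have p0: "p \<noteq> 0"
    using p by auto
  have wp: "w p = 1"
    using p by (simp add: w_def)
  have pk: "p * q powi k \<noteq> 1" for k
  proof
    assume "p * q powi k = 1"
    then have "p = inverse (q powi k)"
      using q by (simp add: field_simps)
    then have "q\<^sup>2 * p ^ 4 = q powi (2 - 4 * k)"
      using q by (simp add: power_int_power power_int_power' power_int_diff power_inverse divide_inverse mult.commute)
    moreover have "norm (q\<^sup>2 * p ^ 4) = 1"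
      using p by (metis norm_minus_cancel norm_one)
    ultimately have "2 - 4 * k = 0"
      using norm_power_int_eq_1_iff[OF q, of "2 - 4 * k"] by simp
    then show False by presburger
  qed
  then have J: "jfun p q \<noteq> 0"
    using jfun_eq_0_iff[OF q(2,1) p0] by auto
  have qk: "q ^ j * (q ^ 16) powi k \<noteq> 1" if "j \<in> {4, 8, 12}" for j k
  proof
    assume "q ^ j * (q ^ 16) powi k = 1"
    moreover have "q ^ j * (q ^ 16) powi k = q powi (int j + 16 * k)"
      using q by (simp add: power_int_add power_int_of_power)
    ultimately have "int j + 16 * k = 0"
      using norm_power_int_eq_1_iff[OF q, of "int j + 16 * k"] by simp
    then show False
      using that by auto presburger+
  qed
  have R: "(\<lambda>z. rank_series (w z * q ^ j) (q ^ 16)) analytic_on {p}" if "j \<in> {4, 8, 12}" for j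
  proof (rule analytic_at_compose[where g = "\<lambda>x. rank_series x (q ^ 16)"])
    show "(\<lambda>z. w z * q ^ j) analytic_on {p}"
      unfolding w_def by (intro analytic_intros)
    show "(\<lambda>x. rank_series x (q ^ 16)) analytic_on {w p * q ^ j}"
      using qk[OF that] q by (intro rank_series_analytic_at qq) (auto simp: wp)
  qed
  have H_eq: "H = (\<lambda>z. - 1 / z - (rank_series (w z * q ^ 4) (q ^ 16) - 1) / (q * z ^ 3)
    + (rank_series (w z * q ^ 8) (q ^ 16) - 1) / (q ^ 5 * z ^ 6)
    - (rank_series (w z * q ^ 12) (q ^ 16) - 1) / (q ^ 12 * z ^ 9))"
    by (simp add: H_def rank_dissection_def w_def fun_eq_iff)
  have "H analytic_on {p}"
    unfolding H_eq using p0 q by (intro analytic_intros R) auto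
  then have H: "isCont H p"
    by (rule analytic_at_imp_isCont)
  have T: "isCont (\<lambda>z. rank_series z q) p"
    by (intro analytic_at_imp_isCont rank_series_analytic_at q p0 pk)
  have NJ: "isCont (theta_num q) p" "isCont (\<lambda>z. jfun z q) p"
    by (intro analytic_at_imp_isCont theta_num_analytic_at jfun_analytic_at q p0)+
  have "(w has_field_derivative - (q\<^sup>2 * (4 * p ^ 3))) (at p)"
    unfolding w_def by (auto intro!: derivative_eq_intros)
  then have D: "((\<lambda>z. (w z - 1) / (z - p)) \<longlongrightarrow> - (q\<^sup>2 * (4 * p ^ 3))) (at p)"
    by (simp add: has_field_derivative_iff wp)
  have D0: "- (q\<^sup>2 * (4 * p ^ 3)) \<noteq> 0"
    using q p0 by simp
  \<comment> \<open>The limit of (z - p)/(1 - w z), read off from the derivative of w. Both singular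
    terms carry this factor, so the cancellation is decided by
    \<open>theta_num_at_pole\<close>.\<close>
  define \<rho> where "\<rho> = - inverse (- (q\<^sup>2 * (4 * p ^ 3)))"
  have "((\<lambda>z. - inverse ((w z - 1) / (z - p))) \<longlongrightarrow> \<rho>) (at p)"
    unfolding \<rho>_def by (intro tendsto_intros D D0)
  moreover have "(\<lambda>z. - inverse ((w z - 1) / (z - p))) = (\<lambda>z. (z - p) / (1 - w z))"
    by (simp add: fun_eq_iff minus_divide_right)
  ultimately have rho: "((\<lambda>z. (z - p) / (1 - w z)) \<longlongrightarrow> \<rho>) (at p)"
    by simp
  have ev: "eventually (\<lambda>z. w z \<noteq> 1) (at p)"
    using tendsto_imp_eventually_ne[OF D D0] by eventually_elim auto
  have "w \<midarrow>p\<rightarrow> w p"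
    unfolding w_def by (intro tendsto_intros)
  then have wlim: "filterlim w (at 1) (at p)"
    using ev unfolding wp by (intro filterlim_atI)
  have T16: "((\<lambda>z. (1 - w z) * rank_series (w z) (q ^ 16)) \<longlongrightarrow> inverse (eta 16 q)) (at p)"
    using filterlim_compose[OF rank_series_pole[OF qq(5,6)] wlim] by (simp add: eta_power)
  have J4: "((\<lambda>z. (1 - w z) / jfun (w z) (q ^ 4)) \<longlongrightarrow> inverse (eta 4 q ^ 3)) (at p)"
    using filterlim_compose[OF jfun_pole[OF qq(3,4)] wlim] by (simp add: eta_power)
  have "((\<lambda>z. (z - p) * rank_series z q - ((z - p) / (1 - w z)) * ((1 - w z) * rank_series (w z) (q ^ 16))
      - (z - p) * H z - theta_num q z / jfun z q * (((z - p) / (1 - w z)) * ((1 - w z) / jfun (w z) (q ^ 4))))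
    \<longlongrightarrow> (p - p) * rank_series p q - \<rho> * inverse (eta 16 q) - (p - p) * H p
      - theta_num q p / jfun p q * (\<rho> * inverse (eta 4 q ^ 3))) (at p)"
    using H T NJ J unfolding isCont_def
    by (intro tendsto_intros rho T16 J4) auto
  also have "(p - p) * rank_series p q - \<rho> * inverse (eta 16 q) - (p - p) * H p
      - theta_num q p / jfun p q * (\<rho> * inverse (eta 4 q ^ 3)) = 0"
    unfolding theta_num_at_pole[OF q p] using J nz[of 4] nz[of 16] by (simp add: field_simps)
  finally have lim: "((\<lambda>z. (z - p) * rank_series z q - ((z - p) / (1 - w z)) * ((1 - w z) * rank_series (w z) (q ^ 16))
      - (z - p) * H z - theta_num q z / jfun z q * (((z - p) / (1 - w z)) * ((1 - w z) / jfun (w z) (q ^ 4))))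
    \<longlongrightarrow> 0) (at p)" .
  have "eventually (\<lambda>z. (z - p) * rank_series z q - ((z - p) / (1 - w z)) * ((1 - w z) * rank_series (w z) (q ^ 16))
      - (z - p) * H z - theta_num q z / jfun z q * (((z - p) / (1 - w z)) * ((1 - w z) / jfun (w z) (q ^ 4)))
      = (z - p) * rank_defect q z) (at p)"
    using ev
  proof eventually_elim
    case (elim z)
    define d where "d = 1 - w z"
    have d: "d \<noteq> 0"
      using elim by (auto simp: d_def)
    have e1: "((z - p) / d) * (d * rank_series (w z) (q ^ 16)) = (z - p) * rank_series (w z) (q ^ 16)"
      using d by simp
    have e2: "((z - p) / d) * (d / jfun (w z) (q ^ 4)) = (z - p) / jfun (w z) (q ^ 4)"
      using d by simp
    have e3: "theta_num q z / jfun z q * ((z - p) / jfun (w z) (q ^ 4)) = (z - p) * (theta_num q z / theta_den q z)"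
      by (simp add: theta_den_def w_def)
    show ?case
      unfolding d_def[symmetric] e1 e2 e3 H_def rank_defect_def by (simp add: algebra_simps)
  qed
  with lim show ?thesis
    by (rule Lim_transform_eventually)
qed

theorem rank_series_dissection:
  assumes q: "q \<noteq> 0" "norm q < 1" and z: "z \<noteq> 0" "theta_den q z \<noteq> 0"
  shows "rank_series z q = rank_dissection q z + theta_num q z / theta_den q z"
proof -
  define U where "U = {z. z \<noteq> 0 \<and> theta_den q z \<noteq> 0}"
  have holden: "theta_den q holomorphic_on - {0}"
    by (intro analytic_imp_holomorphic, subst analytic_on_analytic_at)
       (auto intro!: theta_den_analytic_at q)
  have "open ((- {0}) \<inter> theta_den q -` (- {0}))"
    by (intro continuous_open_preimage holomorphic_on_imp_continuous_on holden) auto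
  moreover have "U = (- {0}) \<inter> theta_den q -` (- {0})"
    by (auto simp: U_def)
  ultimately have "open U"
    by simp
  have "rank_defect q z = 0"
  proof (rule punctured_quasi_periodic_eq_0[where f = "rank_defect q" and U = U, OF q])
    show "open U" "0 \<notin> U" "z \<in> U"
      using \<open>open U\<close> z by (auto simp: U_def)
    show "eventually (\<lambda>z. z \<in> U) (at p)" if p: "p \<noteq> 0" for p
    proof (cases "p \<in> U")
      case True
      then show ?thesis
        using eventually_at_in_open'[OF \<open>open U\<close>] by blast
    next
      case False
      \<comment> \<open>Zeros of \<open>theta_den\<close> are isolated because it does not vanish
        identically; the given z witnesses this.\<close>
      have "connected (- {0 :: complex})"
        using connected_open_delete[of "UNIV :: complex set" 0] connected_UNIV by (simp add: Compl_eq_Diff_UNIV)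
      moreover have "theta_den q p = 0"
        using False p by (simp add: U_def)
      ultimately obtain r where r: "0 < r" "ball p r \<subseteq> - {0}" "\<And>z. z \<in> ball p r - {p} \<Longrightarrow> theta_den q z \<noteq> 0"
        using isolated_zeros[OF holden, of p z] p z by (metis Compl_iff open_Compl closed_singleton singletonD)
      have "eventually (\<lambda>z. z \<in> ball p r - {p}) (at p)"
        using r(1) by (intro eventually_at_in_open) auto
      then show ?thesis
        by eventually_elim (use r in \<open>auto simp: U_def\<close>)
    qed
    have "rank_defect q analytic_on U"
      by (subst analytic_on_analytic_at) (auto simp: U_def intro!: rank_defect_analytic_at q)
    then show "rank_defect q holomorphic_on U"
      by (rule analytic_imp_holomorphic)
    show "rank_defect q (q * y) = - (q * y ^ 3 * rank_defect q y)" if "y \<in> U" for y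
      using that by (intro rank_defect_shift q) (auto simp: U_def)
    show "\<exists>n::int. ((\<lambda>z. (z - p * q powi n) * rank_defect q z) \<longlongrightarrow> 0) (at (p * q powi n))"
      if p: "p \<noteq> 0" "p \<notin> U" for p
    proof -
      have "theta_den q p = 0"
        using p by (simp add: U_def)
      then consider k where "p * q powi k = 1" | k where "- (q\<^sup>2 * p ^ 4) * (q ^ 4) powi k = 1"
        using theta_den_eq_0_iff[OF q p(1)] by blast
      then show ?thesis
      proof cases
        case 1
        then show ?thesis
          using rank_defect_removable_1[OF q] by (intro exI[of _ k]) simp
      next
        case 2
        \<comment> \<open>The power of q^4 is absorbed by moving from p to p q^k on its orbit, where
          - q^2 p^4 = 1 holds exactly.\<close>
        have "(q ^ 4) powi k = (q powi k) ^ 4"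
          by (simp add: power_int_power power_int_power' mult.commute)
        then have "- (q\<^sup>2 * (p * q powi k) ^ 4) = 1"
          using 2 by (simp add: power_mult_distrib mult.assoc)
        then show ?thesis
          using rank_defect_removable_pole[OF q] by blast
      qed
    qed
  qed
  then show ?thesis
    by (simp add: rank_defect_def algebra_simps)
qed

section \<open>Partitions by largest part\<close>

lemma has_sum_product_complex:
  fixes f :: "'a \<Rightarrow> complex" and g :: "'b \<Rightarrow> complex"
  assumes "(f has_sum a) A" "(g has_sum b) B"
  shows "((\<lambda>(x, y). f x * g y) has_sum (a * b)) (A \<times> B)"
proof -
  have "(\<lambda>x. norm (f x)) summable_on A" "(\<lambda>y. norm (g y)) summable_on B"
    using assms by (simp_all add: has_sum_imp_summable flip: summable_on_iff_abs_summable_on_complex)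
  then have "(\<lambda>(x, y). norm (f x) * norm (g y)) summable_on A \<times> B"
    by (intro summable_on_SigmaI[where g = "\<lambda>x. norm (f x) * infsum (\<lambda>y. norm (g y)) B"])
       (auto intro!: has_sum_cmult_right summable_on_cmult_left)
  then have "(\<lambda>p. norm (case p of (x, y) \<Rightarrow> f x * g y)) summable_on A \<times> B"
    by (rule Infinite_Sum.abs_summable_on_comparison_test') (auto simp: norm_mult)
  then have s: "(\<lambda>(x, y). f x * g y) summable_on A \<times> B"
    by (rule abs_summable_summable)
  show ?thesis
  proof (rule has_sum_SigmaI[OF _ _ s])
    show "((\<lambda>y. case (x, y) of (x, y) \<Rightarrow> f x * g y) has_sum f x * b) B" for x
      unfolding prod.case by (intro has_sum_cmult_right assms)
    show "((\<lambda>x. f x * b) has_sum a * b) A"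
      by (intro has_sum_cmult_left assms)
  qed
qed

lemma has_sum_geometric_complex:
  fixes x :: complex
  assumes "norm x < 1"
  shows "((\<lambda>j. x ^ j) has_sum inverse (1 - x)) UNIV"
proof (rule norm_summable_imp_has_sum)
  show "summable (\<lambda>j. norm (x ^ j))"
    using assms by (simp add: norm_power summable_geometric)
  show "(\<lambda>j. x ^ j) sums inverse (1 - x)"
    using geometric_sums[OF assms] by (simp add: inverse_eq_divide)
qed

definition bounded_parts :: "nat \<Rightarrow> nat multiset set" where
  "bounded_parts N = {P. set_mset P \<subseteq> {1..N}}"

lemma bij_betw_bounded_parts_Suc:
  "bij_betw (\<lambda>(P, j). P + replicate_mset j (Suc N)) (bounded_parts N \<times> UNIV) (bounded_parts (Suc N))"
proof (rule bij_betwI[where g = "\<lambda>P. (filter_mset (\<lambda>x. x \<noteq> Suc N) P, count P (Suc N))"])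
  show "(\<lambda>(P, j). P + replicate_mset j (Suc N)) \<in> bounded_parts N \<times> UNIV \<rightarrow> bounded_parts (Suc N)"
    by (fastforce simp: bounded_parts_def)
  show "(\<lambda>P. (filter_mset (\<lambda>x. x \<noteq> Suc N) P, count P (Suc N))) \<in> bounded_parts (Suc N) \<rightarrow> bounded_parts N \<times> UNIV"
    by (fastforce simp: bounded_parts_def)
next
  fix p :: "nat multiset \<times> nat"
  assume "p \<in> bounded_parts N \<times> UNIV"
  then obtain P j where p: "p = (P, j)" and P: "set_mset P \<subseteq> {1..N}"
    by (auto simp: bounded_parts_def)
  have "Suc N \<notin># P"
    using P by auto
  then have "count P (Suc N) = 0"
    by (simp add: not_in_iff)
  moreover have "filter_mset (\<lambda>x. x \<noteq> Suc N) P = P"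
    using \<open>Suc N \<notin># P\<close> by (auto simp: filter_mset_eq_conv)
  moreover have "filter_mset (\<lambda>x. x \<noteq> Suc N) (replicate_mset j (Suc N)) = {#}"
    by (auto simp: multiset_eq_iff)
  ultimately show "(\<lambda>P. (filter_mset (\<lambda>x. x \<noteq> Suc N) P, count P (Suc N)))
      (case p of (P, j) \<Rightarrow> P + replicate_mset j (Suc N)) = p"
    unfolding p by simp
next
  fix P :: "nat multiset"
  show "(case (\<lambda>P. (filter_mset (\<lambda>x. x \<noteq> Suc N) P, count P (Suc N))) P of
      (P, j) \<Rightarrow> P + replicate_mset j (Suc N)) = P"
    by (auto simp: multiset_eq_iff)
qed

text \<open>Each admissible part size contributes an independent geometric series; y marks the
  number of parts.\<close>

lemma bounded_parts_has_sum:
  fixes q y :: complex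
  assumes q: "norm q < 1" and y: "norm y \<le> 1"
  shows "((\<lambda>P. y ^ size P * q ^ sum_mset P) has_sum inverse (qpoch (q * y) q N)) (bounded_parts N)"
proof (induction N)
  case 0
  have "bounded_parts 0 = {{#}}"
    by (auto simp: bounded_parts_def)
  then show ?case
    using has_sum_finite[of "{{#}}" "\<lambda>P. y ^ size P * q ^ sum_mset P"] by simp
next
  case (Suc N)
  have "norm (y * q ^ Suc N) \<le> 1 * norm q"
    unfolding norm_mult[of y] norm_power using q y power_decreasing[of 1 "Suc N" "norm q"]
    by (intro mult_mono) auto
  then have "((\<lambda>j. (y * q ^ Suc N) ^ j) has_sum inverse (1 - y * q ^ Suc N)) UNIV"
    using q by (intro has_sum_geometric_complex) simp
  from has_sum_product_complex[OF Suc this]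
  have "((\<lambda>p. (\<lambda>P. y ^ size P * q ^ sum_mset P) (case p of (P, j) \<Rightarrow> P + replicate_mset j (Suc N)))
      has_sum (inverse (qpoch (q * y) q N) * inverse (1 - y * q ^ Suc N))) (bounded_parts N \<times> UNIV)"
    by (rule has_sum_cong[THEN iffD1, rotated])
       (auto simp: power_add power_mult_distrib mult_ac simp flip: power_mult)
  then have "((\<lambda>P. y ^ size P * q ^ sum_mset P)
      has_sum (inverse (qpoch (q * y) q N) * inverse (1 - y * q ^ Suc N))) (bounded_parts (Suc N))"
    using has_sum_reindex_bij_betw[OF bij_betw_bounded_parts_Suc, of "\<lambda>P. y ^ size P * q ^ sum_mset P"] by simp
  moreover have "inverse (qpoch (q * y) q N) * inverse (1 - y * q ^ Suc N) = inverse (qpoch (q * y) q (Suc N))"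
    by (simp add: qpoch_Suc mult_ac)
  ultimately show ?case by simp
qed

definition all_partitions :: "nat multiset set" where
  "all_partitions = {P. \<forall>x\<in>#P. 0 < x}"

text \<open>N is the largest part minus one, so that it runs through all naturals. Only one copy of
  the largest part is removed, and the rest may still contain it.\<close>

lemma bij_betw_largest_part:
  "bij_betw (\<lambda>(N, P). add_mset (Suc N) P) (SIGMA N:UNIV. bounded_parts (Suc N)) (all_partitions - {{#}})"
proof (rule bij_betwI[where g = "\<lambda>P. (Max (set_mset P) - 1, P - {#Max (set_mset P)#})"])
  show "(\<lambda>(N, P). add_mset (Suc N) P) \<in> (SIGMA N:UNIV. bounded_parts (Suc N)) \<rightarrow> all_partitions - {{#}}"
    by (fastforce simp: bounded_parts_def all_partitions_def)
  have Max: "Max (set_mset P) \<in># P" "\<And>x. x \<in># P \<Longrightarrow> x \<le> Max (set_mset P)" "0 < Max (set_mset P)"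
    if "P \<in> all_partitions - {{#}}" for P
  proof -
    show "Max (set_mset P) \<in># P"
      using that Max_in[of "set_mset P"] by auto
    then show "0 < Max (set_mset P)"
      using that by (auto simp: all_partitions_def)
  qed auto
  show "(\<lambda>P. (Max (set_mset P) - 1, P - {#Max (set_mset P)#})) \<in> all_partitions - {{#}} \<rightarrow> (SIGMA N:UNIV. bounded_parts (Suc N))"
  proof
    fix P assume P: "P \<in> all_partitions - {{#}}"
    have "x \<in> {1..Max (set_mset P)}" if "x \<in># P - {#Max (set_mset P)#}" for x
      using in_diffD[OF that] Max[OF P] P by (auto simp: all_partitions_def Suc_le_eq)
    then show "(Max (set_mset P) - 1, P - {#Max (set_mset P)#}) \<in> (SIGMA N:UNIV. bounded_parts (Suc N))"
      using Max(3)[OF P] by (auto simp: bounded_parts_def)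
  qed
  show "(case (Max (set_mset P) - 1, P - {#Max (set_mset P)#}) of (N, P) \<Rightarrow> add_mset (Suc N) P) = P"
    if "P \<in> all_partitions - {{#}}" for P
    using Max[OF that] by simp
next
  fix p assume "p \<in> (SIGMA N:UNIV. bounded_parts (Suc N))"
  then obtain N P where p: "p = (N, P)" and P: "set_mset P \<subseteq> {1..Suc N}"
    by (auto simp: bounded_parts_def)
  have "Max (set_mset (add_mset (Suc N) P)) = Suc N"
    using P by (intro Max_eqI) auto
  then show "(\<lambda>P. (Max (set_mset P) - 1, P - {#Max (set_mset P)#})) (case p of (N, P) \<Rightarrow> add_mset (Suc N) P) = p"
    unfolding p by simp
qed

text \<open>The largest part is N + 1 and there are size P + 1 parts; the two units cancel.\<close>

lemma prank_add_mset_bounded: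
  assumes "P \<in> bounded_parts (Suc N)"
  shows "prank (add_mset (Suc N) P) = int N - int (size P)"
proof -
  have "Max (set_mset (add_mset (Suc N) P)) = Suc N"
    using assms by (intro Max_eqI) (auto simp: bounded_parts_def)
  then show ?thesis
    unfolding prank_def by (simp del: set_mset_add_mset_insert)
qed

text \<open>Sorting by the largest part makes the rank exponent explicit. The value S stays
  existential until the Rogers-Fine iteration identifies it for z \<noteq> 1.\<close>

theorem rank_generating_function_largest_part:
  fixes q z :: complex
  assumes q: "q \<noteq> 0" "norm q < 1" and z: "norm z = 1"
  shows "\<exists>S. (\<lambda>N. z ^ N * q ^ Suc N * inverse (qpoch (q / z) q (Suc N))) sums S \<and>
    ((\<lambda>P. z powi prank P * q ^ sum_mset P) has_sum (1 + S)) all_partitions"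
proof -
  define f where "f P = z powi prank P * q ^ sum_mset P" for P
  define F where "F = (\<lambda>(N, P). f (add_mset (Suc N) P))"
  have z0: "z \<noteq> 0"
    using z by auto
  have F_eq: "F (N, P) = z ^ N * q ^ Suc N * ((1 / z) ^ size P * q ^ sum_mset P)"
    if "P \<in> bounded_parts (Suc N)" for N P
    unfolding F_def prod.case f_def prank_add_mset_bounded[OF that] using z0
    by (simp add: power_int_diff power_add power_divide mult_ac)
  have inner: "((\<lambda>P. F (N, P)) has_sum z ^ N * q ^ Suc N * inverse (qpoch (q / z) q (Suc N))) (bounded_parts (Suc N))" for N
  proof -
    have "((\<lambda>P. z ^ N * q ^ Suc N * ((1 / z) ^ size P * q ^ sum_mset P)) has_sum
        z ^ N * q ^ Suc N * inverse (qpoch (q * (1 / z)) q (Suc N))) (bounded_parts (Suc N))"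
      using z by (intro has_sum_cmult_right bounded_parts_has_sum q) (simp add: norm_divide)
    then show ?thesis
      by (subst has_sum_cong[OF F_eq]) auto
  qed
  \<comment> \<open>Absolute convergence is checked by the same count at the positive real point r
    with y = 1; the complex lemma is reused there and its real part taken.\<close>
  define r where "r = norm q"
  have r: "norm (complex_of_real r) < 1"
    using q by (simp add: r_def)
  obtain K where K: "0 < K" "\<And>n. norm (inverse (qpoch (complex_of_real r) (of_real r) n)) \<le> K"
    using bounded_inverse_qpoch[OF r] by metis
  have reals: "((\<lambda>P. r ^ sum_mset P) has_sum Re (inverse (qpoch (of_real r) (of_real r) N))) (bounded_parts N)" for N
  proof -
    have "((\<lambda>P. complex_of_real r ^ sum_mset P) has_sum inverse (qpoch (of_real r) (of_real r) N)) (bounded_parts N)"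
      using bounded_parts_has_sum[OF r, of 1 N] by simp
    from has_sum_Re[OF this] show ?thesis
      by (simp flip: of_real_power)
  qed
  have "(\<lambda>(N, P). r ^ Suc N * r ^ sum_mset P) summable_on (SIGMA N:UNIV. bounded_parts (Suc N))"
  proof (rule summable_on_SigmaI)
    show "((\<lambda>P. case (N, P) of (N, P) \<Rightarrow> r ^ Suc N * r ^ sum_mset P) has_sum
        r ^ Suc N * Re (inverse (qpoch (of_real r) (of_real r) (Suc N)))) (bounded_parts (Suc N))" for N
      unfolding prod.case by (intro has_sum_cmult_right reals)
    have "summable (\<lambda>N. r ^ N * (r * K))"
      using q by (intro summable_mult2 summable_geometric) (simp add: r_def)
    then have sm: "summable (\<lambda>N. r ^ Suc N * K)"
      by (simp add: mult_ac)
    have "summable (\<lambda>N. norm (r ^ Suc N * Re (inverse (qpoch (of_real r) (of_real r) (Suc N)))))"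
    proof (rule summable_comparison_test[OF _ sm], intro exI allI impI)
      fix N
      have "\<bar>Re (inverse (qpoch (complex_of_real r) (of_real r) (Suc N)))\<bar> \<le> K"
        using abs_Re_le_cmod K(2) order_trans by blast
      then have "r ^ Suc N * \<bar>Re (inverse (qpoch (complex_of_real r) (of_real r) (Suc N)))\<bar> \<le> r ^ Suc N * K"
        by (intro mult_left_mono) (auto simp: r_def)
      then show "norm (norm (r ^ Suc N * Re (inverse (qpoch (of_real r) (of_real r) (Suc N))))) \<le> r ^ Suc N * K"
        by (simp add: abs_mult r_def)
    qed
    then show "(\<lambda>N. r ^ Suc N * Re (inverse (qpoch (of_real r) (of_real r) (Suc N)))) summable_on UNIV"
      by (rule norm_summable_imp_summable_on)
  qed (auto simp: r_def)
  then have "(\<lambda>p. norm (F p)) summable_on (SIGMA N:UNIV. bounded_parts (Suc N))"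
  proof (rule Infinite_Sum.abs_summable_on_comparison_test')
    fix p assume "p \<in> (SIGMA N:UNIV. bounded_parts (Suc N))"
    then obtain N P where p: "p = (N, P)" "P \<in> bounded_parts (Suc N)"
      by auto
    show "norm (F p) \<le> (case p of (N, P) \<Rightarrow> r ^ Suc N * r ^ sum_mset P)"
      unfolding p(1) F_eq[OF p(2)] prod.case using z by (simp add: norm_mult norm_power norm_divide r_def)
  qed
  then have "F summable_on (SIGMA N:UNIV. bounded_parts (Suc N))"
    by (rule abs_summable_summable)
  then have S: "(F has_sum infsum F (SIGMA N:UNIV. bounded_parts (Suc N))) (SIGMA N:UNIV. bounded_parts (Suc N))"
    by (rule has_sum_infsum)
  have 1: "((\<lambda>N. z ^ N * q ^ Suc N * inverse (qpoch (q / z) q (Suc N))) has_sum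
      infsum F (SIGMA N:UNIV. bounded_parts (Suc N))) UNIV"
    using S inner by (rule has_sum_SigmaD)
  have "(f has_sum infsum F (SIGMA N:UNIV. bounded_parts (Suc N))) (all_partitions - {{#}})"
    using S has_sum_reindex_bij_betw[OF bij_betw_largest_part, of f]
    by (simp add: F_def case_prod_unfold)
  then have "(f has_sum (f {#} + infsum F (SIGMA N:UNIV. bounded_parts (Suc N)))) (insert {#} (all_partitions - {{#}}))"
    by (intro has_sum_insert) auto
  moreover have "insert {#} (all_partitions - {{#}}) = all_partitions"
    by (auto simp: all_partitions_def)
  moreover have "f {#} = 1"
    by (simp add: f_def prank_def)
  ultimately have "(f has_sum (1 + infsum F (SIGMA N:UNIV. bounded_parts (Suc N)))) all_partitions"
    by simp
  with has_sum_imp_sums[OF 1] show ?thesis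
    unfolding f_def[abs_def] by blast
qed

section \<open>Regrouping by the size of the partition\<close>

lemma finite_partitions_of: "finite (partitions_of n)"
proof (rule finite_subset)
  show "partitions_of n \<subseteq> mset ` {xs. set xs \<subseteq> {..n} \<and> length xs \<le> n}"
  proof
    fix P assume P: "P \<in> partitions_of n"
    obtain xs where xs: "P = mset xs"
      using ex_mset by metis
    have pos: "\<forall>x\<in>set xs. 0 < x" and s: "sum_list xs = n"
      using P by (auto simp: partitions_of_def xs sum_mset_sum_list)
    have "length xs \<le> sum_list xs" if "\<forall>x\<in>set xs. 0 < x" for xs :: "nat list"
      using that by (induction xs) auto
    then have "length xs \<le> n"
      using pos s by blast
    moreover have "set xs \<subseteq> {..n}"
      using member_le_sum_list s by auto
    ultimately show "P \<in> mset ` {xs. set xs \<subseteq> {..n} \<and> length xs \<le> n}"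
      using xs by blast
  qed
  show "finite (mset ` {xs. set xs \<subseteq> {..n} \<and> length xs \<le> n})"
    by (intro finite_imageI finite_lists_length_le) simp
qed

lemma sums_by_size:
  fixes h :: "nat multiset \<Rightarrow> complex" and q :: complex
  assumes "((\<lambda>P. h P * q ^ sum_mset P) has_sum S) all_partitions"
  shows "(\<lambda>n. (\<Sum>P\<in>partitions_of n. h P) * q ^ n) sums S"
proof -
  have "((\<lambda>(n, P). h P * q ^ n) has_sum S) (SIGMA n:UNIV. partitions_of n)"
    using assms
    by (subst has_sum_reindex_bij_witness[of _ "\<lambda>P. (sum_mset P, P)" snd all_partitions "\<lambda>P. h P * q ^ sum_mset P"])
       (auto simp: partitions_of_def all_partitions_def)
  then have "((\<lambda>n. (\<Sum>P\<in>partitions_of n. h P) * q ^ n) has_sum S) UNIV"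
  proof (rule has_sum_SigmaD)
    show "((\<lambda>P. case (n, P) of (n, P) \<Rightarrow> h P * q ^ n) has_sum (\<Sum>P\<in>partitions_of n. h P) * q ^ n) (partitions_of n)" for n
      unfolding prod.case by (intro has_sum_cmult_left has_sum_finite finite_partitions_of)
  qed
  then show ?thesis
    by (rule has_sum_imp_sums)
qed

section \<open>The rank generating function and its values at roots of unity\<close>

text \<open>The case \<open>\<alpha> = 0\<close> of the Rogers--Fine functional equation.\<close>

lemma rogers_fine_step:
  fixes q b t :: complex
  assumes nz: "\<And>i. q ^ i * b \<noteq> 1"
    and sm: "summable (\<lambda>N. t ^ N / qpoch b q N)"
  shows "(1 - t) * (\<Sum>N. t ^ N / qpoch b q N) =
    1 + b * t / (1 - b) * (\<Sum>N. (t * q) ^ N / qpoch (q * b) q N)"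
    and "summable (\<lambda>N. b * t / (1 - b) * ((t * q) ^ N / qpoch (q * b) q N))"
proof -
  define f where "f N = t ^ N / qpoch b q N" for N
  have qnz: "qpoch b q N \<noteq> 0" for N
    using nz by (simp add: qpoch_eq_0_iff)
  \<comment> \<open>The difference 1/(b)_(N+1) - 1/(b)_N equals b q^N/(b)_(N+1); q^N turns t into t
    q, and splitting off 1 - b turns b into q b.\<close>
  have "f (Suc N) - t * f N = b * t / (1 - b) * ((t * q) ^ N / qpoch (q * b) q N)" for N
  proof -
    have b: "1 - q ^ N * b \<noteq> 0" "1 - b \<noteq> 0"
      using nz[of N] nz[of 0] by auto
    have "f (Suc N) - t * f N = t ^ Suc N * (q ^ N * b) / qpoch b q (Suc N)"
      using b qnz[of N] by (simp add: f_def qpoch_Suc field_simps)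
    also have "\<dots> = b * t / (1 - b) * ((t * q) ^ N / qpoch (q * b) q N)"
      unfolding qpoch_Suc_shift by (simp add: power_mult_distrib)
    finally show ?thesis .
  qed
  then have eq: "(\<lambda>N. f (Suc N) - t * f N) = (\<lambda>N. b * t / (1 - b) * ((t * q) ^ N / qpoch (q * b) q N))"
    by auto
  have "summable f"
    using sm by (simp add: f_def[abs_def])
  moreover from this have "summable (\<lambda>N. f (Suc N))"
    by (simp only: summable_Suc_iff)
  ultimately have smf: "summable f" "summable (\<lambda>N. f (Suc N))" .
  show sm': "summable (\<lambda>N. b * t / (1 - b) * ((t * q) ^ N / qpoch (q * b) q N))"
    unfolding eq[symmetric] by (intro summable_diff summable_mult smf)
  have "suminf f = 1 + (\<Sum>N. f (Suc N))"
    using suminf_split_head[OF smf(1)] by (simp add: f_def)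
  then have "(1 - t) * suminf f = 1 + ((\<Sum>N. f (Suc N)) - (\<Sum>N. t * f N))"
    using suminf_mult[OF smf(1), of t] by (simp add: algebra_simps)
  also have "(\<Sum>N. f (Suc N)) - (\<Sum>N. t * f N) = (\<Sum>N. f (Suc N) - t * f N)"
    by (intro suminf_diff summable_mult smf)
  also have "\<dots> = b * t / (1 - b) * (\<Sum>N. (t * q) ^ N / qpoch (q * b) q N)"
  \<comment> \<open>Summability of the new series follows from \<open>sm'\<close> only when the
    factor is nonzero; otherwise both sides are 0.\<close>
  proof (cases "b * t / (1 - b) = 0")
    case False
    then have "summable (\<lambda>N. (t * q) ^ N / qpoch (q * b) q N)"
      using sm' by (rule summable_mult_D[rotated])
    then show ?thesis
      unfolding eq by (rule suminf_mult)
  next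
    case True
    show ?thesis
      unfolding eq True by simp
  qed
  finally show "(1 - t) * (\<Sum>N. t ^ N / qpoch b q N) =
      1 + b * t / (1 - b) * (\<Sum>N. (t * q) ^ N / qpoch (q * b) q N)"
    by (simp add: f_def)
qed

lemma unit_circle_nonpole:
  fixes q z :: complex
  assumes q: "q \<noteq> 0" "norm q < 1" and z: "norm z = 1" "z \<noteq> 1"
  shows "z \<noteq> 0" "z * q powi k \<noteq> 1"
proof -
  show "z \<noteq> 0"
    using z by auto
  show "z * q powi k \<noteq> 1"
  proof
    assume *: "z * q powi k = 1"
    then have "norm (q powi k) = 1"
      using z(1) by (metis mult_1 norm_mult norm_one)
    then have "k = 0"
      using norm_power_int_eq_1_iff[OF q] by simp
    then show False
      using * z by simp
  qed
qed

lemma qpoch_add: "qpoch x q (m + n) = qpoch x q m * qpoch (q ^ m * x) q n"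
  unfolding qpoch_def by (subst prod_lessThan_add) (simp add: power_add mult_ac)

text \<open>Each application of \<open>rogers_fine_step\<close> emits one term of the rank series.
  The factors b t contribute odd exponents 2n + 1, which add up to squares. The remainder vanishes
  in the limit because \<open>a\<close> tends to 0 and \<open>V\<close> is bounded.\<close>

lemma rank_series_largest_part:
  fixes q z :: complex
  assumes q: "q \<noteq> 0" "norm q < 1" and z: "norm z = 1" "z \<noteq> 1"
    and S: "(\<lambda>N. z ^ N * q ^ Suc N * inverse (qpoch (q / z) q (Suc N))) sums S"
  shows "1 + S = (1 - z) * rank_series z q"
proof -
  note zc = unit_circle_nonpole[OF q z]
  have nz: "1 - q ^ n * z \<noteq> 0" "1 - q ^ n / z \<noteq> 0" for n
    using one_minus_power_neq_0[OF q(1) zc] by auto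
  \<comment> \<open>These are the parameters after M steps; z cancels in their product
    q^(2M+1).\<close>
  define b t where "b = (\<lambda>M. q ^ Suc M / z)" and "t = (\<lambda>M. z * q ^ M)"
  define V where "V M = (\<Sum>N. t M ^ N / qpoch (b M) q N)" for M
  define a where "a n = q ^ n\<^sup>2 / (qpoch (q * z) q n * qpoch (q / z) q n)" for n
  have bnz: "q ^ i * b M \<noteq> 1" for i M
    using nz(2)[of "i + Suc M"] by (auto simp: b_def power_add)
  have qz_nz: "qpoch (q / z) q n \<noteq> 0" for n
    using bnz[of _ 0] by (auto simp: qpoch_eq_0_iff b_def)
  have lim_nz: "qpoch_inf (q / z) q \<noteq> 0"
    using bnz[of _ 0] by (auto simp: qpoch_inf_eq_0_iff[OF q(2)] b_def)
  have l: "(\<lambda>n. qpoch (q / z) q n) \<longlonglongrightarrow> qpoch_inf (q / z) q"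
    by (rule qpoch_tendsto[OF q(2)])
  have "Bseq (\<lambda>n. qpoch (q / z) q n)" "Bseq (\<lambda>n. inverse (qpoch (q / z) q n))"
    by (rule convergent_imp_Bseq convergentI l tendsto_inverse[OF l lim_nz])+
  then obtain K1 K2 where K: "K1 > 0" "\<And>n. norm (qpoch (q / z) q n) \<le> K1"
    "K2 > 0" "\<And>n. norm (inverse (qpoch (q / z) q n)) \<le> K2"
    by (auto simp: Bseq_def)
  \<comment> \<open>The reciprocal of (b M)_N is a quotient of two values of (q/z)_n, bounded in
    both directions. At M = 0 the ratio \<open>t M\<close> has modulus 1, so geometric domination
    begins at M = 1.\<close>
  have Vb: "norm (t M ^ N / qpoch (b M) q N) \<le> norm q ^ N * (K1 * K2)" if "M \<ge> 1" for M N
  proof -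
    have "qpoch (q / z) q (M + N) = qpoch (q / z) q M * qpoch (b M) q N"
      by (simp add: qpoch_add b_def mult_ac)
    then have "inverse (qpoch (b M) q N) = qpoch (q / z) q M * inverse (qpoch (q / z) q (M + N))"
      using qz_nz[of M] qz_nz[of "M + N"] by (auto simp: field_simps)
    then have 1: "norm (inverse (qpoch (b M) q N)) \<le> K1 * K2"
      unfolding norm_mult using K by (auto simp: norm_mult intro!: mult_mono)
    have "norm (t M) \<le> norm q"
      using z(1) q that power_decreasing[of 1 M "norm q"] by (simp add: t_def norm_mult norm_power)
    then have 2: "norm (t M ^ N) \<le> norm q ^ N"
      unfolding norm_power by (intro power_mono) auto
    show ?thesis
      unfolding divide_inverse norm_mult using 1 2 K by (intro mult_mono) auto
  qed
  have sumq: "summable (\<lambda>N. norm q ^ N * (K1 * K2))"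
    using q by (intro summable_mult2 summable_geometric) simp
  have smn: "summable (\<lambda>N. norm (t M ^ N / qpoch (b M) q N))" if "M \<ge> 1" for M
    by (rule summable_comparison_test[OF _ sumq]) (use Vb[OF that] in auto)
  then have sm: "summable (\<lambda>N. t M ^ N / qpoch (b M) q N)" if "M \<ge> 1" for M
    using that by (blast intro: summable_norm_cancel)
  have Vbound: "norm (V M) \<le> (\<Sum>N. norm q ^ N * (K1 * K2))" if "M \<ge> 1" for M
    unfolding V_def by (rule norm_suminf_le[OF Vb[OF that] sumq])
  have Vrec: "(1 - t M) * V M = 1 + b M * t M / (1 - b M) * V (Suc M)" if "M \<ge> 1" for M
  proof -
    have "t M * q = t (Suc M)" "q * b M = b (Suc M)"
      by (simp_all add: t_def b_def)
    then show ?thesis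
      unfolding V_def using rogers_fine_step(1)[OF bnz sm[OF that]] by simp
  qed
  have a_Suc: "a (Suc n) * (1 - t (Suc n)) = a n * (b n * t n / (1 - b n))" for n
  proof -
    have e: "(Suc n)\<^sup>2 = n\<^sup>2 + (Suc n + n)"
      by (simp add: power2_eq_square)
    have "a (Suc n) = q ^ (n\<^sup>2) * (q ^ Suc n * q ^ n) /
        (qpoch (q * z) q n * (1 - t (Suc n)) * (qpoch (q / z) q n * (1 - b n)))"
      unfolding a_def e power_add by (simp add: qpoch_Suc t_def b_def mult_ac)
    moreover have "q ^ Suc n * q ^ n = b n * t n"
      using zc(1) by (simp add: b_def t_def)
    moreover have "1 - t (Suc n) \<noteq> 0"
      using nz(1)[of "Suc n"] by (simp add: t_def mult_ac)
    ultimately show ?thesis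
      by (simp add: a_def)
  qed
  \<comment> \<open>The base case is step 0 done by hand: the series by largest part is q/(1 - q/z)
    times V 1, and the leading 1 is a(0).\<close>
  have partial: "1 + S = (\<Sum>n\<le>M. a n) + a (Suc M) * ((1 - t (Suc M)) * V (Suc M))" for M
  proof (induction M)
    case 0
    have "z ^ N * q ^ Suc N * inverse (qpoch (q / z) q (Suc N)) = q / (1 - q / z) * (t 1 ^ N / qpoch (b 1) q N)" for N
      unfolding qpoch_Suc_shift by (simp add: t_def b_def power_mult_distrib divide_inverse mult_ac power2_eq_square)
    then have "S = (\<Sum>N. q / (1 - q / z) * (t 1 ^ N / qpoch (b 1) q N))"
      using sums_unique[OF S] by simp
    also have "\<dots> = q / (1 - q / z) * V 1"
      unfolding V_def by (rule suminf_mult[OF sm]) simp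
    also have "q / (1 - q / z) = a (Suc 0) * (1 - t (Suc 0))"
      unfolding a_Suc using zc(1) by (simp add: a_def b_def t_def)
    finally show ?case
      by (simp add: a_def mult.assoc)
  next
    case (Suc M)
    have "a (Suc M) * ((1 - t (Suc M)) * V (Suc M)) =
        a (Suc M) + a (Suc M) * (b (Suc M) * t (Suc M) / (1 - b (Suc M))) * V (Suc (Suc M))"
      unfolding Vrec[of "Suc M", simplified] by (simp add: distrib_left)
    also have "a (Suc M) * (b (Suc M) * t (Suc M) / (1 - b (Suc M))) = a (Suc (Suc M)) * (1 - t (Suc (Suc M)))"
      by (rule a_Suc[symmetric])
    finally show ?case
      using Suc by (simp add: mult.assoc)
  qed
  have a_sums: "a sums ((1 - z) * rank_series z q)"
  proof -
    have "(\<lambda>n. (1 - z) * (q ^ n\<^sup>2 / (qpoch z q (n + 1) * qpoch (q / z) q n))) sums ((1 - z) * rank_series z q)"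
      unfolding rank_series_eq_appell(2)[OF q zc] by (intro sums_mult rank_series_eq_appell(1)[OF q zc])
    moreover have "(1 - z) * (q ^ n\<^sup>2 / (qpoch z q (n + 1) * qpoch (q / z) q n)) = a n" for n
      using z(2) by (simp add: a_def qpoch_Suc_shift)
    ultimately show ?thesis by simp
  qed
  have "(\<lambda>M. a (Suc M) * ((1 - t (Suc M)) * V (Suc M))) \<longlonglongrightarrow> 0"
  proof (rule Lim_null_comparison)
    have "a \<longlonglongrightarrow> 0"
      using a_sums by (intro summable_LIMSEQ_zero) (rule sums_summable)
    then have "(\<lambda>M. norm (a (Suc M))) \<longlonglongrightarrow> 0"
      by (intro tendsto_norm_zero LIMSEQ_Suc)
    then show "(\<lambda>M. norm (a (Suc M)) * (2 * (\<Sum>N. norm q ^ N * (K1 * K2)))) \<longlonglongrightarrow> 0"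
      by (rule tendsto_mult_left_zero)
    have "norm (1 - t (Suc M)) \<le> 2" for M
    proof -
      have "norm (1 - t (Suc M)) \<le> norm (1::complex) + norm (t (Suc M))"
        by (rule norm_triangle_ineq4)
      also have "norm (t (Suc M)) \<le> 1"
        using z(1) q power_le_one[of "norm q" "Suc M"] unfolding t_def norm_mult norm_power by simp
      finally show ?thesis by simp
    qed
    then have "norm (a (Suc M) * ((1 - t (Suc M)) * V (Suc M))) \<le>
        norm (a (Suc M)) * (2 * (\<Sum>N. norm q ^ N * (K1 * K2)))" for M
      unfolding norm_mult using Vbound[of "Suc M"] by (intro mult_left_mono mult_mono) auto
    then show "eventually (\<lambda>M. norm (a (Suc M) * ((1 - t (Suc M)) * V (Suc M))) \<le>
        norm (a (Suc M)) * (2 * (\<Sum>N. norm q ^ N * (K1 * K2)))) sequentially"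
      by simp
  qed
  moreover have "(\<lambda>M. \<Sum>n\<le>M. a n) \<longlonglongrightarrow> (1 - z) * rank_series z q"
    using a_sums by (simp add: sums_def_le)
  ultimately have "(\<lambda>M. (\<Sum>n\<le>M. a n) + a (Suc M) * ((1 - t (Suc M)) * V (Suc M))) \<longlonglongrightarrow> (1 - z) * rank_series z q + 0"
    by (rule tendsto_add[rotated])
  then have "(\<lambda>M::nat. 1 + S) \<longlonglongrightarrow> (1 - z) * rank_series z q"
    unfolding partial[symmetric] by simp
  then show ?thesis
    using LIMSEQ_unique tendsto_const by blast
qed

theorem rank_generating_function:
  fixes q z :: complex
  assumes q: "q \<noteq> 0" "norm q < 1" and z: "norm z = 1" "z \<noteq> 1"
  shows "(\<lambda>n. (\<Sum>P\<in>partitions_of n. z powi prank P) * q ^ n) sums ((1 - z) * rank_series z q)"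
proof -
  obtain S where S: "(\<lambda>N. z ^ N * q ^ Suc N * inverse (qpoch (q / z) q (Suc N))) sums S"
    "((\<lambda>P. z powi prank P * q ^ sum_mset P) has_sum (1 + S)) all_partitions"
    using rank_generating_function_largest_part[OF q z(1)] by blast
  show ?thesis
    using sums_by_size[OF S(2)] unfolding rank_series_largest_part[OF q z S(1)] .
qed

lemma fourth_roots_of_unity_filter:
  fixes r a :: int
  shows "(if r mod 4 = a mod 4 then 1 else 0) =
    (1 + \<i> powi (r - a) + (- 1) powi (r - a) + (- \<i>) powi (r - a)) / (4 :: complex)"
proof -
  define k e where "k = (r - a) div 4" and "e = (r - a) mod 4"
  have pw: "x powi (r - a) = x ^ nat e" if "x ^ 4 = 1" for x :: complex
  proof -
    have "r - a = 4 * k + int (nat e)"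
      by (simp add: k_def e_def)
    moreover have "x \<noteq> 0"
      using that by auto
    moreover have "x powi (4 * k) = 1"
      unfolding power_int_mult using that by simp
    ultimately show ?thesis
      by (simp only: power_int_add power_int_of_nat mult_1_left simp_thms)
  qed
  have p4: "\<i> ^ 4 = 1" "(- 1 :: complex) ^ 4 = 1" "(- \<i>) ^ 4 = 1"
    by (simp_all add: power4_eq_xxxx)
  have m: "r mod 4 = a mod 4 \<longleftrightarrow> e = 0"
    unfolding e_def by presburger
  have "e = 0 \<or> e = 1 \<or> e = 2 \<or> e = 3"
    unfolding e_def by presburger
  then show ?thesis
    unfolding m pw[OF p4(1)] pw[OF p4(2)] pw[OF p4(3)]
    by (elim disjE) (simp_all add: power3_eq_cube)
qed

text \<open>The trivial character contributes p(n), which the subtracted mean p(n)/4 removes; only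
  the three nontrivial fourth roots of unity remain.\<close>

lemma NrankMod_roots_of_unity:
  "of_nat (NrankMod a 4 n) - of_nat (pnum n) / of_nat 4 =
    (\<i> powi (- a) * (\<Sum>P\<in>partitions_of n. \<i> powi prank P)
      + (- 1) powi (- a) * (\<Sum>P\<in>partitions_of n. (- 1) powi prank P)
      + (- \<i>) powi (- a) * (\<Sum>P\<in>partitions_of n. (- \<i>) powi prank P)) / (4 :: complex)"
proof -
  have "of_nat (NrankMod a 4 n) = (\<Sum>P\<in>partitions_of n. if prank P mod 4 = a mod 4 then 1 else (0 :: complex))"
    unfolding NrankMod_def using finite_partitions_of[of n]
    by (subst sum.inter_filter[symmetric]) auto
  also have "\<dots> = (\<Sum>P\<in>partitions_of n. (1 + \<i> powi (- a) * \<i> powi prank P + (- 1) powi (- a) * (- 1) powi prank P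
      + (- \<i>) powi (- a) * (- \<i>) powi prank P) / 4)"
  proof (rule sum.cong[OF refl])
    fix P
    have pd: "x powi (r - a) = x powi (- a) * x powi r" if "x \<noteq> 0" for x :: complex and r
      using power_int_add[of x "- a" r] that by simp
    show "(if prank P mod 4 = a mod 4 then 1 else 0) =
      (1 + \<i> powi (- a) * \<i> powi prank P + (- 1) powi (- a) * (- 1) powi prank P
      + (- \<i>) powi (- a) * (- \<i>) powi prank P) / (4 :: complex)"
      unfolding fourth_roots_of_unity_filter by (subst (1 2 3) pd) simp_all
  qed
  also have "\<dots> = (of_nat (pnum n) + \<i> powi (- a) * (\<Sum>P\<in>partitions_of n. \<i> powi prank P)
      + (- 1) powi (- a) * (\<Sum>P\<in>partitions_of n. (- 1) powi prank P)
      + (- \<i>) powi (- a) * (\<Sum>P\<in>partitions_of n. (- \<i>) powi prank P)) / 4"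
    by (simp add: sum.distrib sum_distrib_left pnum_def flip: sum_divide_distrib)
  finally show ?thesis
    by (simp add: field_simps)
qed

text \<open>\<open>rank_series_inverse\<close> makes the contributions of the two imaginary roots
  equal. For odd residues they enter with opposite coefficients and cancel.\<close>

lemma Ddev_eq_rank_series:
  fixes q :: complex
  assumes q: "q \<noteq> 0" "norm q < 1"
  defines "f \<equiv> 2 * rank_series (- 1) q" and "\<phi> \<equiv> (1 - \<i>) * rank_series \<i> q"
  shows "Ddev 0 4 q = (2 * \<phi> + f) / 4" "Ddev 1 4 q = - f / 4"
    "Ddev 2 4 q = (f - 2 * \<phi>) / 4" "Ddev 3 4 q = - f / 4"
proof -
  have i1: "\<i> \<noteq> 1" "- \<i> \<noteq> 1"
    by (auto simp: complex_eq_iff)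
  have sym: "(1 - - \<i>) * rank_series (- \<i>) q = \<phi>"
    using rank_series_inverse[OF q unit_circle_nonpole[OF q, of "\<i>"]] i1
    by (simp add: \<phi>_def algebra_simps)
  have D: "Ddev a 4 q = (\<i> powi (- a) * \<phi> + (- 1) powi (- a) * f + (- \<i>) powi (- a) * \<phi>) / 4" for a
  proof -
    have "(\<lambda>n. (\<i> powi (- a) * ((\<Sum>P\<in>partitions_of n. \<i> powi prank P) * q ^ n)
      + (- 1) powi (- a) * ((\<Sum>P\<in>partitions_of n. (- 1) powi prank P) * q ^ n)
      + (- \<i>) powi (- a) * ((\<Sum>P\<in>partitions_of n. (- \<i>) powi prank P) * q ^ n)) / 4) sums
      ((\<i> powi (- a) * ((1 - \<i>) * rank_series \<i> q) + (- 1) powi (- a) * ((1 - - 1) * rank_series (- 1) q)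
      + (- \<i>) powi (- a) * ((1 - - \<i>) * rank_series (- \<i>) q)) / 4)"
      using i1 by (intro sums_divide sums_add sums_mult rank_generating_function q) auto
    also have "(\<lambda>n. (\<i> powi (- a) * ((\<Sum>P\<in>partitions_of n. \<i> powi prank P) * q ^ n)
      + (- 1) powi (- a) * ((\<Sum>P\<in>partitions_of n. (- 1) powi prank P) * q ^ n)
      + (- \<i>) powi (- a) * ((\<Sum>P\<in>partitions_of n. (- \<i>) powi prank P) * q ^ n)) / 4) =
      (\<lambda>n. (of_nat (NrankMod a 4 n) - of_nat (pnum n) / of_nat 4) * q ^ n)"
      unfolding NrankMod_roots_of_unity by (simp add: fun_eq_iff algebra_simps)
    finally show ?thesis
      unfolding Ddev_def sym by (simp add: sums_iff f_def \<phi>_def)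
  qed
  show "Ddev 0 4 q = (2 * \<phi> + f) / 4" "Ddev 1 4 q = - f / 4"
    "Ddev 2 4 q = (f - 2 * \<phi>) / 4" "Ddev 3 4 q = - f / 4"
    unfolding D by (simp_all add: power_int_minus power3_eq_cube field_simps)
qed

section \<open>Specialisation at fourth roots of unity\<close>

lemma gfun_eq_rank_series: "gfun x q = (1 / x) * (- 1 + rank_series x q)"
  by (simp add: gfun_def rank_series_def)

lemma G4_eq_rank_series:
  assumes "q \<noteq> 0"
  shows "G4 b0 b1 q = - b0 * rank_series (- (q\<^sup>2)) (q ^ 16) - b1 * ((rank_series (- (q ^ 6)) (q ^ 16) - 1) / q)"
proof -
  have "q\<^sup>2 * gfun (- (q\<^sup>2)) (q ^ 16) = 1 - rank_series (- (q\<^sup>2)) (q ^ 16)"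
    using assms by (simp add: gfun_eq_rank_series)
  moreover have "q ^ 5 * gfun (- (q ^ 6)) (q ^ 16) = - ((rank_series (- (q ^ 6)) (q ^ 16) - 1) / q)"
  proof -
    have "q ^ 6 = q ^ 5 * q"
      by (simp add: eval_nat_numeral)
    then show ?thesis
      using assms by (simp add: gfun_eq_rank_series field_simps)
  qed
  ultimately show ?thesis
    unfolding G4_def by (simp add: mult.assoc)
qed

text \<open>The four arguments are - q^2, - q^6, - q^10, - q^14. The reflection x -> q^16/x
  exchanges the outer two and the inner two, so only the two values that occur in \<open>G4\<close>
  survive.\<close>

lemma rank_dissection_at_root:
  assumes q: "q \<noteq> 0" "norm q < 1" and z: "z ^ 4 = 1"
  shows "rank_dissection q z =
    (1 - 1 / z) * (rank_series (- (q\<^sup>2)) (q ^ 16) + (rank_series (- (q ^ 6)) (q ^ 16) - 1) / (q * z\<^sup>2))"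
proof -
  note qq = base_power_conds[OF q]
  have z0: "z \<noteq> 0"
    using z by auto
  \<comment> \<open>For even m the exponent 2(m + 1) + 16k is 2 modulo 4 and hence not 0. The cases
    m = 0 and m = 2 license the reflections at - q^2 and - q^6.\<close>
  have odd: "- (q ^ (2 * Suc m)) * (q ^ 16) powi k \<noteq> 1" if "even m" for m and k :: int
  proof
    assume "- (q ^ (2 * Suc m)) * (q ^ 16) powi k = 1"
    moreover have "- (q ^ (2 * Suc m)) * (q ^ 16) powi k = - (q powi (2 * (int m + 1) + 16 * k))"
    proof -
      have "q ^ (2 * Suc m) = q powi (2 * (int m + 1))"
        by (subst power_int_of_nat[symmetric]) (simp add: algebra_simps del: power_int_of_nat)
      then show ?thesis
        using q by (simp add: power_int_add power_int_of_power)
    qed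
    ultimately have "norm (- (q powi (2 * (int m + 1) + 16 * k))) = 1"
      by simp
    then have "2 * (int m + 1) + 16 * k = 0"
      using norm_power_int_eq_1_iff[OF q] by simp
    then show False
      using that by presburger
  qed
  have "q ^ 16 / - (q ^ 6) = - (q ^ 10)" "q ^ 16 / (- (q ^ 6))\<^sup>2 = q ^ 4"
    "q ^ 16 / - (q\<^sup>2) = - (q ^ 14)" "q ^ 16 / (- (q\<^sup>2))\<^sup>2 = q ^ 12"
    using q(1) by (simp_all add: divide_simps flip: power_add power_mult)
  then have r: "rank_series (- (q ^ 10)) (q ^ 16) - 1 = q ^ 4 * (rank_series (- (q ^ 6)) (q ^ 16) - 1)"
    "rank_series (- (q ^ 14)) (q ^ 16) - 1 = q ^ 12 * (rank_series (- (q\<^sup>2)) (q ^ 16) - 1)"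
    using rank_series_reflect[OF qq(5,6), of "- (q ^ 6)"] rank_series_reflect[OF qq(5,6), of "- (q\<^sup>2)"]
      odd[of 0] odd[of 2] q(1) by auto
  have w: "- (q\<^sup>2 * z ^ 4) = - (q\<^sup>2)" "- (q\<^sup>2) * q ^ 4 = - (q ^ 6)" "- (q\<^sup>2) * q ^ 8 = - (q ^ 10)"
    "- (q\<^sup>2) * q ^ 12 = - (q ^ 14)"
    unfolding z by (simp_all flip: power_add)
  have zz: "1 / z ^ 3 = z" "1 / z ^ 6 = 1 / z\<^sup>2" "1 / z ^ 9 = 1 / z" "1 / z\<^sup>2 = z\<^sup>2" "1 / z = z ^ 3"
  proof -
    have "z ^ 3 * z = 1" "z ^ 6 = z ^ 4 * z\<^sup>2" "z ^ 9 = z ^ 4 * z ^ 4 * z" "z\<^sup>2 * z\<^sup>2 = 1"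
      using z by (simp_all add: eval_nat_numeral mult.assoc)
    then show "1 / z ^ 3 = z" "1 / z ^ 6 = 1 / z\<^sup>2" "1 / z ^ 9 = 1 / z" "1 / z\<^sup>2 = z\<^sup>2" "1 / z = z ^ 3"
      using z z0 by (simp_all add: field_simps)
  qed
  define X where "X = rank_series (- (q\<^sup>2)) (q ^ 16)"
  define Y where "Y = rank_series (- (q ^ 6)) (q ^ 16) - 1"
  have "rank_dissection q z = X - 1 / z - Y / q * (1 / z ^ 3) + q ^ 4 * Y / q ^ 5 * (1 / z ^ 6)
      - q ^ 12 * (X - 1) / q ^ 12 * (1 / z ^ 9)"
    unfolding rank_dissection_def w r X_def[symmetric] Y_def[symmetric] by simp
  also have "q ^ 4 * Y / q ^ 5 = Y / q"
    using q by (simp add: field_simps eval_nat_numeral)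
  also have "q ^ 12 * (X - 1) / q ^ 12 = X - 1"
    using q by simp
  finally have "rank_dissection q z = X * (1 - 1 / z) + Y / q * (1 / z\<^sup>2 - z)"
    unfolding zz(1,2,3) by (simp add: algebra_simps diff_divide_distrib)
  also have "1 / z\<^sup>2 - z = (1 - 1 / z) * (1 / z\<^sup>2)"
  proof -
    have "1 / z * (1 / z\<^sup>2) = 1 / z ^ 3"
      by (simp add: power2_eq_square power3_eq_cube)
    then show ?thesis
      unfolding left_diff_distrib zz(1) by simp
  qed
  finally have "rank_dissection q z = X * (1 - 1 / z) + Y / q * ((1 - 1 / z) * (1 / z\<^sup>2))" .
  then show ?thesis
    unfolding X_def[symmetric] Y_def[symmetric] by (simp only: distrib_left divide_inverse inverse_mult_distrib mult_ac mult_1_left)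
qed

text \<open>The change z -> -z flips only the odd theta function, which can therefore be eliminated
  by means of the known value at 1.\<close>

lemma theta_num_at_minus_1:
  assumes q: "q \<noteq> 0" "norm q < 1"
  shows "theta_num q (- 1) = - (2 * eta 2 q * jfun (- q) (q\<^sup>2) + (eta 1 q)\<^sup>2) * jfun (- (q\<^sup>2)) (q ^ 4)"
  using theta_num_at_1[OF q] by (simp add: theta_num_def algebra_simps)

text \<open>At the imaginary unit - q z^2 = q, and the odd theta function has argument q^2 to base
  q^2, one of its zeros.\<close>

lemma theta_num_at_imaginary_unit:
  assumes q: "q \<noteq> 0" "norm q < 1"
  shows "theta_num q \<i> = - (eta 2 q * jfun q (q\<^sup>2)) * jfun (- (q\<^sup>2)) (q ^ 4)"
proof -
  have "jfun (q\<^sup>2) (q\<^sup>2) = 0"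
    using q base_power_conds[OF q] by (subst jfun_eq_0_iff) (auto intro!: exI[of _ "- 1"] simp: power_int_minus)
  then show ?thesis
    by (simp add: theta_num_def)
qed

lemma jfun_minus_square_nonzero:
  assumes q: "q \<noteq> 0" "norm q < 1"
  shows "jfun (- (q\<^sup>2)) (q ^ 4) \<noteq> 0"
  using jfun_eta(2)[OF base_power_conds(1,2)[OF q]] eta_nonzero[OF q(2)]
  by (simp add: eta_power flip: power_mult)

lemma rank_series_at_minus_1:
  assumes q: "q \<noteq> 0" "norm q < 1"
  shows "2 * rank_series (- 1) q =
    - 4 * G4 1 1 q - eta 1 q / eta 2 q * (2 * jfun (- q) (q\<^sup>2) + jfun q (q\<^sup>2))"
proof -
  note nz = eta_nonzero[OF q(2)]
  note p = jfun_minus_square_nonzero[OF q]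
  have den: "theta_den q (- 1) = 2 * (eta 2 q)\<^sup>2 / eta 1 q * jfun (- (q\<^sup>2)) (q ^ 4)"
    by (simp add: theta_den_def jfun_eta(3)[OF q])
  then have "theta_den q (- 1) \<noteq> 0"
    using nz p by simp
  then have "rank_series (- 1) q = rank_dissection q (- 1) + theta_num q (- 1) / theta_den q (- 1)"
    by (intro rank_series_dissection q) auto
  moreover have "rank_dissection q (- 1) = - 2 * G4 1 1 q"
    using rank_dissection_at_root[OF q, of "- 1"] q(1)
    by (simp add: G4_eq_rank_series algebra_simps diff_divide_distrib)
  moreover have "2 * (theta_num q (- 1) / theta_den q (- 1)) =
      - (eta 1 q / eta 2 q * (2 * jfun (- q) (q\<^sup>2) + jfun q (q\<^sup>2)))"
    unfolding theta_num_at_minus_1[OF q] den jfun_eta(1)[OF q] using nz[of 1] nz[of 2] p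
    by (simp add: field_simps power2_eq_square)
  ultimately show ?thesis
    by (simp add: distrib_left)
qed

lemma rank_series_at_imaginary_unit:
  assumes q: "q \<noteq> 0" "norm q < 1"
  shows "(1 - \<i>) * rank_series \<i> q =
    2 * G4 (- 1) 1 q - (eta 2 q)\<^sup>2 / (eta 1 q * eta 4 q) * jfun q (q\<^sup>2)"
proof -
  note nz = eta_nonzero[OF q(2)]
  note p = jfun_minus_square_nonzero[OF q]
  have i1: "1 - \<i> \<noteq> 0"
    by (auto simp: complex_eq_iff)
  have den: "theta_den q \<i> = (1 - \<i>) * (eta 1 q * eta 4 q / eta 2 q) * jfun (- (q\<^sup>2)) (q ^ 4)"
    using jfun_imaginary_eta(1)[OF q, of \<i>] by (simp add: theta_den_def)
  then have "theta_den q \<i> \<noteq> 0"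
    using nz p i1 by simp
  then have "rank_series \<i> q = rank_dissection q \<i> + theta_num q \<i> / theta_den q \<i>"
    by (intro rank_series_dissection q) auto
  moreover have "(1 - \<i>) * rank_dissection q \<i> = 2 * G4 (- 1) 1 q"
  proof -
    have "(1 - \<i>) * (1 - 1 / \<i>) = 2"
      by (simp add: algebra_simps)
    moreover have "\<i> ^ 4 = 1"
      by (simp add: power4_eq_xxxx)
    ultimately have "(1 - \<i>) * rank_dissection q \<i> =
        2 * (rank_series (- (q\<^sup>2)) (q ^ 16) + (rank_series (- (q ^ 6)) (q ^ 16) - 1) / (q * \<i>\<^sup>2))"
      using rank_dissection_at_root[OF q, of \<i>] by (simp only: mult.assoc[symmetric])
    then show ?thesis
      using q(1) by (simp add: G4_eq_rank_series algebra_simps diff_divide_distrib)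
  qed
  moreover have "(1 - \<i>) * (theta_num q \<i> / theta_den q \<i>) =
      - ((eta 2 q)\<^sup>2 / (eta 1 q * eta 4 q) * jfun q (q\<^sup>2))"
    unfolding theta_num_at_imaginary_unit[OF q] den using nz[of 1] nz[of 2] nz[of 4] p i1
    by (simp add: divide_simps power2_eq_square)
  ultimately show ?thesis
    by (simp add: distrib_left)
qed

text \<open>The 2-dissections of phi(-q), phi(q), psi(-q) and psi(q); their components are the four
  \<open>Jbar\<close> of \<open>theta4\<close>.\<close>

lemma jfun_dissect_Jbar:
  assumes q: "q \<noteq> 0" "norm q < 1"
  shows "jfun q (q\<^sup>2) = Jbar 4 8 q - q * Jbar 0 8 q"
    and "jfun (- q) (q\<^sup>2) = Jbar 4 8 q + q * Jbar 0 8 q"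
    and "eta 1 q * eta 4 q / eta 2 q = Jbar 6 16 q - q * Jbar 14 16 q"
    and "(eta 2 q)\<^sup>2 / eta 1 q = Jbar 6 16 q + q * Jbar 14 16 q"
proof -
  note qq = base_power_conds[OF q]
  have J: "Jbar 4 8 q = jfun (- (q ^ 4)) (q ^ 8)" "Jbar 6 16 q = jfun (- (q ^ 6)) (q ^ 16)"
    "Jbar 14 16 q = jfun (- (q ^ 14)) (q ^ 16)"
    by (simp_all add: Jbar_def)
  \<comment> \<open>The dissection yields the argument - q^8, the definition of
    \<open>Jbar 0 8\<close> the argument -1; x -> q^8/x identifies them.\<close>
  have J0: "Jbar 0 8 q = jfun (- (q ^ 8)) (q ^ 8)"
    using jfun_commute[of "q ^ 8" "- 1"] q by (simp add: Jbar_def)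
  have e: "(q\<^sup>2) ^ 4 = q ^ 8" "q\<^sup>2 * q\<^sup>2 = q ^ 4" "(q\<^sup>2) ^ 3 * q\<^sup>2 = q ^ 8" "(q ^ 4) ^ 4 = q ^ 16"
    "q ^ 4 * q\<^sup>2 = q ^ 6" "(q ^ 4) ^ 3 * q\<^sup>2 = q ^ 14"
    by (simp_all flip: power_mult power_add)
  show "jfun q (q\<^sup>2) = Jbar 4 8 q - q * Jbar 0 8 q" "jfun (- q) (q\<^sup>2) = Jbar 4 8 q + q * Jbar 0 8 q"
    using jfun_parity[OF qq(1,2), of q] jfun_parity[OF qq(1,2), of "- q"] q(1)
    by (simp_all add: J J0 e)
  show "eta 1 q * eta 4 q / eta 2 q = Jbar 6 16 q - q * Jbar 14 16 q"
    "(eta 2 q)\<^sup>2 / eta 1 q = Jbar 6 16 q + q * Jbar 14 16 q"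
    unfolding jfun_eta(5,6)[OF q, symmetric]
    using jfun_parity[OF qq(3,4), of q] jfun_parity[OF qq(3,4), of "- q"] q(1)
    by (simp_all add: J e)
qed

lemma J1_eq_eta:
  assumes q: "q \<noteq> 0" "norm q < 1"
  shows "J1 4 q = eta 4 q"
  using jfun_q_cubed(1)[OF base_power_conds(3,4)[OF q]] by (simp add: J1_def J2_def eta_def flip: power_mult)

theorem theorem1p4:
  fixes q :: complex
  assumes "0 < norm q" and "norm q < 1"
  shows "Ddev 0 4 q = theta4 (-5) 3 1 1 q + 2 * G4 (-1) 0 q
    \<and> Ddev 1 4 q = Ddev 3 4 q
    \<and> Ddev 3 4 q = theta4 3 (-1) (-3) 1 q + G4 1 1 q
    \<and> Ddev 2 4 q = theta4 (-1) (-1) 5 (-3) q + 2 * G4 0 (-1) q"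
proof -
  have q: "q \<noteq> 0" "norm q < 1"
    using assms by auto
  note nz = eta_nonzero[OF q(2)]
  \<comment> \<open>With the powers of q absorbed into \<open>b\<close> and \<open>d\<close>,
    \<open>theta4\<close> is a bilinear form in (a, b) and (c, d).\<close>
  define a b c d e where "a = Jbar 4 8 q" and "b = q * Jbar 0 8 q" and "c = Jbar 6 16 q"
    and "d = q * Jbar 14 16 q" and "e = eta 4 q"
  have e0: "e \<noteq> 0"
    using nz by (simp add: e_def)
  note J = jfun_dissect_Jbar[OF q, folded a_def b_def c_def d_def]
  have e1: "eta 1 q / eta 2 q = (c - d) / e"
    using J(3) e0 by (simp add: e_def field_simps)
  have e2: "(eta 2 q)\<^sup>2 / (eta 1 q * eta 4 q) = (c + d) / e"
    using J(4) by (simp add: e_def flip: divide_divide_eq_left)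
  have f: "2 * rank_series (- 1) q = - 4 * G4 1 1 q - (c - d) * (3 * a + b) / e"
    unfolding rank_series_at_minus_1[OF q] J e1 by (simp add: algebra_simps add_divide_distrib diff_divide_distrib)
  have phi: "(1 - \<i>) * rank_series \<i> q = 2 * G4 (- 1) 1 q - (c + d) * (a - b) / e"
    unfolding rank_series_at_imaginary_unit[OF q] J e2 by simp
  have theta: "theta4 a0 a1 a2 a3 q = (a0 * a * c + a1 * b * d + a2 * a * d + a3 * b * c) / (4 * e)" for a0 a1 a2 a3
    unfolding theta4_def J1_eq_eta[OF q] by (simp add: a_def b_def c_def d_def e_def power2_eq_square mult_ac)
  \<comment> \<open>Expanding the products yields the constants: -2 (c + d)(a - b) - (c - d)(3a +
    b), for instance, has coefficients -5, 3, 1, 1 on ac, bd, ad, bc. \<open>G4\<close> is linear in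
    its two coefficients, so its contributions add.\<close>
  show ?thesis
    unfolding Ddev_eq_rank_series[OF q] f phi theta G4_eq_rank_series[OF q(1)] using e0
    by (simp add: divide_simps) (simp add: algebra_simps)
qed

end
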